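(* Let $n\ge 2$, $q\in\{1,\ldots,n-1\}$, $\gamma\in\{0,\ldots,q-1\}$, and let $H:A(n,n-q+\gamma)\to[0,\infty)$ be measurable and rotation invariant, so that $H(E)=H_I(d(o,E))$ for a function $H_I:[0,\infty)\to[0,\infty)$. Then for all measurable $f:A(n,\gamma)\to[0,\infty)$, $$\int_{G(n,q)}\int_{A(n,n-q+\gamma)} f(E\cap L)\,H(E)\,\mu_{n-q+\gamma}(dE)\,\nu_q(dL)=D(n,q,\gamma)\int_{A(n,\gamma)} f(E)\,d(o,E)^{-(n-q)}\,J_H(d(o,E))\,\mu_\gamma(dE),$$ where $$J_H(r)=\int_0^1 H_I(rz)\,z^{q}(1-z^2)^{\frac{n-q}{2}-1}\,dz,\qquad D(n,q,\gamma)=\frac{\omega_{\gamma+1}\,\omega_{q-\gamma}\,\omega_{n-q}}{\omega_{n-(q-\gamma)+1}\,\omega_{n-\gamma}}.$$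
   Context: $\omega_m=2\pi^{m/2}/\Gamma(m/2)$ is the surface area of $S^{m-1}$. $G(n,k)$ is the Grassmannian of $k$-dimensional linear subspaces of $\mathbb{R}^n$ with unique $SO_n$-invariant probability measure $\nu_k$; $A(n,k)$ is the space of $k$-dimensional affine subspaces with motion invariant measure $\mu_k(\cdot)=\int_{G(n,k)}\int_{L^\perp}1\{L+x\in\cdot\}\,\lambda_{L^\perp}(dx)\,\nu_k(dL)$, $\lambda_{L^\perp}$ Lebesgue measure on $L^\perp$. $d(o,E)=\inf_{x\in E}\|x\|$. A function $H$ on $A(n,k)$ is rotation invariant if $H(\eta E)=H(E)$ for all $\eta\in SO_n$; then it depends only on $d(o,E)$. For almost all $(E,L)$, $E\cap L$ is a $\gamma$-dimensional affine subspace. *)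

theory Defs
  imports "HOL-Probability.Probability"
begin

text \<open>Surface area of the unit sphere S^(m-1) in R^m.\<close>
definition omega :: "nat \<Rightarrow> real" where
  "omega m = 2 * pi powr (real m / 2) / Gamma (real m / 2)"

definition rotations :: "((real^'n) \<Rightarrow> (real^'n)) set" where
  "rotations = {f. orthogonal_transformation f \<and> det (matrix f) = 1}"

definition Grass :: "nat \<Rightarrow> (real^'n) set set" where
  "Grass k = {L. subspace L \<and> dim L = k}"

definition AffGrass :: "nat \<Rightarrow> (real^'n) set set" where
  "AffGrass k = {E. \<exists>L\<in>Grass k. \<exists>x. E = (\<lambda>y. y + x) ` L}"

text \<open>Borel sigma-algebra on a family of closed sets (Fell topology), generated by the
  distance functions E \<mapsto> d(x,E).\<close>
definition set_sigma :: "(real^'n) set set \<Rightarrow> (real^'n) set measure" where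
  "set_sigma \<Omega> = sigma \<Omega> {{E\<in>\<Omega>. infdist x E \<in> B} | x B. B \<in> sets borel}"

definition nu :: "nat \<Rightarrow> (real^'n) set measure" where
  "nu k = (THE M. sets M = sets (set_sigma (Grass k)) \<and> prob_space M \<and>
             (\<forall>\<eta>\<in>rotations. distr M M (\<lambda>L. \<eta> ` L) = M))"

definition onb :: "(real^'n) set \<Rightarrow> nat \<Rightarrow> real^'n" where
  "onb V = (SOME b. (\<forall>i<dim V. \<forall>j<dim V. b i \<bullet> b j = (if i = j then 1 else 0))
                    \<and> span (b ` {..<dim V}) = V)"

definition lebesgue_sub :: "(real^'n) set \<Rightarrow> (real^'n) measure" where
  "lebesgue_sub V = distr (PiM {..<dim V} (\<lambda>_. lborel)) borel
                          (\<lambda>c. \<Sum>i<dim V. c i *\<^sub>R onb V i)"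

definition mu :: "nat \<Rightarrow> (real^'n) set measure" where
  "mu k = measure_of (AffGrass k) (sets (set_sigma (AffGrass k)))
     (\<lambda>A. \<integral>\<^sup>+ L. (\<integral>\<^sup>+ x. indicator A ((\<lambda>y. y + x) ` L) \<partial>lebesgue_sub (orthogonal_comp L)) \<partial>nu k)"

definition JH :: "(real \<Rightarrow> real) \<Rightarrow> nat \<Rightarrow> nat \<Rightarrow> real \<Rightarrow> ennreal" where
  "JH HI n q r = (\<integral>\<^sup>+ z. ennreal (HI (r * z) * z ^ q * (1 - z\<^sup>2) powr ((real n - real q) / 2 - 1))
                        * indicator {0..1} z \<partial>lborel)"

definition Dconst :: "nat \<Rightarrow> nat \<Rightarrow> nat \<Rightarrow> real" where
  "Dconst n q \<gamma> = omega (\<gamma> + 1) * omega (q - \<gamma>) * omega (n - q)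
                   / (omega (n - (q - \<gamma>) + 1) * omega (n - \<gamma>))"

end

theory Submission
  imports Defs
begin

text \<open>Both sides are invariant under rotations, so \<open>f\<close> may be replaced by its average over the
  rotation group, a function \<open>\<phi>\<close> of the distance of a flat from the origin. It remains to find the
  distribution of \<open>d(o, E \<inter> L)\<close> for a fixed flat \<open>E\<close> at distance \<open>s\<close> and a random \<open>L\<close>. Let \<open>W\<close> be the
  linear span of \<open>E\<close> and \<open>u \<in> W\<close> its unit normal vector, so that \<open>E = {y \<in> W. y \<bullet> u = s}\<close> and
  \<open>d(o, E \<inter> L) = s / z\<close>, where \<open>z\<close> is the length of the projection of \<open>u\<close> onto \<open>W \<inter> L\<close>. By rotation
  invariance \<open>u\<close> may be taken uniform on the unit sphere of \<open>W\<close>, and almost surely \<open>W \<inter> L\<close> has dimension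
  \<open>\<gamma> + 1\<close> in the \<open>(n - q + \<gamma> + 1)\<close>-dimensional space \<open>W\<close>, so \<open>z\<close> has a density proportional to
  \<open>z ^ \<gamma> * (1 - z\<^sup>2) powr ((n - q) / 2 - 1)\<close>. The substitution \<open>s = r z\<close> gives \<open>J\<^sub>H\<close>.\<close>

text \<open>The measures in the statement are described rather than constructed: \<open>nu\<close>
  by \<open>THE\<close>, \<open>mu\<close> by a set function not known to be additive,
  \<open>lebesgue_sub\<close> through an arbitrarily chosen basis. An explicit Haar measure on
  rotation matrices settles \<open>nu\<close>. A Gaussian weight of mass one along the complementary
  directions replaces the chosen basis by an expression jointly measurable in subspace and point.
  Since the sigma-algebras know only the functions \<open>infdist x\<close>, projections,
  dimensions, directions and intersections must all be recovered from distances. The Gaussian also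
  supplies the uniform direction, since its length and direction are independent. The constant has
  two sources. The law of \<open>z\<close> contributes \<open>omega (\<gamma> + 1) * omega (n - q) /
  omega (n - q + \<gamma> + 1)\<close>. The factor
  \<open>omega (q - \<gamma>) / omega (n - \<gamma>)\<close> and the negative power of the distance
  compare the radial densities of flats of codimension \<open>q - \<gamma>\<close> and
  \<open>n - \<gamma>\<close>. The exponent \<open>q\<close> of \<open>z\<close> is
  \<open>\<gamma>\<close> from the law of \<open>z\<close> plus \<open>q - \<gamma>\<close> from
  rescaling the radial density.\<close>

section \<open>Orthogonal projections and distances to subspaces and slices\<close>

definition proj :: "'a::euclidean_space set \<Rightarrow> 'a \<Rightarrow> 'a" where
  "proj V x = (SOME p. p \<in> V \<and> (\<forall>w\<in>V. (x - p) \<bullet> w = 0))"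

lemma proj_spec:
  assumes "subspace V"
  shows "proj V x \<in> V \<and> (\<forall>w\<in>V. (x - proj V x) \<bullet> w = 0)"
proof -
  obtain y z where "y \<in> span V" "\<And>w. w \<in> span V \<Longrightarrow> orthogonal z w" "x = y + z"
    using orthogonal_subspace_decomp_exists by blast
  then have "\<exists>p. p \<in> V \<and> (\<forall>w\<in>V. (x - p) \<bullet> w = 0)"
    using assms by (intro exI[of _ y]) (auto simp: orthogonal_def span_eq_iff[THEN iffD2])
  then show ?thesis unfolding proj_def by (rule someI_ex)
qed

lemma proj_in: "subspace V \<Longrightarrow> proj V x \<in> V"
  using proj_spec by blast

lemma proj_orth: "subspace V \<Longrightarrow> w \<in> V \<Longrightarrow> (x - proj V x) \<bullet> w = 0"
  using proj_spec by blast

lemma proj_eqI: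
  assumes "subspace V" "p \<in> V" "\<And>w. w \<in> V \<Longrightarrow> (x - p) \<bullet> w = 0"
  shows "proj V x = p"
proof -
  have "p - proj V x \<in> V" using assms proj_in subspace_diff by blast
  then have "(p - proj V x) \<bullet> (p - proj V x) = 0"
    using assms(3)[of "p - proj V x"] proj_orth[OF assms(1), of "p - proj V x" x]
    by (simp add: inner_diff_left)
  then show ?thesis by simp
qed

lemma proj_add: "subspace V \<Longrightarrow> proj V (x + y) = proj V x + proj V y"
  by (rule proj_eqI) (simp_all add: proj_in subspace_add add_diff_add inner_add_left proj_orth)

lemma proj_scaleR: "subspace V \<Longrightarrow> proj V (c *\<^sub>R x) = c *\<^sub>R proj V x"
  by (rule proj_eqI) (simp_all add: proj_in subspace_scale scaleR_diff_right[symmetric] proj_orth)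

lemma proj_id: "subspace V \<Longrightarrow> x \<in> V \<Longrightarrow> proj V x = x"
  by (rule proj_eqI) auto

lemma proj_inner: "subspace V \<Longrightarrow> w \<in> V \<Longrightarrow> proj V x \<bullet> w = x \<bullet> w"
  using proj_orth[of V w x] by (simp add: inner_diff_left)

lemma proj_inner_self: "subspace V \<Longrightarrow> proj V x \<bullet> x = (norm (proj V x))\<^sup>2"
  by (metis inner_commute power2_norm_eq_inner proj_in proj_inner)

lemma proj_pythagoras:
  "subspace V \<Longrightarrow> (norm x)\<^sup>2 = (norm (proj V x))\<^sup>2 + (norm (x - proj V x))\<^sup>2"
  using proj_inner_self[of V x]
  by (simp add: power2_norm_eq_inner inner_diff_left inner_diff_right inner_commute)

lemma proj_dist_sq:
  assumes "subspace V" "w \<in> V"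
  shows "(dist x w)\<^sup>2 = (norm (x - proj V x))\<^sup>2 + (norm (proj V x - w))\<^sup>2"
proof -
  have "proj V x - w \<in> V" using assms proj_in subspace_diff by blast
  from proj_orth[OF assms(1) this, of x] have "(x - proj V x) \<bullet> (proj V x - w) = 0" .
  then have "(norm ((x - proj V x) + (proj V x - w)))\<^sup>2 = (norm (x - proj V x))\<^sup>2 + (norm (proj V x - w))\<^sup>2"
    by (rule norm_add_Pythagorean[unfolded orthogonal_def])
  then show ?thesis by (simp add: dist_norm)
qed

lemma infdist_eqI:
  assumes "a \<in> A" "dist x a = r" "\<And>b. b \<in> A \<Longrightarrow> r \<le> dist x b"
  shows "infdist x A = r"
proof (rule antisym)
  show "infdist x A \<le> r" using assms(1,2) infdist_le by blast
  show "r \<le> infdist x A"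
    using assms by (subst infdist_notempty) (auto intro!: cINF_greatest)
qed

lemma infdist_subspace: "subspace V \<Longrightarrow> infdist x V = norm (x - proj V x)"
proof (rule infdist_eqI[of "proj V x"])
  assume V: "subspace V"
  fix b assume "b \<in> V"
  then have "(norm (x - proj V x))\<^sup>2 \<le> (dist x b)\<^sup>2" by (simp only: proj_dist_sq[OF V] le_add_same_cancel1 zero_le_power2)
  then show "norm (x - proj V x) \<le> dist x b" by (rule power2_le_imp_le) simp
qed (simp_all add: proj_in dist_norm)

lemma infdist_subspace_sq:
  "subspace V \<Longrightarrow> (infdist x V)\<^sup>2 = (norm x)\<^sup>2 - (norm (proj V x))\<^sup>2"
  using proj_pythagoras[of V x] by (simp add: infdist_subspace)

text \<open>Subspaces are observed only through distances. Polarization expresses the coordinates of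
  a projection by such distances, which makes projections visible to the sigma-algebra.\<close>

lemma proj_polarization:
  assumes "subspace V"
  shows "proj V x \<bullet> y = ((norm (x + y))\<^sup>2 - (infdist (x + y) V)\<^sup>2
    - (norm (x - y))\<^sup>2 + (infdist (x - y) V)\<^sup>2) / 4"
proof -
  have "proj V x \<bullet> proj V y = proj V x \<bullet> y"
    using proj_inner[OF assms proj_in[OF assms]] by (metis inner_commute)
  moreover have m: "proj V (x - y) = proj V x - proj V y"
    using proj_add[OF assms, of x "- y"] proj_scaleR[OF assms, of "-1" y] by simp
  ultimately show ?thesis
    unfolding infdist_subspace_sq[OF assms] m proj_add[OF assms] power2_norm_eq_inner
      inner_add_left inner_add_right inner_diff_left inner_diff_right
    by (simp add: inner_commute)
qed

text \<open>On \<open>X\<close> the functional given by \<open>v\<close> agrees with the one given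
  by \<open>proj X v\<close>, so the slice is a hyperplane of \<open>X\<close> with that normal.
  Pythagoras separates the distance from \<open>z\<close> to \<open>X\<close> from the distance
  inside \<open>X\<close>. The vector \<open>v\<close> may lie outside \<open>X\<close>, which
  allows \<open>X\<close> to be an intersection with a random subspace.\<close>

lemma infdist_slice:
  assumes X: "subspace X" and P: "proj X v \<noteq> 0"
  shows "infdist z {y\<in>X. y \<bullet> v = c} = sqrt ((infdist z X)\<^sup>2 + ((c - z \<bullet> proj X v) / norm (proj X v))\<^sup>2)"
proof -
  let ?P = "proj X v" and ?Q = "proj X z"
  \<comment> \<open>The foot of the perpendicular: \<open>?Q\<close> is moved along the normal
    \<open>?P\<close> until the inner product reaches \<open>c\<close>.\<close>
  let ?y = "?Q + ((c - z \<bullet> ?P) / (norm ?P)\<^sup>2) *\<^sub>R ?P"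
  have PX: "?P \<in> X" "?Q \<in> X" using X proj_in by auto
  have QP: "?Q \<bullet> ?P = z \<bullet> ?P" using X PX proj_inner by blast
  have yv: "y \<bullet> v = y \<bullet> ?P" if "y \<in> X" for y
    using X that by (metis inner_commute proj_inner)
  have ds: "dist z y = sqrt ((infdist z X)\<^sup>2 + (norm (?Q - y))\<^sup>2)" if "y \<in> X" for y
    using proj_dist_sq[OF X that, of z] by (simp add: infdist_subspace[OF X] real_sqrt_unique)
  have yX: "?y \<in> X" using PX X by (simp add: subspace_add subspace_scale)
  show ?thesis
  proof (rule infdist_eqI)
    show "?y \<in> {y\<in>X. y \<bullet> v = c}"
    proof -
      have "?y \<bullet> v = z \<bullet> ?P + (c - z \<bullet> ?P) / (norm ?P)\<^sup>2 * (?P \<bullet> ?P)"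
        unfolding yv[OF yX] by (simp only: inner_add_left QP inner_scaleR_left)
      also have "\<dots> = c" using P by (simp add: power2_norm_eq_inner)
      finally show ?thesis using yX by simp
    qed
    have "norm (?Q - ?y) = \<bar>c - z \<bullet> ?P\<bar> / norm ?P"
      using P by (simp add: power2_eq_square)
    then show "dist z ?y = sqrt ((infdist z X)\<^sup>2 + ((c - z \<bullet> ?P) / norm ?P)\<^sup>2)"
      by (simp add: ds[OF yX] power_divide)
  next
    fix y assume y: "y \<in> {y\<in>X. y \<bullet> v = c}"
    then have "\<bar>c - z \<bullet> ?P\<bar> = \<bar>(?Q - y) \<bullet> ?P\<bar>"
      using yv[of y] by (simp add: inner_diff_left QP)
    also have "\<dots> \<le> norm (?Q - y) * norm ?P" by (rule Cauchy_Schwarz_ineq2)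
    finally have "\<bar>c - z \<bullet> ?P\<bar> / norm ?P \<le> norm (?Q - y)" using P by (simp add: divide_simps)
    then have "((c - z \<bullet> ?P) / norm ?P)\<^sup>2 \<le> (norm (?Q - y))\<^sup>2"
      by (simp add: abs_le_square_iff[symmetric])
    then show "sqrt ((infdist z X)\<^sup>2 + ((c - z \<bullet> ?P) / norm ?P)\<^sup>2) \<le> dist z y"
      using y ds[of y] by simp
  qed
qed

lemma dim_slice:
  assumes X: "subspace X" and P: "proj X v \<noteq> 0"
  shows "dim {y\<in>X. y \<bullet> v = 0} = dim X - 1"
proof -
  have yv: "y \<bullet> v = y \<bullet> proj X v" if "y \<in> X" for y
    using X that by (metis inner_commute proj_inner)
  have "span {proj X v} \<subseteq> X" by (rule span_minimal) (use X proj_in in auto)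
  from dim_subspace_orthogonal_to_vectors[OF subspace_span X this]
  have "dim {y \<in> X. \<forall>x\<in>span {proj X v}. orthogonal x y} + 1 = dim X"
    using P by (simp add: dim_insert)
  moreover have "{y \<in> X. \<forall>x\<in>span {proj X v}. orthogonal x y} = {y\<in>X. y \<bullet> v = 0}"
    using yv by (auto simp: span_singleton orthogonal_def inner_commute)
  ultimately show ?thesis by simp
qed

lemma subspace_slice: "subspace X \<Longrightarrow> subspace {y\<in>X. y \<bullet> v = 0}"
  by (auto simp: subspace_def inner_add_left)

subsection \<open>Orthonormal systems\<close>

text \<open>The orthonormality clause of \<open>onb\<close>, for systems of any length
  \<open>d\<close>. Indexing by numbers makes prefixes of a system correspond to subspaces.\<close>

definition ons :: "(nat \<Rightarrow> 'a::euclidean_space) \<Rightarrow> nat \<Rightarrow> bool" where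
  "ons b d \<longleftrightarrow> (\<forall>i<d. \<forall>j<d. b i \<bullet> b j = (if i = j then 1 else 0))"

lemma onsD: "ons b d \<Longrightarrow> i < d \<Longrightarrow> j < d \<Longrightarrow> b i \<bullet> b j = (if i = j then 1 else 0)"
  by (auto simp: ons_def)

lemma ons_mono: "ons b d \<Longrightarrow> e \<le> d \<Longrightarrow> ons b e"
  by (auto simp: ons_def)

lemma ons_inner_sum:
  assumes "ons b d" "i < d"
  shows "(\<Sum>j<d. c j *\<^sub>R b j) \<bullet> b i = c i"
proof -
  have "(\<Sum>j<d. c j *\<^sub>R b j) \<bullet> b i = (\<Sum>j<d. if j = i then c j else 0)"
    unfolding inner_sum_left by (rule sum.cong) (use assms in \<open>auto simp: onsD\<close>)
  also have "\<dots> = c i" using assms by simp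
  finally show ?thesis .
qed

lemma ons_norm_sum:
  assumes "ons b d"
  shows "(norm (\<Sum>i<d. c i *\<^sub>R b i))\<^sup>2 = (\<Sum>i<d. (c i)\<^sup>2)"
proof -
  let ?s = "\<Sum>i<d. c i *\<^sub>R b i"
  have "(norm ?s)\<^sup>2 = (\<Sum>i<d. c i * (?s \<bullet> b i))"
    unfolding power2_norm_eq_inner by (subst (2) inner_commute, subst inner_sum_left) (simp add: inner_commute)
  also have "\<dots> = (\<Sum>i<d. (c i)\<^sup>2)"
    using ons_inner_sum[OF assms, of _ c] by (intro sum.cong) (auto simp: power2_eq_square)
  finally show ?thesis .
qed

lemma ons_proj:
  assumes "ons b d"
  shows "proj (span (b ` {..<d})) x = (\<Sum>i<d. (x \<bullet> b i) *\<^sub>R b i)"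
proof (rule proj_eqI)
  let ?p = "\<Sum>i<d. (x \<bullet> b i) *\<^sub>R b i"
  show "?p \<in> span (b ` {..<d})" by (intro span_sum span_scale span_base) auto
  fix w assume "w \<in> span (b ` {..<d})"
  then show "(x - ?p) \<bullet> w = 0"
  proof (rule span_induct)
    show "subspace {w. (x - ?p) \<bullet> w = 0}" by (rule subspace_hyperplane)
    show "\<And>w. w \<in> b ` {..<d} \<Longrightarrow> (x - ?p) \<bullet> w = 0"
      using ons_inner_sum[OF assms] by (auto simp: inner_diff_left)
  qed
qed simp

lemma ons_inj: "ons b d \<Longrightarrow> inj_on b {..<d}"
  by (rule inj_onI) (metis lessThan_iff onsD zero_neq_one)

lemma ons_dim:
  assumes "ons b d"
  shows "dim (span (b ` {..<d})) = d"
proof -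
  have "pairwise orthogonal (b ` {..<d})"
    using assms by (auto simp: pairwise_def orthogonal_def onsD)
  moreover have "0 \<notin> b ` {..<d}" using assms onsD by fastforce
  ultimately have "independent (b ` {..<d})" by (rule pairwise_orthogonal_independent)
  then show ?thesis using ons_inj[OF assms] by (simp add: dim_eq_card_independent card_image)
qed

text \<open>Induction on the number of missing vectors: as long as the span is proper, a unit vector
  of \<open>V\<close> orthogonal to it is put at index \<open>d\<close>. Earlier entries stay, so
  one basis can be adapted to a chain of subspaces.\<close>

lemma ons_extend:
  assumes "ons b d" "subspace V" "span (b ` {..<d}) \<subseteq> V"
  shows "\<exists>c. (\<forall>i<d. c i = b i) \<and> ons c (dim V) \<and> span (c ` {..<dim V}) = V"
  using assms
proof (induction "dim V - d" arbitrary: b d)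
  case 0
  have "d \<le> dim V" using dim_subset[OF 0(4)] ons_dim[OF 0(2)] by simp
  with 0 have d: "d = dim V" by simp
  then have "span (b ` {..<d}) = V"
    using subspace_dim_equal[of "span (b ` {..<d})" V] 0 ons_dim[OF 0(2)] by simp
  with 0(2) show ?case unfolding d by blast
next
  case (Suc k)
  then have "span (b ` {..<d}) \<noteq> V" using ons_dim[of b d] by auto
  then have "span (b ` {..<d}) \<subset> span V" using Suc by (auto simp: span_eq_iff[THEN iffD2])
  then obtain x where x: "x \<noteq> 0" "x \<in> span V" "\<And>y. y \<in> span (b ` {..<d}) \<Longrightarrow> orthogonal x y"
    using orthogonal_to_subspace_exists_gen by blast
  define b' where "b' = b(d := x /\<^sub>R norm x)"
  have bx: "x \<bullet> b i = 0" if "i < d" for i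
    using x(3)[of "b i"] that by (auto simp: orthogonal_def intro: span_base)
  have o: "ons b' (Suc d)"
  proof -
    have "(x /\<^sub>R norm x) \<bullet> (x /\<^sub>R norm x) = 1" using x(1) by (subst norm_eq_1[symmetric]) simp
    moreover have "(x /\<^sub>R norm x) \<bullet> b i = 0" "b i \<bullet> (x /\<^sub>R norm x) = 0" if "i < d" for i
      using bx[OF that] by (simp_all add: inner_commute)
    ultimately show ?thesis using Suc(3) by (auto simp: ons_def b'_def less_Suc_eq)
  qed
  have xV: "x /\<^sub>R norm x \<in> V" using x Suc(4) by (simp add: subspace_scale span_eq_iff[THEN iffD2])
  have "b' ` {..<d} = b ` {..<d}" by (rule image_cong) (simp_all add: b'_def)
  then have im: "b' ` {..<Suc d} = insert (x /\<^sub>R norm x) (b ` {..<d})"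
    unfolding lessThan_Suc image_insert by (simp add: b'_def)
  have "b ` {..<d} \<subseteq> V" using Suc(5) span_superset[of "b ` {..<d}"] by (rule subset_trans[rotated])
  then have s: "span (b' ` {..<Suc d}) \<subseteq> V"
    unfolding im using xV Suc(4) by (intro span_minimal) auto
  obtain c where "\<forall>i<Suc d. c i = b' i" "ons c (dim V)" "span (c ` {..<dim V}) = V"
    using Suc(1)[OF _ o Suc(4) s] Suc(2) by fastforce
  then show ?case by (intro exI[of _ c]) (auto simp: b'_def)
qed

lemma ons_exists:
  assumes "subspace V"
  obtains b where "ons b (dim V)" "span (b ` {..<dim V}) = V"
  using ons_extend[of undefined 0 V] assms by (auto simp: ons_def subspace_0)

lemma ons_full_span:
  fixes b :: "nat \<Rightarrow> 'a::euclidean_space"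
  assumes "ons b DIM('a)"
  shows "span (b ` {..<DIM('a)}) = UNIV"
  using ons_dim[OF assms] by (metis dim_eq_full span_span)

lemma ons_full_expand:
  fixes b :: "nat \<Rightarrow> 'a::euclidean_space"
  assumes "ons b DIM('a)"
  shows "(\<Sum>i<DIM('a). (x \<bullet> b i) *\<^sub>R b i) = x"
  using ons_proj[OF assms, of x] ons_full_span[OF assms] by (simp add: proj_id)

text \<open>Coordinates in \<open>b\<close> are read as coordinates in \<open>c\<close>; both
  systems compute the norm by the same sum of squares, so the map is an isometry.\<close>

lemma ons_orthogonal_transformation:
  fixes b c :: "nat \<Rightarrow> 'a::euclidean_space"
  assumes b: "ons b DIM('a)" and c: "ons c DIM('a)"
  obtains f where "orthogonal_transformation f" "\<And>i. i < DIM('a) \<Longrightarrow> f (b i) = c i"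
proof
  let ?f = "\<lambda>x. \<Sum>i<DIM('a). (x \<bullet> b i) *\<^sub>R c i"
  have "linear ?f"
    by (rule linearI) (simp_all add: inner_add_left scaleR_add_left sum.distrib scaleR_sum_right)
  moreover have "norm (?f x) = norm x" for x
  proof -
    have "(norm (?f x))\<^sup>2 = (norm (\<Sum>i<DIM('a). (x \<bullet> b i) *\<^sub>R b i))\<^sup>2"
      by (simp only: ons_norm_sum[OF b] ons_norm_sum[OF c])
    then show ?thesis by (simp add: ons_full_expand[OF b])
  qed
  ultimately show "orthogonal_transformation ?f" by (simp add: orthogonal_transformation)
  fix i assume i: "i < DIM('a)"
  have "?f (b i) = (\<Sum>j<DIM('a). if j = i then c j else 0)"
    using onsD[OF b i] by (intro sum.cong) auto
  then show "?f (b i) = c i" using i by simp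
qed

subsection \<open>Flats\<close>

lemma GrassD: "L \<in> Grass k \<Longrightarrow> subspace L" "L \<in> Grass k \<Longrightarrow> dim L = k"
  by (auto simp: Grass_def)

lemma Grass_sub_AffGrass: "Grass k \<subseteq> AffGrass k"
  unfolding AffGrass_def by (force intro!: bexI exI[of _ 0])

lemma translate_AffGrass: "L \<in> Grass k \<Longrightarrow> (\<lambda>y. y + x) ` L \<in> AffGrass k"
  by (auto simp: AffGrass_def)

lemma translate_eq:
  assumes "subspace L" "x - x' \<in> L"
  shows "(\<lambda>y. y + x) ` L = (\<lambda>y. y + x') ` L"
proof -
  have "(\<lambda>y. y + u) ` L \<subseteq> (\<lambda>y. y + w) ` L" if "u - w \<in> L" for u w
    using assms(1) that by (auto intro!: image_eqI[of _ _ "_ + (u - w)"] simp: subspace_add)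
  then show ?thesis using assms subspace_neg[OF assms] by (auto simp: set_eq_subset)
qed

lemma AffGrassE:
  assumes "E \<in> AffGrass k"
  obtains L x where "L \<in> Grass k" "x \<in> orthogonal_comp L" "E = (\<lambda>y. y + x) ` L"
proof -
  obtain L x where L: "L \<in> Grass k" "E = (\<lambda>y. y + x) ` L" using assms by (auto simp: AffGrass_def)
  have s: "subspace L" using L GrassD by blast
  have "x - proj L x \<in> orthogonal_comp L"
    using proj_orth[OF s] by (auto simp: orthogonal_comp_def orthogonal_def inner_commute)
  moreover have "E = (\<lambda>y. y + (x - proj L x)) ` L"
    unfolding L(2) by (rule translate_eq[OF s]) (simp add: s proj_in)
  ultimately show thesis using that L by blast
qed

lemma infdist_translate:
  fixes L :: "'a::real_normed_vector set"
  shows "infdist z ((\<lambda>y. y + x) ` L) = infdist (z - x) L"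
proof (cases "L = {}")
  case False
  have "dist z (y + x) = dist (z - x) y" for y
    unfolding dist_norm by (rule arg_cong[of _ _ norm]) simp
  then show ?thesis using False by (simp add: infdist_notempty image_image)
qed (simp add: infdist_def)

lemma infdist_0_translate:
  fixes L :: "'a::euclidean_space set"
  assumes "subspace L" "x \<in> orthogonal_comp L"
  shows "infdist 0 ((\<lambda>y. y + x) ` L) = norm x"
proof -
  have "proj L (-x) = 0"
    by (rule proj_eqI) (use assms in \<open>auto simp: subspace_0 orthogonal_comp_def orthogonal_def inner_commute\<close>)
  then show ?thesis by (simp add: infdist_translate infdist_subspace assms)
qed

lemma AffGrass_nonempty: "E \<in> AffGrass k \<Longrightarrow> E \<noteq> {}"
  using subspace_0 by (fastforce simp: AffGrass_def Grass_def)

lemma closed_AffGrass: "E \<in> AffGrass k \<Longrightarrow> closed E"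
proof -
  assume "E \<in> AffGrass k"
  then obtain L x where "subspace L" "E = (\<lambda>y. y + x) ` L" by (auto simp: AffGrass_def Grass_def)
  then show ?thesis using closed_translation[OF closed_subspace, of L x] by (simp add: add.commute)
qed

lemma image_AffGrass:
  assumes R: "orthogonal_transformation R" and E: "E \<in> AffGrass k"
  shows "R ` E \<in> AffGrass k"
proof -
  obtain L x where L: "L \<in> Grass k" "E = (\<lambda>y. y + x) ` L" using E by (auto simp: AffGrass_def)
  have lin: "linear R" and inj: "inj R"
    using R orthogonal_transformation_linear orthogonal_transformation_inj by blast+
  have "R ` L \<in> Grass k"
    using L lin inj by (simp add: Grass_def linear_subspace_image dim_image_eq inj_on_subset)
  moreover have "R ` E = (\<lambda>y. y + R x) ` (R ` L)" using L lin by (auto simp: image_image linear_add)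
  ultimately show ?thesis by (auto simp: AffGrass_def)
qed

lemma image_Grass:
  assumes R: "orthogonal_transformation R" and L: "L \<in> Grass k"
  shows "R ` L \<in> Grass k"
proof -
  have lin: "linear R" and inj: "inj R"
    using R orthogonal_transformation_linear orthogonal_transformation_inj by blast+
  then show ?thesis using L by (simp add: Grass_def linear_subspace_image dim_image_eq inj_on_subset)
qed

lemma infdist_orthogonal_image:
  assumes R: "orthogonal_transformation R"
  shows "infdist (R x) (R ` E) = infdist x E"
proof (cases "E = {}")
  case False
  have "dist (R x) (R y) = dist x y" for y
    using R by (metis dist_norm linear_diff orthogonal_transformation)
  then show ?thesis using False by (simp add: infdist_notempty image_image)
qed (simp add: infdist_def)

lemma rotation_0: "R \<in> rotations \<Longrightarrow> R 0 = 0"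
  by (simp add: linear_0 orthogonal_transformation_linear rotations_def)

lemma infdist_0_rotation: "R \<in> rotations \<Longrightarrow> infdist 0 (R ` E) = infdist 0 E"
  using infdist_orthogonal_image[of R 0 E] rotation_0[of R] by (simp add: rotations_def)

text \<open>The Householder reflection in the hyperplane orthogonal to \<open>w\<close> serves to
  correct the sign of a determinant without moving a given set. For its own determinant, an
  orthogonal map \<open>T\<close> taking a coordinate axis to the direction of \<open>w\<close>
  conjugates it to a diagonal matrix with a single entry \<open>-1\<close>.\<close>

lemma reflection_exists:
  fixes w :: "real^'n"
  assumes "w \<noteq> 0"
  obtains S where "orthogonal_transformation S" "det (matrix S) = -1"
    "\<And>y. y \<bullet> w = 0 \<Longrightarrow> S y = y" "\<And>V. subspace V \<Longrightarrow> w \<in> V \<Longrightarrow> S ` V = V"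
proof -
  let ?S = "\<lambda>y. y - (2 * (y \<bullet> w) / (w \<bullet> w)) *\<^sub>R w"
  have lin: "linear ?S"
    by (rule linearI) (simp_all add: inner_add_left algebra_simps add_divide_distrib)
  have ot: "orthogonal_transformation ?S"
    unfolding orthogonal_transformation_def using lin assms
    by (auto simp: inner_diff_left inner_diff_right inner_commute field_simps)
  have inv: "?S (?S y) = y" for y using assms by (simp add: inner_diff_left)
  have img: "?S ` V = V" if "subspace V" "w \<in> V" for V
  proof -
    have "?S ` V \<subseteq> V" using that by (auto intro!: subspace_diff subspace_scale)
    moreover have "V \<subseteq> ?S ` V"
    proof
      fix y assume "y \<in> V"
      then have "?S y \<in> V" using that by (auto intro!: subspace_diff subspace_scale)
      with inv[of y, symmetric] show "y \<in> ?S ` V" by (rule image_eqI)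
    qed
    ultimately show ?thesis by blast
  qed
  obtain k :: 'n where True by blast
  obtain T :: "real^'n \<Rightarrow> real^'n" where T: "orthogonal_transformation T" "T (axis k 1) = w /\<^sub>R norm w"
  proof -
    have "norm (axis k 1 :: real^'n) = 1" "norm (w /\<^sub>R norm w) = 1" using assms by simp_all
    then obtain f :: "real^'n \<Rightarrow> real^'n" where f: "orthogonal_transformation f" "f (axis k 1) = w /\<^sub>R norm w"
      by (rule orthogonal_transformation_exists_1)
    then show ?thesis by (rule that)
  qed
  show thesis
  proof (rule that[OF ot])
    let ?D = "\<lambda>y::real^'n. y - (2 * (y \<bullet> axis k 1)) *\<^sub>R axis k 1"
    have linD: "linear ?D" by (rule linearI) (simp_all add: inner_add_left algebra_simps)
    have linT: "linear T" using T orthogonal_transformation_linear by blast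
    have conj: "?S \<circ> T = T \<circ> ?D"
    proof
      fix y
      have "T y \<bullet> w = norm w * (T y \<bullet> T (axis k 1))" using assms T(2) by simp
      also have "T y \<bullet> T (axis k 1) = y \<bullet> axis k 1" using T(1) by (simp add: orthogonal_transformation_def)
      finally have "T y \<bullet> w = norm w * (y \<bullet> axis k 1)" .
      then have "?S (T y) = T y - (2 * (y \<bullet> axis k 1)) *\<^sub>R T (axis k 1)"
        using assms T(2) by (simp add: power2_norm_eq_inner[symmetric] power2_eq_square divide_simps)
      also have "\<dots> = T (?D y)" using linT by (simp add: linear_diff linear_scale)
      finally show "(?S \<circ> T) y = (T \<circ> ?D) y" by simp
    qed
    have "det (matrix ?S ** matrix T) = det (matrix T ** matrix ?D)"
      using conj lin linT linD by (simp add: matrix_compose[symmetric])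
    moreover have "det (matrix T) \<noteq> 0" using T(1) orthogonal_transformation_det[of T] by force
    ultimately have e: "det (matrix ?S) = det (matrix ?D)" by (simp add: det_mul)
    have D: "matrix ?D $ i $ j = (if i = j then if i = k then -1 else 1 else 0)" for i j
      by (simp add: matrix_def inner_axis_axis) (simp add: axis_def)
    have "det (matrix ?D) = (\<Prod>i\<in>UNIV. matrix ?D $ i $ i)"
      by (rule det_diagonal) (simp add: D)
    also have "\<dots> = (\<Prod>i\<in>UNIV. if i = k then -1 else 1)"
      by (simp add: D)
    also have "\<dots> = -1" by simp
    finally show "det (matrix ?S) = -1" using e by simp
  qed (use img in auto)
qed

text \<open>The case \<open>x = 0\<close> is the reason for the dimension bound: a normal direction
  must then come from some nonzero vector orthogonal to \<open>L\<close>.\<close>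

lemma unit_vector_orthogonal_comp:
  assumes "x \<in> orthogonal_comp L" "dim L < DIM('a)"
  obtains u :: "'a::euclidean_space" where "norm u = 1" "u \<in> orthogonal_comp L" "x = norm x *\<^sub>R u"
proof (cases "x = 0")
  case True
  obtain v where v: "v \<noteq> 0" "\<And>y. y \<in> span L \<Longrightarrow> orthogonal v y"
    using orthogonal_to_subspace_exists assms(2) by blast
  show thesis
    by (rule that[of "v /\<^sub>R norm v"])
      (use v True in \<open>auto simp: orthogonal_comp_def orthogonal_def inner_commute span_base\<close>)
next
  case False
  show thesis
    by (rule that[of "x /\<^sub>R norm x"]) (use False assms in \<open>auto simp: orthogonal_comp_def orthogonal_def\<close>)
qed

text \<open>A frame adapted to a flat: the first \<open>k\<close> vectors span its direction, and
  the next one is the normal along which it is shifted. Matching two such frames matches the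
  flats.\<close>

lemma ons_flat:
  fixes L :: "'a::euclidean_space set"
  assumes L: "subspace L" "dim L = k" "k < DIM('a)" and x: "x \<in> orthogonal_comp L"
  obtains b where "ons b DIM('a)" "span (b ` {..<k}) = L" "x = norm x *\<^sub>R b k"
proof -
  obtain b0 where b0: "ons b0 k" "span (b0 ` {..<k}) = L" using ons_exists[OF L(1)] L(2) by metis
  obtain u where u: "norm u = 1" "u \<in> orthogonal_comp L" "x = norm x *\<^sub>R u"
    using unit_vector_orthogonal_comp[OF x] L by metis
  have bu: "b0 i \<bullet> u = 0" if "i < k" for i
    using u(2) b0(2) that by (auto simp: orthogonal_comp_def orthogonal_def intro!: span_base)
  have "ons (b0(k := u)) (Suc k)"
    using b0(1) bu u(1) by (auto simp: ons_def less_Suc_eq inner_commute norm_eq_1)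
  from ons_extend[OF this subspace_UNIV] obtain c where
    c: "\<forall>i<Suc k. c i = (b0(k := u)) i" "ons c DIM('a)" by auto
  have "c ` {..<k} = b0 ` {..<k}" using c by (intro image_cong) auto
  then show thesis using that[OF c(2)] b0 c(1) u(3) by simp
qed

text \<open>Matching adapted frames gives an orthogonal map from \<open>E\<close> to
  \<open>F\<close>. If its determinant is \<open>-1\<close>, it is followed by a reflection that
  maps \<open>F\<close> to itself; room for such a reflection is where dimension at least two
  enters.\<close>

lemma rotation_transitive:
  fixes E F :: "(real^'n) set"
  assumes n: "CARD('n) \<ge> 2" "k < CARD('n)" and E: "E \<in> AffGrass k" and F: "F \<in> AffGrass k"
    and d: "infdist 0 E = infdist 0 F"
  obtains R where "R \<in> rotations" "R ` E = F"
proof -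
  obtain L x where L: "L \<in> Grass k" "x \<in> orthogonal_comp L" "E = (\<lambda>y. y + x) ` L" using AffGrassE[OF E] .
  obtain K y where K: "K \<in> Grass k" "y \<in> orthogonal_comp K" "F = (\<lambda>z. z + y) ` K" using AffGrassE[OF F] .
  have xy: "norm x = norm y"
    using d L K by (simp add: infdist_0_translate GrassD)
  obtain b where b: "ons b DIM(real^'n)" "span (b ` {..<k}) = L" "x = norm x *\<^sub>R b k"
    using ons_flat[of L k x] L n by (auto simp: Grass_def)
  obtain c where c: "ons c DIM(real^'n)" "span (c ` {..<k}) = K" "y = norm y *\<^sub>R c k"
    using ons_flat[of K k y] K n by (auto simp: Grass_def)
  obtain R where R: "orthogonal_transformation R" "\<And>i. i < DIM(real^'n) \<Longrightarrow> R (b i) = c i"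
    using ons_orthogonal_transformation[OF b(1) c(1)] by blast
  have lin: "linear R" using R orthogonal_transformation_linear by blast
  have "R ` L = span (R ` b ` {..<k})" using b(2) lin by (metis linear_span_image)
  also have "R ` b ` {..<k} = c ` {..<k}"
    using R(2) n by (force simp: image_image intro!: image_cong)
  finally have RL: "R ` L = K" using c by simp
  have Rx: "R x = y"
    using R(2)[of k] n b(3) c(3) xy lin by (metis DIM_cart DIM_real linear_scale mult.right_neutral)
  have RE: "R ` E = F"
    unfolding L(3) K(3) RL[symmetric] Rx[symmetric] using lin by (auto simp: image_image linear_add)
  \<comment> \<open>A reflection in \<open>w\<close> preserves \<open>F\<close> if it fixes the
    shift \<open>y\<close> and maps \<open>K\<close> to itself. A nonzero vector of \<open>K\<close>
    does this; for a point, where \<open>K\<close> is trivial, any nonzero vector orthogonal to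
    \<open>y\<close> does.\<close>
  obtain w where w: "w \<noteq> 0" "w \<bullet> y = 0" "w \<in> K \<or> w \<in> orthogonal_comp K"
  proof (cases "k = 0")
    case True
    then have "K = {0}" using K by (simp add: Grass_def) (metis dim_eq_0 subset_singletonD subspace_0 empty_iff)
    obtain w where "w \<noteq> 0" "orthogonal y w" using orthogonal_to_vector_exists[of y] n by auto
    then show thesis using that[of w] \<open>K = {0}\<close> by (simp add: orthogonal_def inner_commute)
  next
    case False
    then have "K \<noteq> {0}" using K by (auto simp: Grass_def)
    then obtain w where "w \<in> K" "w \<noteq> 0" using K subspace_0 by (fastforce simp: Grass_def)
    then show thesis using that[of w] K(2) by (simp add: orthogonal_comp_def orthogonal_def)
  qed
  obtain S where S: "orthogonal_transformation S" "det (matrix S) = -1"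
    "\<And>y. y \<bullet> w = 0 \<Longrightarrow> S y = y" "\<And>V. subspace V \<Longrightarrow> w \<in> V \<Longrightarrow> S ` V = V"
    using reflection_exists[OF w(1)] by (metis (no_types, lifting))
  have linS: "linear S" using S orthogonal_transformation_linear by blast
  have "S ` K = K"
  proof (cases "w \<in> K")
    case True then show ?thesis using S(4) K GrassD by blast
  next
    case False
    then have "S z = z" if "z \<in> K" for z
      using that w(3) S(3)[of z] by (auto simp: orthogonal_comp_def orthogonal_def)
    then show ?thesis by simp
  qed
  moreover have "S y = y" using S(3) w(2) by (simp add: inner_commute)
  moreover have "S ` F = (\<lambda>z. z + S y) ` (S ` K)"
    unfolding K(3) image_image using linS by (simp add: linear_add)
  ultimately have SF: "S ` F = F" using K(3) by simp
  show thesis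
  proof (cases "det (matrix R) = 1")
    case True then show thesis using that[of R] R RE by (simp add: rotations_def)
  next
    case False
    then have "det (matrix R) = -1" using orthogonal_transformation_det[OF R(1)] by linarith
    then have "det (matrix (S \<circ> R)) = 1" using S lin linS by (simp add: matrix_compose det_mul)
    moreover have "orthogonal_transformation (S \<circ> R)" using S R orthogonal_transformation_compose by blast
    ultimately show thesis using that[of "S \<circ> R"] SF RE by (auto simp: rotations_def image_comp[symmetric])
  qed
qed

subsection \<open>Measurable families of flats\<close>

lemma space_set_sigma [simp]: "space (set_sigma \<Omega>) = \<Omega>"
  by (simp add: set_sigma_def space_measure_of_conv)

text \<open>The sigma-algebra is generated by distances to fixed points, so a set-valued map needs
  to be tested only on these. The later measurability proofs for flats rest on this test.\<close>

lemma measurable_set_sigma: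
  assumes "\<And>\<omega>. \<omega> \<in> space M \<Longrightarrow> F \<omega> \<in> \<Omega>"
    and "\<And>x. (\<lambda>\<omega>. infdist x (F \<omega>)) \<in> borel_measurable M"
  shows "F \<in> measurable M (set_sigma \<Omega>)"
  unfolding set_sigma_def
proof (rule measurable_measure_of)
  fix y assume "y \<in> {{E\<in>\<Omega>. infdist x E \<in> B} | x B. B \<in> sets borel}"
  then obtain x B where y: "y = {E\<in>\<Omega>. infdist x E \<in> B}" "B \<in> sets borel" by blast
  have "F -` y \<inter> space M = (\<lambda>\<omega>. infdist x (F \<omega>)) -` B \<inter> space M" using assms(1) y by auto
  then show "F -` y \<inter> space M \<in> sets M" using measurable_sets[OF assms(2) y(2)] by simp
qed (use assms in auto)

lemma measurable_infdist_set_sigma: "(\<lambda>E. infdist x E) \<in> borel_measurable (set_sigma \<Omega>)"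
proof (rule measurableI)
  fix B :: "real set" assume "B \<in> sets borel"
  then have "{E\<in>\<Omega>. infdist x E \<in> B} \<in> sets (set_sigma \<Omega>)"
    unfolding set_sigma_def by (subst sets_measure_of) (auto intro!: sigma_sets.Basic)
  then show "(\<lambda>E. infdist x E) -` B \<inter> space (set_sigma \<Omega>) \<in> sets (set_sigma \<Omega>)"
    by (auto simp: vimage_def Int_def conj_commute)
qed simp

lemma measurable_infdist_comp:
  assumes "F \<in> measurable M (set_sigma \<Omega>)"
  shows "(\<lambda>\<omega>. infdist x (F \<omega>)) \<in> borel_measurable M"
  using measurable_compose[OF assms measurable_infdist_set_sigma] .

text \<open>At first only distances from fixed points are measurable. Because \<open>infdist\<close>
  is 1-Lipschitz in the point, \<open>infdist (g \<omega>) (A \<omega>) < r\<close> holds exactly if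
  some \<open>d\<close> in a countable dense set satisfies
  \<open>dist (g \<omega>) d + infdist d (A \<omega>) < r\<close>.\<close>

lemma measurable_infdist_joint:
  fixes g :: "'b \<Rightarrow> 'a::euclidean_space"
  assumes A: "\<And>y. (\<lambda>\<omega>. infdist y (A \<omega>)) \<in> borel_measurable M"
    and g[measurable]: "g \<in> borel_measurable M"
  shows "(\<lambda>\<omega>. infdist (g \<omega>) (A \<omega>)) \<in> borel_measurable M"
proof (rule borel_measurableI_less)
  fix r :: real
  note A[measurable]
  obtain D :: "'a set" where D: "countable D" "\<And>X. open X \<Longrightarrow> X \<noteq> {} \<Longrightarrow> \<exists>d\<in>D. d \<in> X"
    using countable_dense_setE by blast
  have "{\<omega>\<in>space M. infdist (g \<omega>) (A \<omega>) < r} =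
    (\<Union>d\<in>D. {\<omega>\<in>space M. dist (g \<omega>) d + infdist d (A \<omega>) < r})"
  proof (intro equalityI subsetI)
    fix \<omega> assume "\<omega> \<in> {\<omega>\<in>space M. infdist (g \<omega>) (A \<omega>) < r}"
    then have w: "\<omega> \<in> space M" "infdist (g \<omega>) (A \<omega>) < r" by auto
    let ?e = "(r - infdist (g \<omega>) (A \<omega>)) / 2"
    have "ball (g \<omega>) ?e \<noteq> {}" using w by simp
    then obtain d where d: "d \<in> D" "d \<in> ball (g \<omega>) ?e" using D(2)[of "ball (g \<omega>) ?e"] by auto
    have "infdist d (A \<omega>) \<le> infdist (g \<omega>) (A \<omega>) + dist d (g \<omega>)" by (rule infdist_triangle)
    with d have "dist (g \<omega>) d + infdist d (A \<omega>) < r" by (simp add: dist_commute)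
    then show "\<omega> \<in> (\<Union>d\<in>D. {\<omega>\<in>space M. dist (g \<omega>) d + infdist d (A \<omega>) < r})" using w d by blast
  next
    fix \<omega> assume "\<omega> \<in> (\<Union>d\<in>D. {\<omega>\<in>space M. dist (g \<omega>) d + infdist d (A \<omega>) < r})"
    then obtain d where "d \<in> D" "\<omega> \<in> space M" "dist (g \<omega>) d + infdist d (A \<omega>) < r" by blast
    moreover have "infdist (g \<omega>) (A \<omega>) \<le> infdist d (A \<omega>) + dist (g \<omega>) d" by (rule infdist_triangle)
    ultimately show "\<omega> \<in> {\<omega>\<in>space M. infdist (g \<omega>) (A \<omega>) < r}" by simp
  qed
  also have "\<dots> \<in> sets M"
  proof (rule sets.countable_UN'[OF D(1)])
    have "{\<omega>\<in>space M. dist (g \<omega>) d + infdist d (A \<omega>) < r} \<in> sets M" for d by measurable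
    then show "(\<lambda>d. {\<omega>\<in>space M. dist (g \<omega>) d + infdist d (A \<omega>) < r}) ` D \<subseteq> sets M" by blast
  qed
  finally show "{\<omega>\<in>space M. infdist (g \<omega>) (A \<omega>) < r} \<in> sets M" .
qed

lemma measurable_proj_joint:
  fixes g :: "'b \<Rightarrow> 'a::euclidean_space"
  assumes A: "\<And>y. (\<lambda>\<omega>. infdist y (A \<omega>)) \<in> borel_measurable M"
    and sub: "\<And>\<omega>. \<omega> \<in> space M \<Longrightarrow> subspace (A \<omega>)"
    and g[measurable]: "g \<in> borel_measurable M"
  shows "(\<lambda>\<omega>. proj (A \<omega>) (g \<omega>)) \<in> borel_measurable M"
proof (rule borel_measurable_euclidean_space[THEN iffD2], intro ballI)
  fix b :: 'a assume "b \<in> Basis"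
  have [measurable]: "(\<lambda>\<omega>. infdist (g \<omega> + b) (A \<omega>)) \<in> borel_measurable M"
    "(\<lambda>\<omega>. infdist (g \<omega> - b) (A \<omega>)) \<in> borel_measurable M"
    by (rule measurable_infdist_joint[OF A], measurable)+
  have "(\<lambda>\<omega>. ((norm (g \<omega> + b))\<^sup>2 - (infdist (g \<omega> + b) (A \<omega>))\<^sup>2
    - (norm (g \<omega> - b))\<^sup>2 + (infdist (g \<omega> - b) (A \<omega>))\<^sup>2) / 4) \<in> borel_measurable M"
    by measurable
  then show "(\<lambda>\<omega>. proj (A \<omega>) (g \<omega>) \<bullet> b) \<in> borel_measurable M"
    by (rule measurable_cong[THEN iffD1, rotated]) (simp add: proj_polarization sub)
qed

lemma measurable_translate:
  assumes F: "F \<in> measurable M (set_sigma (Grass k))" and g[measurable]: "g \<in> borel_measurable M"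
  shows "(\<lambda>\<omega>. (\<lambda>y. y + g \<omega>) ` F \<omega>) \<in> measurable M (set_sigma (AffGrass k))"
proof (rule measurable_set_sigma)
  fix x show "(\<lambda>\<omega>. infdist x ((\<lambda>y. y + g \<omega>) ` F \<omega>)) \<in> borel_measurable M"
    unfolding infdist_translate by (rule measurable_infdist_joint[OF measurable_infdist_comp[OF F]]) measurable
qed (use measurable_space[OF F] translate_AffGrass in auto)

subsection \<open>Gram-Schmidt orthonormalisation\<close>

text \<open>Division by a zero norm gives zero, so a vector dependent on its predecessors yields 0
  and the recursion makes sense for every input.\<close>

fun gs :: "(nat \<Rightarrow> 'a::euclidean_space) \<Rightarrow> nat \<Rightarrow> 'a" where
  "gs A i = (let w = A i - (\<Sum>j<i. (A i \<bullet> gs A j) *\<^sub>R gs A j) in w /\<^sub>R norm w)"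

declare gs.simps [simp del]

definition gs_res :: "(nat \<Rightarrow> 'a::euclidean_space) \<Rightarrow> nat \<Rightarrow> 'a" where
  "gs_res A i = A i - (\<Sum>j<i. (A i \<bullet> gs A j) *\<^sub>R gs A j)"

lemma gs_eq: "gs A i = gs_res A i /\<^sub>R norm (gs_res A i)"
  by (simp add: gs_res_def Let_def gs.simps[of A i])

lemma gs_self: "gs A i \<bullet> gs A i = (if gs_res A i = 0 then 0 else 1)"
  by (subst (1 2) gs_eq) (simp add: divide_simps power2_norm_eq_inner[symmetric] power2_eq_square)

lemma gs_orthogonal: "j < i \<Longrightarrow> gs A i \<bullet> gs A j = 0"
proof (induction i arbitrary: j rule: less_induct)
  case (less i)
  have *: "gs A l \<bullet> gs A j = (if l = j then gs A j \<bullet> gs A j else 0)" if "l < i" for l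
    using less.IH[of l j] less.IH[of j l] that less.prems by (cases l j rule: linorder_cases) (auto simp: inner_commute)
  have "gs_res A i \<bullet> gs A j = A i \<bullet> gs A j - (\<Sum>l<i. (A i \<bullet> gs A l) * (gs A l \<bullet> gs A j))"
    by (simp add: gs_res_def inner_diff_left inner_sum_left)
  also have "(\<Sum>l<i. (A i \<bullet> gs A l) * (gs A l \<bullet> gs A j)) = (\<Sum>l<i. if l = j then (A i \<bullet> gs A j) * (gs A j \<bullet> gs A j) else 0)"
  proof (rule sum.cong)
    fix l assume "l \<in> {..<i}"
    then show "(A i \<bullet> gs A l) * (gs A l \<bullet> gs A j) = (if l = j then (A i \<bullet> gs A j) * (gs A j \<bullet> gs A j) else 0)"
      using *[of l] by (cases "l = j") auto
  qed simp
  also have "\<dots> = (A i \<bullet> gs A j) * (gs A j \<bullet> gs A j)" using less.prems by simp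
  \<comment> \<open>For a degenerate \<open>j\<close> the vector \<open>gs A j\<close> is 0 and both
    sides vanish; otherwise it has length one.\<close>
  also have "\<dots> = A i \<bullet> gs A j"
    using gs_self[of A j] by (auto split: if_splits)
  finally show ?case by (subst gs_eq) simp
qed

lemma gs_ons:
  assumes "\<And>i. i < d \<Longrightarrow> gs_res A i \<noteq> 0"
  shows "ons (gs A) d"
  unfolding ons_def
proof (intro allI impI)
  fix i j assume "i < d" "j < d"
  then show "gs A i \<bullet> gs A j = (if i = j then 1 else 0)"
    using gs_orthogonal[of i j A] gs_orthogonal[of j i A] gs_self[of A i] assms[of i]
    by (cases i j rule: linorder_cases) (auto simp: inner_commute)
qed

text \<open>The recursion uses only linear structure, norms and inner products, and hence commutes
  with \<open>R\<close>. This equivariance is the source of the invariance of the Haar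
  measure.\<close>

lemma gs_isometry:
  assumes R: "orthogonal_transformation R"
  shows "(\<And>j. j \<le> i \<Longrightarrow> A' j = R (A j)) \<Longrightarrow> gs A' i = R (gs A i)"
proof (induction i rule: less_induct)
  case (less i)
  have lin: "linear R" using R orthogonal_transformation_linear by blast
  have IH: "gs A' j = R (gs A j)" if "j < i" for j using less that by auto
  have inn: "R x \<bullet> R y = x \<bullet> y" for x y using R by (simp add: orthogonal_transformation_def)
  have "gs_res A' i = R (gs_res A i)"
    unfolding gs_res_def using less.prems[of i] IH
    by (simp add: inn linear_diff[OF lin] linear_sum[OF lin] linear_scale[OF lin])
  moreover have "norm (R x) = norm x" for x using R by (simp add: orthogonal_transformation)
  ultimately show ?case by (subst (1 2) gs_eq) (simp add: linear_scale[OF lin])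
qed

lemma gs_cong: "(\<And>j. j \<le> i \<Longrightarrow> A' j = A j) \<Longrightarrow> gs A' i = gs A i"
  using gs_isometry[of "\<lambda>x. x" i A' A] by simp

lemma measurable_gs_res:
  fixes M :: "'b measure" and A :: "'b \<Rightarrow> nat \<Rightarrow> 'a::euclidean_space"
  assumes "\<And>j. j \<le> i \<Longrightarrow> (\<lambda>\<omega>. A \<omega> j) \<in> borel_measurable M"
  shows "(\<lambda>\<omega>. gs_res (A \<omega>) i) \<in> borel_measurable M"
  using assms
proof (induction i rule: less_induct)
  case (less i)
  have [measurable]: "(\<lambda>\<omega>. gs (A \<omega>) j) \<in> borel_measurable M" if "j < i" for j
  proof -
    have [measurable]: "(\<lambda>\<omega>. gs_res (A \<omega>) j) \<in> borel_measurable M"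
      using less that by auto
    show ?thesis by (subst gs_eq) measurable
  qed
  have [measurable]: "(\<lambda>\<omega>. A \<omega> i) \<in> borel_measurable M" using less by auto
  show ?case unfolding gs_res_def
    by (intro borel_measurable_diff borel_measurable_sum borel_measurable_scaleR borel_measurable_inner) auto
qed

lemma measurable_gs:
  fixes M :: "'b measure" and A :: "'b \<Rightarrow> nat \<Rightarrow> 'a::euclidean_space"
  assumes "\<And>j. j \<le> i \<Longrightarrow> (\<lambda>\<omega>. A \<omega> j) \<in> borel_measurable M"
  shows "(\<lambda>\<omega>. gs (A \<omega>) i) \<in> borel_measurable M"
proof -
  note measurable_gs_res[OF assms, measurable]
  show ?thesis by (subst gs_eq) measurable
qed

subsection \<open>Rotation invariance of Lebesgue measure\<close>

lemma orthogonal_transformation_measurable: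
  fixes R :: "'a::euclidean_space \<Rightarrow> 'a"
  assumes "orthogonal_transformation R"
  shows "R \<in> borel_measurable borel"
  using orthogonal_transformation_linear[OF assms]
  by (intro borel_measurable_continuous_onI linear_continuous_on) (simp add: linear_conv_bounded_linear)

lemma nn_integral_lborel_shift:
  fixes c :: "'a::euclidean_space"
  assumes [measurable]: "f \<in> borel_measurable borel"
  shows "(\<integral>\<^sup>+x. f (x + c) \<partial>lborel) = (\<integral>\<^sup>+x. f x \<partial>lborel)"
proof -
  have "(\<integral>\<^sup>+x. f x \<partial>lborel) = (\<integral>\<^sup>+x. f x \<partial>distr lborel borel ((+) c))" by (simp only: lborel_distr_plus)
  also have "\<dots> = (\<integral>\<^sup>+x. f (x + c) \<partial>lborel)" by (subst nn_integral_distr) (simp_all add: add.commute)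
  finally show ?thesis by simp
qed

text \<open>Uniqueness of translation invariant measures, by Fubini's theorem for
  \<open>\<integral>\<integral> 1\<^sub>A(x) 1\<^sub>B(x + R y)\<close> with the rotation invariant set \<open>B\<close>, the unit ball.\<close>

lemma lborel_orthogonal_aux:
  fixes R :: "'a::euclidean_space \<Rightarrow> 'a"
  assumes R: "orthogonal_transformation R" and A[measurable]: "A \<in> sets borel"
  shows "(\<integral>\<^sup>+y. indicator A (- R y) \<partial>lborel) = emeasure lborel A"
proof -
  note orthogonal_transformation_measurable[OF R, measurable]
  have Rp: "R (x + y) = R x + R y" for x y
    using R by (simp add: linear_add orthogonal_transformation_linear)
  have Ri: "R (inv R x) = x" for x
    using R by (simp add: orthogonal_transformation_surj surj_f_inv_f)
  let ?B = "cball 0 1 :: 'a set"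
  have [measurable]: "?B \<in> sets borel" by simp
  have RB: "indicator ?B (R y) = (indicator ?B y :: ennreal)" for y
    using R by (simp add: indicator_def orthogonal_transformation)
  have s1: "(\<integral>\<^sup>+y. indicator ?B (R y) \<partial>lborel) = (\<integral>\<^sup>+y. indicator ?B (x + R y) \<partial>lborel :: ennreal)" for x
    using nn_integral_lborel_shift[of "\<lambda>y. indicator ?B (R y)" "inv R x"] by (simp add: Rp Ri add.commute)
  have s2: "(\<integral>\<^sup>+x. indicator A x * indicator ?B (x + z) \<partial>lborel) = (\<integral>\<^sup>+x. indicator A (x - z) * indicator ?B x \<partial>lborel :: ennreal)" for z
    using nn_integral_lborel_shift[of "\<lambda>x. indicator A (x - z) * indicator ?B x" z] by simp
  have s3: "(\<integral>\<^sup>+y. indicator A (x - R y) \<partial>lborel) = (\<integral>\<^sup>+y. indicator A (- R y) \<partial>lborel :: ennreal)" for x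
    using nn_integral_lborel_shift[of "\<lambda>y. indicator A (x - R y)" "inv R x"] by (simp add: Rp Ri)
  have "emeasure lborel ?B * emeasure lborel A = (\<integral>\<^sup>+x. indicator A x * (\<integral>\<^sup>+y. indicator ?B (R y) \<partial>lborel) \<partial>lborel)"
    by (simp add: RB nn_integral_multc mult.commute)
  also have "\<dots> = (\<integral>\<^sup>+x. \<integral>\<^sup>+y. indicator A x * indicator ?B (x + R y) \<partial>lborel \<partial>lborel)"
    by (intro nn_integral_cong) (subst s1, simp add: nn_integral_cmult)
  also have "\<dots> = (\<integral>\<^sup>+y. \<integral>\<^sup>+x. indicator A x * indicator ?B (x + R y) \<partial>lborel \<partial>lborel)"
    by (rule lborel_pair.Fubini') measurable
  also have "\<dots> = (\<integral>\<^sup>+y. \<integral>\<^sup>+x. indicator A (x - R y) * indicator ?B x \<partial>lborel \<partial>lborel)"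
    by (simp only: s2)
  also have "\<dots> = (\<integral>\<^sup>+x. \<integral>\<^sup>+y. indicator A (x - R y) * indicator ?B x \<partial>lborel \<partial>lborel)"
    by (rule lborel_pair.Fubini') measurable
  also have "\<dots> = (\<integral>\<^sup>+x. (\<integral>\<^sup>+y. indicator A (- R y) \<partial>lborel) * indicator ?B x \<partial>lborel)"
    by (simp add: nn_integral_multc s3)
  also have "\<dots> = emeasure lborel ?B * (\<integral>\<^sup>+y. indicator A (- R y) \<partial>lborel)"
    by (simp only: mult.commute[of "emeasure lborel ?B"]) (rule nn_integral_cmult_indicator, simp)
  finally have "emeasure lborel ?B * emeasure lborel A = emeasure lborel ?B * (\<integral>\<^sup>+y. indicator A (- R y) \<partial>lborel)" .
  moreover have "emeasure lborel ?B \<noteq> \<infinity>" "emeasure lborel ?B \<noteq> 0"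
    by (simp_all add: emeasure_cball less_imp_neq[OF unit_ball_vol_pos, symmetric])
  ultimately show ?thesis by (simp add: ennreal_mult_cancel_left)
qed

lemma lborel_orthogonal:
  fixes R :: "'a::euclidean_space \<Rightarrow> 'a"
  assumes R: "orthogonal_transformation R"
  shows "distr lborel borel R = lborel"
proof (rule measure_eqI)
  note orthogonal_transformation_measurable[OF R, measurable]
  fix A assume "A \<in> sets (distr lborel borel R)"
  then have [measurable]: "A \<in> sets borel" by simp
  have "orthogonal_transformation (\<lambda>x. - R x)" using R by (simp add: orthogonal_transformation_neg)
  from lborel_orthogonal_aux[OF this, of A]
  have "emeasure lborel A = (\<integral>\<^sup>+y. indicator A (R y) \<partial>lborel)" by simp
  also have "\<dots> = (\<integral>\<^sup>+y. indicator A y \<partial>distr lborel borel R)" by (subst nn_integral_distr) simp_all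
  finally show "emeasure (distr lborel borel R) A = emeasure lborel A" by simp
qed simp

lemma nn_integral_lborel_orthogonal:
  fixes R :: "'a::euclidean_space \<Rightarrow> 'a"
  assumes R: "orthogonal_transformation R" and [measurable]: "f \<in> borel_measurable borel"
  shows "(\<integral>\<^sup>+x. f (R x) \<partial>lborel) = (\<integral>\<^sup>+x. f x \<partial>lborel)"
proof -
  note orthogonal_transformation_measurable[OF R, measurable]
  have "(\<integral>\<^sup>+x. f x \<partial>lborel) = (\<integral>\<^sup>+x. f x \<partial>distr lborel borel R)" by (simp only: lborel_orthogonal[OF R])
  also have "\<dots> = (\<integral>\<^sup>+x. f (R x) \<partial>lborel)" by (subst nn_integral_distr) auto
  finally show ?thesis by simp
qed

subsection \<open>Haar measure on the rotation group\<close>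

text \<open>Rotations as matrices rather than as functions: they then lie in a Euclidean space,
  where Borel sets and coordinatewise measurability are available.\<close>

definition SO :: "(real^'n^'n) set" where
  "SO = {M. orthogonal_matrix M \<and> det M = 1}"

lemma SO_mult: "M \<in> SO \<Longrightarrow> N \<in> SO \<Longrightarrow> M ** N \<in> SO"
  by (simp add: SO_def orthogonal_matrix_mul det_mul)

lemma SO_transpose: "M \<in> SO \<Longrightarrow> transpose M \<in> SO"
  by (simp add: SO_def)

lemma SO_inverse: "M \<in> SO \<Longrightarrow> transpose M ** M = mat 1" "M \<in> SO \<Longrightarrow> M ** transpose M = mat 1"
  by (auto simp: SO_def orthogonal_matrix_def)

lemma SO_rotation: "M \<in> SO \<Longrightarrow> (*v) M \<in> rotations"
  by (simp add: SO_def rotations_def orthogonal_transformation_matrix matrix_of_matrix_vector_mul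
    matrix_vector_mul_linear)

lemma rotation_SO:
  assumes "R \<in> rotations"
  shows "matrix R \<in> SO" "(*v) (matrix R) = R"
  using assms by (auto simp: SO_def rotations_def orthogonal_transformation_matrix matrix_vector_mul)

lemma SO_orthogonal: "M \<in> SO \<Longrightarrow> orthogonal_transformation ((*v) M)"
  using SO_rotation by (auto simp: rotations_def)

lemma SO_1: "mat 1 \<in> SO"
  by (simp add: SO_def orthogonal_matrix_id)

lemma borel_measurable_matrix:
  fixes f :: "'b \<Rightarrow> real^'n^'m"
  assumes "\<And>i j. (\<lambda>\<omega>. f \<omega> $ i $ j) \<in> borel_measurable M"
  shows "f \<in> borel_measurable M"
proof (rule borel_measurable_euclidean_space[THEN iffD2], intro ballI)
  fix b :: "real^'n^'m" assume "b \<in> Basis"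
  then obtain i j where b: "b = axis i (axis j 1)" by (auto simp: Basis_vec_def)
  show "(\<lambda>\<omega>. f \<omega> \<bullet> b) \<in> borel_measurable M"
    by (simp only: b inner_axis inner_real_def mult_1_right) (rule assms)
qed

lemma borel_measurable_vector:
  fixes f :: "'b \<Rightarrow> real^'n"
  assumes "\<And>i. (\<lambda>\<omega>. f \<omega> $ i) \<in> borel_measurable M"
  shows "f \<in> borel_measurable M"
proof (rule borel_measurable_euclidean_space[THEN iffD2], intro ballI)
  fix b :: "real^'n" assume "b \<in> Basis"
  then obtain i where b: "b = axis i 1" by (auto simp: Basis_vec_def)
  show "(\<lambda>\<omega>. f \<omega> \<bullet> b) \<in> borel_measurable M"
    by (simp only: b inner_axis inner_real_def mult_1_right) (rule assms)
qed

lemma measurable_vec_nth [measurable (raw)]: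
  fixes f :: "'b \<Rightarrow> 'a::euclidean_space^'n"
  assumes "f \<in> borel_measurable M"
  shows "(\<lambda>\<omega>. f \<omega> $ i) \<in> borel_measurable M"
proof -
  have "(\<lambda>x::'a^'n. x $ i) \<in> borel_measurable borel"
    by (intro borel_measurable_continuous_onI continuous_on_component continuous_on_id)
  with assms show ?thesis by (rule measurable_compose)
qed

lemma measurable_det [measurable (raw)]:
  fixes f :: "'b \<Rightarrow> real^'n^'n"
  assumes [measurable]: "f \<in> borel_measurable M"
  shows "(\<lambda>\<omega>. det (f \<omega>)) \<in> borel_measurable M"
  unfolding det_def by measurable

lemma measurable_matrix_mult [measurable (raw)]:
  fixes f :: "'b \<Rightarrow> real^'n^'m" and g :: "'b \<Rightarrow> real^'k^'n"
  assumes [measurable]: "f \<in> borel_measurable M" "g \<in> borel_measurable M"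
  shows "(\<lambda>\<omega>. f \<omega> ** g \<omega>) \<in> borel_measurable M"
  by (rule borel_measurable_matrix) (simp add: matrix_matrix_mult_def)

lemma measurable_transpose [measurable (raw)]:
  fixes f :: "'b \<Rightarrow> real^'n^'m"
  assumes [measurable]: "f \<in> borel_measurable M"
  shows "(\<lambda>\<omega>. transpose (f \<omega>)) \<in> borel_measurable M"
  by (rule borel_measurable_matrix) (simp add: transpose_def)

lemma measurable_matrix_vector_mult [measurable (raw)]:
  fixes f :: "'b \<Rightarrow> real^'n^'m"
  assumes [measurable]: "f \<in> borel_measurable M" "g \<in> borel_measurable M"
  shows "(\<lambda>\<omega>. f \<omega> *v g \<omega>) \<in> borel_measurable M"
  by (rule borel_measurable_vector) (simp add: matrix_vector_mult_def)

lemma orthogonal_matrix_borel: "{M :: real^'n^'n. orthogonal_matrix M} \<in> sets borel"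
proof -
  have eq: "orthogonal_matrix M \<longleftrightarrow> (\<forall>i j. (transpose M ** M) $ i $ j = (mat 1 :: real^'n^'n) $ i $ j)" for M :: "real^'n^'n"
    by (simp add: orthogonal_matrix vec_eq_iff)
  have "{M \<in> space borel. \<forall>i j. (transpose M ** M) $ i $ j = (mat 1 :: real^'n^'n) $ i $ j} \<in> sets borel"
    by measurable
  then show ?thesis by (simp add: eq)
qed

abbreviation SO_space :: "(real^'n^'n) measure" where
  "SO_space \<equiv> restrict_space borel SO"

lemma SO_space_mult: "R \<in> SO \<Longrightarrow> (\<lambda>M. R ** M) \<in> measurable SO_space SO_space"
  by (intro measurable_restrict_space2 measurable_restrict_space1) (auto simp: space_restrict_space SO_mult)

section \<open>Random orthonormal frames from the uniform distribution on the ball\<close>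

definition unif_ball :: "(real^'n) measure" where
  "unif_ball = uniform_measure lborel (cball 0 1)"

lemma emeasure_cball_pos_finite:
  "emeasure lborel (cball 0 1 :: (real^'n) set) \<noteq> 0" "emeasure lborel (cball 0 1 :: (real^'n) set) \<noteq> \<infinity>"
proof -
  show "emeasure lborel (cball 0 1 :: (real^'n) set) \<noteq> \<infinity>"
    using emeasure_lborel_cball_finite[of "0::real^'n" 1] by simp
  show "emeasure lborel (cball 0 1 :: (real^'n) set) \<noteq> 0"
    by (simp add: emeasure_cball less_imp_neq[OF unit_ball_vol_pos, symmetric])
qed

lemma sets_unif_ball [simp, measurable_cong]: "sets unif_ball = sets borel"
  by (simp add: unif_ball_def)

lemma space_unif_ball [simp]: "space unif_ball = UNIV"
  by (simp add: unif_ball_def)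

lemma prob_unif_ball: "prob_space unif_ball"
  unfolding unif_ball_def using emeasure_cball_pos_finite by (rule prob_space_uniform_measure)

lemma unif_ball_orthogonal:
  fixes R :: "real^'n \<Rightarrow> real^'n"
  assumes R: "orthogonal_transformation R"
  shows "distr unif_ball unif_ball R = unif_ball"
proof (rule measure_eqI)
  note orthogonal_transformation_measurable[OF R, measurable]
  fix A assume "A \<in> sets (distr unif_ball unif_ball R)"
  then have A[measurable]: "A \<in> sets borel" by simp
  have v: "R -` A \<in> sets borel" by (rule measurable_sets_borel[OF _ A]) measurable
  have "emeasure (distr unif_ball unif_ball R) A = emeasure unif_ball (R -` A)"
    by (subst emeasure_distr) auto
  also have "\<dots> = emeasure lborel (cball 0 1 \<inter> R -` A) / emeasure lborel (cball 0 1 :: (real^'n) set)"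
    unfolding unif_ball_def using v by simp
  also have "cball 0 1 \<inter> R -` A = R -` (cball 0 1 \<inter> A)"
    using R by (auto simp: orthogonal_transformation)
  also have "emeasure lborel (R -` (cball 0 1 \<inter> A)) = emeasure (distr lborel borel R) (cball 0 1 \<inter> A)"
    by (subst emeasure_distr) auto
  also have "\<dots> = emeasure lborel (cball 0 1 \<inter> A)" by (simp only: lborel_orthogonal[OF R])
  also have "\<dots> / emeasure lborel (cball 0 1 :: (real^'n) set) = emeasure unif_ball A"
    unfolding unif_ball_def by simp
  finally show "emeasure (distr unif_ball unif_ball R) A = emeasure unif_ball A" .
qed simp

lemma AE_lborel_not_in_lowdim:
  fixes V :: "'a::euclidean_space set"
  assumes "dim V < DIM('a)"
  shows "AE x in lborel. x \<notin> V"
proof -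
  have "closed (span V)" by (simp add: closed_subspace)
  moreover have "negligible (span V)" using assms by (intro negligible_lowdim) simp
  ultimately have "span V \<in> null_sets lborel"
    by (auto simp: negligible_iff_null_sets null_sets_completion_iff)
  from AE_not_in[OF this] show ?thesis
    by eventually_elim (use span_superset in auto)
qed

lemma AE_unif_ball_not_in_lowdim:
  fixes V :: "(real^'n) set"
  assumes "dim V < CARD('n)"
  shows "AE x in unif_ball. x \<notin> V"
proof -
  have "AE x in lborel. x \<notin> V" using AE_lborel_not_in_lowdim[of V] assms by simp
  then show ?thesis unfolding unif_ball_def by (intro AE_uniform_measureI) auto
qed

abbreviation unif_seq :: "(nat \<Rightarrow> real^'n) measure" where
  "unif_seq \<equiv> PiM {..<CARD('n)} (\<lambda>_. unif_ball)"

text \<open>By Fubini the \<open>i\<close>-th vector is integrated first, the others being fixed.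
  The residual vanishes only if this vector lies in the span of the \<open>i\<close> earlier
  outputs, a proper subspace and thus a null set.\<close>

lemma AE_gs_res_nonzero:
  assumes i: "i < CARD('n)"
  shows "AE A in (unif_seq :: (nat \<Rightarrow> real^'n) measure). gs_res A i \<noteq> 0"
proof -
  interpret prob_space "unif_ball :: (real^'n) measure" by (rule prob_unif_ball)
  interpret product_sigma_finite "\<lambda>_::nat. unif_ball :: (real^'n) measure" by standard
  let ?I = "{..<CARD('n)} - {i}"
  have I: "insert i ?I = {..<CARD('n)}" using i by auto
  have m: "(\<lambda>A. gs_res A i) \<in> borel_measurable (unif_seq :: (nat \<Rightarrow> real^'n) measure)"
    by (rule measurable_gs_res) (use i in \<open>auto intro!: measurable_component_singleton[of _ _ "\<lambda>_. unif_ball", simplified]\<close>)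
  have m'[measurable]: "{A \<in> space unif_seq. gs_res A i = (0::real^'n)} \<in> sets unif_seq"
    using m by measurable
  have "emeasure unif_seq {A \<in> space unif_seq. gs_res A i = (0::real^'n)}
    = (\<integral>\<^sup>+A. indicator {A \<in> space unif_seq. gs_res A i = (0::real^'n)} A \<partial>unif_seq)"
    by simp
  also have "\<dots> = (\<integral>\<^sup>+A. \<integral>\<^sup>+y. indicator {A \<in> space unif_seq. gs_res A i = (0::real^'n)} (A(i := y)) \<partial>unif_ball \<partial>PiM ?I (\<lambda>_. unif_ball))"
    using product_nn_integral_insert[of ?I i "indicator {A \<in> space unif_seq. gs_res A i = (0::real^'n)}"] unfolding I
    by simp
  also have "\<dots> = (\<integral>\<^sup>+A. 0 \<partial>PiM ?I (\<lambda>_. unif_ball :: (real^'n) measure))"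
  proof (rule nn_integral_cong)
    fix A :: "nat \<Rightarrow> real^'n"
    let ?V = "gs A ` {..<i}"
    have "dim ?V \<le> card ?V" by (rule dim_le_card) (auto simp: span_superset)
    also have "\<dots> \<le> i" using card_image_le[of "{..<i}" "gs A"] by simp
    finally have "dim (span ?V) < CARD('n)" using i by simp
    then have "AE y in unif_ball. y \<notin> span ?V" by (rule AE_unif_ball_not_in_lowdim)
    then have "AE y in unif_ball. indicator {A \<in> space unif_seq. gs_res A i = (0::real^'n)} (A(i := y)) = (0::ennreal)"
    proof eventually_elim
      fix y assume y: "y \<notin> span ?V"
      have g: "gs (A(i := y)) j = gs A j" if "j < i" for j
        by (rule gs_cong) (use that in auto)
      have "gs_res (A(i := y)) i = y - (\<Sum>j<i. (y \<bullet> gs A j) *\<^sub>R gs A j)"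
        by (simp add: gs_res_def g)
      moreover have "(\<Sum>j<i. (y \<bullet> gs A j) *\<^sub>R gs A j) \<in> span ?V"
        by (intro span_sum span_scale span_base) auto
      ultimately have "gs_res (A(i := y)) i \<noteq> 0" using y by auto
      then show "indicator {A \<in> space unif_seq. gs_res A i = (0::real^'n)} (A(i := y)) = (0::ennreal)"
        by simp
    qed
    then show "(\<integral>\<^sup>+y. indicator {A \<in> space unif_seq. gs_res A i = (0::real^'n)} (A(i := y)) \<partial>unif_ball) = 0"
      by (simp add: nn_integral_0_iff_AE cong: nn_integral_cong_AE)
  qed
  finally have "emeasure unif_seq {A \<in> space unif_seq. gs_res A i = (0::real^'n)} = 0" by simp
  then show ?thesis by (intro AE_I[of _ _ "{A \<in> space unif_seq. gs_res A i = 0}"]) auto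
qed

lemma unif_seq_orthogonal:
  fixes R :: "real^'n \<Rightarrow> real^'n"
  assumes R: "orthogonal_transformation R"
  shows "distr unif_seq unif_seq (compose {..<CARD('n)} R) = unif_seq"
proof -
  note orthogonal_transformation_measurable[OF R, measurable]
  have "distr unif_seq unif_seq (compose {..<CARD('n)} R) = PiM {..<CARD('n)} (\<lambda>i. distr unif_ball unif_ball R)"
    by (rule distr_PiM_finite_prob_space') (auto simp: prob_unif_ball)
  then show ?thesis by (simp add: unif_ball_orthogonal[OF R])
qed

lemma negative_reflection_exists:
  obtains D :: "real^'n^'n" where "orthogonal_matrix D" "det D = -1"
proof -
  have "(1::real^'n) \<noteq> 0" by simp
  then obtain S :: "real^'n \<Rightarrow> real^'n" where "orthogonal_transformation S" "det (matrix S) = -1"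
    using reflection_exists[of "1::real^'n"] by metis
  then show thesis using that by (auto simp: orthogonal_transformation_matrix)
qed

text \<open>Take the matrix whose columns are the Gram-Schmidt vectors of independent uniform points
  of the ball. Rotating the input leaves the law of the input unchanged and multiplies the matrix by
  the rotation from the left, hence the law of the matrix is left invariant.\<close>

lemma haar_exists:
  "\<exists>Q :: (real^'n^'n) measure. prob_space Q \<and> sets Q = sets SO_space \<and>
     (\<forall>R\<in>SO. distr Q Q (\<lambda>M. R ** M) = Q)"
proof -
  obtain idx :: "'n \<Rightarrow> nat" where idx: "bij_betw idx UNIV {..<CARD('n)}"
    using ex_bij_betw_finite_nat[of "UNIV :: 'n set"] by (auto simp: atLeast0LessThan)
  have idx_less: "idx c < CARD('n)" for c using idx by (auto simp: bij_betw_def)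
  have idx_inj: "idx c = idx d \<longleftrightarrow> c = d" for c d using idx by (auto simp: bij_betw_def inj_on_def)
  obtain D :: "real^'n^'n" where D: "orthogonal_matrix D" "det D = -1" by (rule negative_reflection_exists)
  define B :: "(nat \<Rightarrow> real^'n) \<Rightarrow> real^'n^'n" where "B = (\<lambda>A. \<chi> r c. gs A (idx c) $ r)"
  \<comment> \<open>Determinant \<open>-1\<close> is corrected by the fixed matrix \<open>D\<close>
    on the right, which commutes with left multiplication by rotations. The value
    \<open>mat 1\<close> on degenerate inputs keeps \<open>h\<close> inside \<open>SO\<close>
    everywhere.\<close>
  define h :: "(nat \<Rightarrow> real^'n) \<Rightarrow> real^'n^'n" where
    "h = (\<lambda>A. if orthogonal_matrix (B A) then if det (B A) = 1 then B A else B A ** D else mat 1)"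
  have B_orth: "orthogonal_matrix (B A)" if "ons (gs A) CARD('n)" for A
  proof -
    have c: "column c (B A) = gs A (idx c)" for c by (simp add: B_def column_def vec_eq_iff)
    show ?thesis
      unfolding orthogonal_matrix_orthonormal_columns c orthogonal_def
      using that idx_less idx_inj by (auto simp: ons_def norm_eq_1)
  qed
  have h_SO: "h A \<in> SO" for A
    using D det_orthogonal_matrix[of "B A"]
    by (auto simp: h_def SO_def orthogonal_matrix_mul det_mul orthogonal_matrix_id)
  have B_meas[measurable]: "B \<in> borel_measurable unif_seq"
    unfolding B_def
  proof (rule borel_measurable_matrix)
    fix r c :: 'n
    have [measurable]: "(\<lambda>A. gs A (idx c)) \<in> borel_measurable (unif_seq :: (nat \<Rightarrow> real^'n) measure)"
      by (rule measurable_gs) (use idx_less[of c] in \<open>auto intro!: measurable_component_singleton[of _ _ "\<lambda>_. unif_ball", simplified]\<close>)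
    show "(\<lambda>A. (\<chi> r c. gs A (idx c) $ r) $ r $ c) \<in> borel_measurable (unif_seq :: (nat \<Rightarrow> real^'n) measure)" by simp
  qed
  have [measurable]: "Measurable.pred unif_seq (\<lambda>A. orthogonal_matrix (B A))"
    using measurable_sets[OF B_meas orthogonal_matrix_borel] by (simp add: pred_def vimage_def Int_def conj_commute)
  have "h \<in> borel_measurable unif_seq" unfolding h_def by measurable
  then have h_meas: "h \<in> measurable unif_seq SO_space"
    by (rule measurable_restrict_space2[rotated]) (use h_SO in auto)
  have AE_ons: "AE A in (unif_seq :: (nat \<Rightarrow> real^'n) measure). ons (gs A) CARD('n)"
  proof -
    have "AE A in (unif_seq :: (nat \<Rightarrow> real^'n) measure). \<forall>i\<in>{..<CARD('n)}. gs_res A i \<noteq> 0"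
      by (rule AE_finite_allI) (auto intro: AE_gs_res_nonzero)
    then show ?thesis by eventually_elim (rule gs_ons, simp)
  qed
  let ?Q = "distr unif_seq SO_space h"
  show ?thesis
  proof (intro exI[of _ ?Q] conjI ballI)
    interpret product_prob_space "\<lambda>_::nat. unif_ball :: (real^'n) measure"
      by (rule product_prob_spaceI) (rule prob_unif_ball)
    show "prob_space ?Q" by (rule prob_space.prob_space_distr[OF prob_space_PiM h_meas]) (rule prob_unif_ball)
    fix R :: "real^'n^'n" assume R: "R \<in> SO"
    let ?R = "(*v) R"
    have ot: "orthogonal_transformation ?R" using R by (rule SO_orthogonal)
    note orthogonal_transformation_measurable[OF ot, measurable]
    have equi: "h (compose {..<CARD('n)} ?R A) = R ** h A" if "ons (gs A) CARD('n)" for A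
    proof -
      have g: "gs (compose {..<CARD('n)} ?R A) i = ?R (gs A i)" if "i < CARD('n)" for i
        by (rule gs_isometry[OF ot]) (use that in \<open>auto simp: compose_def\<close>)
      have BR: "B (compose {..<CARD('n)} ?R A) = R ** B A"
        by (simp add: B_def vec_eq_iff g[OF idx_less] matrix_matrix_mult_def matrix_vector_mult_def)
      have "orthogonal_matrix (R ** B A)" using R B_orth[OF that] by (simp add: SO_def orthogonal_matrix_mul)
      then show ?thesis using R B_orth[OF that]
        by (simp add: h_def BR det_mul SO_def matrix_mul_assoc)
    qed
    have T: "compose {..<CARD('n)} ?R \<in> measurable unif_seq unif_seq"
      unfolding compose_def by (rule measurable_restrict) measurable
    note SO_space_mult[OF R, measurable] h_meas[measurable] T[measurable]
    have "distr ?Q ?Q (\<lambda>M. R ** M) = distr unif_seq SO_space (\<lambda>A. R ** h A)"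
      by (subst distr_distr) (auto simp: comp_def intro!: distr_cong)
    also have "\<dots> = distr unif_seq SO_space (\<lambda>A. h (compose {..<CARD('n)} ?R A))"
      by (rule distr_cong_AE) (use AE_ons equi in \<open>auto elim!: eventually_mono\<close>)
    also have "\<dots> = distr (distr unif_seq unif_seq (compose {..<CARD('n)} ?R)) SO_space h"
      by (subst distr_distr) (auto simp: comp_def)
    also have "\<dots> = ?Q" by (simp only: unif_seq_orthogonal[OF ot])
    finally show "distr ?Q ?Q (\<lambda>M. R ** M) = ?Q" .
  qed simp
qed

section \<open>Invariance of Haar measure and its action on sets\<close>

definition haar :: "(real^'n^'n) measure" where
  "haar = (SOME Q. prob_space Q \<and> sets Q = sets SO_space \<and> (\<forall>R\<in>SO. distr Q Q (\<lambda>M. R ** M) = Q))"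

lemma haar_spec:
  "prob_space (haar :: (real^'n^'n) measure)"
  "sets (haar :: (real^'n^'n) measure) = sets SO_space"
  "(R :: real^'n^'n) \<in> SO \<Longrightarrow> distr haar haar (\<lambda>M. R ** M) = haar"
  using someI_ex[OF haar_exists] unfolding haar_def[symmetric] by blast+

declare haar_spec(2) [simp, measurable_cong]

lemma space_haar [simp]: "space haar = SO"
  using sets_eq_imp_space_eq[OF haar_spec(2)] by (simp add: space_restrict_space)

lemma measurable_haar_id: "(\<lambda>M. M) \<in> borel_measurable haar"
  by (simp add: measurable_cong_sets[OF haar_spec(2) refl] measurable_restrict_space1)

lemma measurable_into_haar:
  assumes "f \<in> borel_measurable M" "\<And>\<omega>. \<omega> \<in> space M \<Longrightarrow> f \<omega> \<in> SO"
  shows "f \<in> measurable M haar"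
  by (subst measurable_cong_sets[OF refl haar_spec(2)], rule measurable_restrict_space2) (use assms in auto)

lemma measurable_haar_transpose: "transpose \<in> measurable haar haar"
  by (rule measurable_into_haar) (use measurable_haar_id in \<open>auto intro!: measurable_transpose SO_transpose\<close>)

lemma haar_left:
  assumes R: "R \<in> SO" and f: "f \<in> borel_measurable haar"
  shows "(\<integral>\<^sup>+M. f (R ** M) \<partial>haar) = (\<integral>\<^sup>+M. f M \<partial>haar)"
proof -
  have m: "(\<lambda>M. R ** M) \<in> measurable haar haar"
    by (rule measurable_into_haar) (use R measurable_haar_id in \<open>auto intro!: measurable_matrix_mult SO_mult\<close>)
  have "(\<integral>\<^sup>+M. f M \<partial>haar) = (\<integral>\<^sup>+M. f M \<partial>distr haar haar (\<lambda>M. R ** M))" by (simp only: haar_spec(3)[OF R])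
  also have "\<dots> = (\<integral>\<^sup>+M. f (R ** M) \<partial>haar)" by (rule nn_integral_distr[OF m]) (simp add: f)
  finally show ?thesis by simp
qed

lemma nn_integral_haar_const: "(\<integral>\<^sup>+M. c \<partial>haar) = c"
  by (simp only: nn_integral_const prob_space.emeasure_space_1[OF haar_spec(1)] mult_1_right)

text \<open>Left invariance in one variable of \<open>\<integral>\<integral> f (N\<^sup>T M)\<close> and in the other variable of the same
  integral, read as \<open>\<integral>\<integral> f ((M\<^sup>T N)\<^sup>T)\<close>, gives invariance under inversion.\<close>

lemma haar_transpose:
  fixes f :: "real^'n^'n \<Rightarrow> ennreal"
  assumes f: "f \<in> borel_measurable haar"
  shows "(\<integral>\<^sup>+M. f (transpose M) \<partial>haar) = (\<integral>\<^sup>+M. f M \<partial>haar)"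
proof -
  interpret prob_space "haar :: (real^'n^'n) measure" by (rule haar_spec)
  interpret P: pair_sigma_finite "haar :: (real^'n^'n) measure" "haar :: (real^'n^'n) measure" ..
  note measurable_haar_id[measurable]
  have m: "(\<lambda>(M, N). f (transpose N ** M)) \<in> borel_measurable (haar \<Otimes>\<^sub>M haar)"
  proof -
    have "(\<lambda>p. transpose (snd p) ** fst p) \<in> measurable (haar \<Otimes>\<^sub>M haar) (haar :: (real^'n^'n) measure)"
    proof (rule measurable_into_haar)
      show "(\<lambda>p. transpose (snd p) ** fst p) \<in> borel_measurable (haar \<Otimes>\<^sub>M (haar :: (real^'n^'n) measure))"
        by (intro measurable_matrix_mult measurable_transpose measurable_compose[OF _ measurable_haar_id] measurable_fst measurable_snd)
    qed (auto simp: space_pair_measure SO_mult SO_transpose)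
    from measurable_compose[OF this f] show ?thesis by (simp add: case_prod_beta')
  qed
  have "(\<integral>\<^sup>+M. f M \<partial>haar) = (\<integral>\<^sup>+N. \<integral>\<^sup>+M. f (transpose N ** M) \<partial>haar \<partial>haar)"
    by (subst nn_integral_haar_const[of "\<integral>\<^sup>+M. f M \<partial>haar", symmetric], rule nn_integral_cong)
      (simp add: haar_left[OF SO_transpose f])
  also have "\<dots> = (\<integral>\<^sup>+M. \<integral>\<^sup>+N. f (transpose N ** M) \<partial>haar \<partial>haar)"
    using P.Fubini[OF m] by simp
  also have "\<dots> = (\<integral>\<^sup>+M. \<integral>\<^sup>+N. f (transpose (transpose M ** N)) \<partial>haar \<partial>haar)"
    by (simp add: matrix_transpose_mul)
  also have "\<dots> = (\<integral>\<^sup>+M. \<integral>\<^sup>+N. f (transpose N) \<partial>haar \<partial>(haar :: (real^'n^'n) measure))"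
    by (rule nn_integral_cong)
      (simp add: haar_left[OF SO_transpose measurable_compose[OF measurable_haar_transpose f]])
  also have "\<dots> = (\<integral>\<^sup>+N. f (transpose N) \<partial>haar)" by (rule nn_integral_haar_const)
  finally show ?thesis by simp
qed

text \<open>Transposition turns right multiplication into left multiplication and preserves the
  integral by \<open>haar_transpose\<close>.\<close>

lemma haar_right:
  fixes f :: "real^'n^'n \<Rightarrow> ennreal"
  assumes R: "R \<in> SO" and f: "f \<in> borel_measurable haar"
  shows "(\<integral>\<^sup>+M. f (M ** R) \<partial>haar) = (\<integral>\<^sup>+M. f M \<partial>haar)"
proof -
  have m: "(\<lambda>M. M ** R) \<in> measurable haar haar"
    by (rule measurable_into_haar) (use R measurable_haar_id in \<open>auto intro!: measurable_matrix_mult SO_mult\<close>)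
  have "(\<integral>\<^sup>+M. f (M ** R) \<partial>haar) = (\<integral>\<^sup>+M. f (transpose M ** R) \<partial>haar)"
    using haar_transpose[OF measurable_compose[OF m f]] by simp
  also have "\<dots> = (\<integral>\<^sup>+M. f (transpose (transpose R ** M)) \<partial>haar)"
    by (simp add: matrix_transpose_mul)
  also have "\<dots> = (\<integral>\<^sup>+M. f (transpose M) \<partial>haar)"
    using haar_left[OF SO_transpose[OF R] measurable_compose[OF measurable_haar_transpose f]] by simp
  also have "\<dots> = (\<integral>\<^sup>+M. f M \<partial>haar)" by (rule haar_transpose[OF f])
  finally show ?thesis .
qed

text \<open>The distance from \<open>x\<close> to the rotated set equals the distance from the
  back-rotated point to the original set. Both may depend on \<open>\<omega>\<close>, which is the
  situation of \<open>measurable_infdist_joint\<close>.\<close>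

lemma measurable_haar_action:
  fixes M :: "'b measure" and r :: "'b \<Rightarrow> real^'n^'n"
  assumes r: "r \<in> measurable M haar" and F: "\<And>y. (\<lambda>\<omega>. infdist y (F \<omega>)) \<in> borel_measurable M"
    and im: "\<And>\<omega>. \<omega> \<in> space M \<Longrightarrow> (*v) (r \<omega>) ` F \<omega> \<in> \<Omega>"
  shows "(\<lambda>\<omega>. (*v) (r \<omega>) ` F \<omega>) \<in> measurable M (set_sigma \<Omega>)"
proof (rule measurable_set_sigma)
  fix x :: "real^'n"
  note measurable_compose[OF r measurable_haar_id, measurable]
  have "(\<lambda>\<omega>. infdist (transpose (r \<omega>) *v x) (F \<omega>)) \<in> borel_measurable M"
    by (rule measurable_infdist_joint[OF F]) measurable
  moreover have "infdist (transpose (r \<omega>) *v x) (F \<omega>) = infdist x ((*v) (r \<omega>) ` F \<omega>)" if "\<omega> \<in> space M" for \<omega>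
  proof -
    have so: "r \<omega> \<in> SO" using measurable_space[OF r that] by simp
    have "r \<omega> *v (transpose (r \<omega>) *v x) = x"
      by (simp only: matrix_vector_mul_assoc SO_inverse[OF so] matrix_vector_mul_lid)
    then show ?thesis using infdist_orthogonal_image[OF SO_orthogonal[OF so], of "transpose (r \<omega>) *v x" "F \<omega>"] by simp
  qed
  ultimately show "(\<lambda>\<omega>. infdist x ((*v) (r \<omega>) ` F \<omega>)) \<in> borel_measurable M"
    by (rule measurable_cong[THEN iffD1, rotated])
qed (use im in auto)

subsection \<open>The invariant measure on the Grassmannian\<close>

lemma Grass_exists:
  assumes "k \<le> CARD('n)"
  obtains L :: "(real^'n) set" where "L \<in> Grass k"
proof -
  obtain b :: "nat \<Rightarrow> real^'n" where b: "ons b DIM(real^'n)"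
    using ons_exists[OF subspace_UNIV] by (metis dim_UNIV)
  then have "ons b k" using assms ons_mono by auto
  then show thesis using that[of "span (b ` {..<k})"] ons_dim by (auto simp: Grass_def)
qed

lemma SO_image_Grass: "M \<in> SO \<Longrightarrow> L \<in> Grass k \<Longrightarrow> (*v) M ` L \<in> Grass k"
  using image_Grass SO_orthogonal by blast

lemma SO_image_AffGrass: "M \<in> SO \<Longrightarrow> E \<in> AffGrass k \<Longrightarrow> (*v) M ` E \<in> AffGrass k"
  using image_AffGrass SO_orthogonal by blast

lemma measurable_action_Grass:
  fixes r :: "'b \<Rightarrow> real^'n^'n"
  assumes "r \<in> measurable M haar" "F \<in> measurable M (set_sigma (Grass k))"
  shows "(\<lambda>\<omega>. (*v) (r \<omega>) ` F \<omega>) \<in> measurable M (set_sigma (Grass k))"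
  using assms by (intro measurable_haar_action measurable_infdist_comp SO_image_Grass)
    (auto dest: measurable_space)

lemma measurable_action_AffGrass:
  fixes r :: "'b \<Rightarrow> real^'n^'n"
  assumes "r \<in> measurable M haar" "F \<in> measurable M (set_sigma (AffGrass k))"
  shows "(\<lambda>\<omega>. (*v) (r \<omega>) ` F \<omega>) \<in> measurable M (set_sigma (AffGrass k))"
  using assms by (intro measurable_haar_action measurable_infdist_comp SO_image_AffGrass)
    (auto dest: measurable_space)

text \<open>Some rotation takes \<open>E\<close> to \<open>F\<close>, and right invariance absorbs
  it. The range \<open>\<Omega>\<close> is left open so that the lemma serves for the sigma-algebra
  of subspaces as well as for that of flats.\<close>

lemma haar_orbit_AffGrass:
  fixes E F :: "(real^'n) set"
  assumes n: "CARD('n) \<ge> 2" "k < CARD('n)" and EF: "E \<in> AffGrass k" "F \<in> AffGrass k" "infdist 0 E = infdist 0 F"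
    and \<Omega>: "\<Omega> \<subseteq> AffGrass k" "\<And>M. M \<in> SO \<Longrightarrow> (*v) M ` E \<in> \<Omega>"
    and f: "f \<in> borel_measurable (set_sigma \<Omega>)"
  shows "(\<integral>\<^sup>+M. f ((*v) M ` E) \<partial>haar) = (\<integral>\<^sup>+M. f ((*v) M ` F) \<partial>haar)"
proof -
  obtain R where R: "R \<in> rotations" "R ` E = F" using rotation_transitive[OF n EF] .
  have F: "(*v) (matrix R) ` E = F" and S: "matrix R \<in> SO" using rotation_SO[OF R(1)] R(2) by auto
  have "(\<lambda>M. (*v) M ` E) \<in> measurable haar (set_sigma \<Omega>)"
    by (rule measurable_haar_action) (use \<Omega> in auto)
  from haar_right[OF S measurable_compose[OF this f]]
  have "(\<integral>\<^sup>+M. f ((*v) (M ** matrix R) ` E) \<partial>haar) = (\<integral>\<^sup>+M. f ((*v) M ` E) \<partial>haar)" .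
  moreover have "(*v) (M ** matrix R) ` E = (*v) M ` F" for M :: "real^'n^'n"
    unfolding F[symmetric] image_image matrix_vector_mul_assoc ..
  ultimately show ?thesis by (simp only:)
qed

text \<open>This resolves the \<open>THE\<close> in \<open>nu\<close>. Existence: the orbit of
  \<open>L0\<close> under Haar measure inherits left invariance. Uniqueness: an invariant
  \<open>M1\<close> is unchanged by averaging over rotations; after exchanging the integrals, the
  inner one is the same for every starting subspace \<open>L\<close>, so it may be computed at
  \<open>L0\<close>.\<close>

lemma nu_eq:
  fixes L0 :: "(real^'n) set"
  assumes n: "CARD('n) \<ge> 2" "k < CARD('n)" and L0: "L0 \<in> Grass k"
  shows "nu k = distr haar (set_sigma (Grass k)) (\<lambda>M. (*v) M ` L0)"
proof -
  let ?G = "set_sigma (Grass k) :: (real^'n) set measure"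
  let ?N = "distr haar ?G (\<lambda>M. (*v) M ` L0)"
  have act: "(\<lambda>M. (*v) M ` L) \<in> measurable haar ?G" if "L \<in> Grass k" for L
    by (rule measurable_action_Grass) (use that in auto)
  have N: "(\<integral>\<^sup>+L. f L \<partial>?N) = (\<integral>\<^sup>+M. f ((*v) M ` L0) \<partial>haar)" if "f \<in> borel_measurable ?G" for f
    by (rule nn_integral_distr[OF act[OF L0]]) (simp add: that)
  have rot: "(\<lambda>L. \<eta> ` L) \<in> measurable ?G ?G" if "\<eta> \<in> rotations" for \<eta>
  proof -
    have "(\<lambda>L. (*v) (matrix \<eta>) ` L) \<in> measurable ?G ?G"
      by (rule measurable_action_Grass) (use rotation_SO[OF that] in auto)
    then show ?thesis using rotation_SO[OF that] by simp
  qed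
  show ?thesis unfolding nu_def
  proof (rule the_equality, intro conjI ballI)
    show "prob_space ?N" by (rule prob_space.prob_space_distr[OF haar_spec(1) act[OF L0]])
    fix \<eta> :: "real^'n \<Rightarrow> real^'n" assume \<eta>: "\<eta> \<in> rotations"
    show "distr ?N ?N (\<lambda>L. \<eta> ` L) = ?N"
    proof (rule measure_eqI)
      fix A assume "A \<in> sets (distr ?N ?N (\<lambda>L. \<eta> ` L))"
      then have A[measurable]: "A \<in> sets ?G" by simp
      have "emeasure (distr ?N ?N (\<lambda>L. \<eta> ` L)) A = (\<integral>\<^sup>+L. indicator A L \<partial>distr ?N ?N (\<lambda>L. \<eta> ` L))" by simp
      also have "\<dots> = (\<integral>\<^sup>+L. indicator A (\<eta> ` L) \<partial>?N)"
        by (rule nn_integral_distr) (use rot[OF \<eta>] in \<open>auto simp: measurable_distr_eq1 measurable_distr_eq2\<close>)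
      also have "\<dots> = (\<integral>\<^sup>+M. indicator A (\<eta> ` (*v) M ` L0) \<partial>haar)"
        by (rule N, rule measurable_compose[OF rot[OF \<eta>]]) simp
      also have "\<dots> = (\<integral>\<^sup>+M. indicator A ((*v) (matrix \<eta> ** M) ` L0) \<partial>haar)"
        using rotation_SO(2)[OF \<eta>] by (simp add: image_image flip: matrix_vector_mul_assoc)
      also have "\<dots> = (\<integral>\<^sup>+M. indicator A ((*v) M ` L0) \<partial>haar)"
        by (rule haar_left[OF rotation_SO(1)[OF \<eta>]], rule measurable_compose[OF act[OF L0]]) simp
      also have "\<dots> = (\<integral>\<^sup>+L. indicator A L \<partial>?N)" by (rule N[symmetric]) simp
      finally show "emeasure (distr ?N ?N (\<lambda>L. \<eta> ` L)) A = emeasure ?N A" by simp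
    qed simp
  next
    fix M1 assume M1: "sets M1 = sets ?G \<and> prob_space M1 \<and> (\<forall>\<eta>\<in>rotations. distr M1 M1 (\<lambda>L. \<eta> ` L) = M1)"
    then have s[simp, measurable_cong]: "sets M1 = sets ?G" by blast
    have sp[simp]: "space M1 = Grass k" using sets_eq_imp_space_eq[OF s] by simp
    interpret M1: prob_space M1 using M1 by blast
    interpret H: prob_space "haar :: (real^'n^'n) measure" by (rule haar_spec)
    interpret P: pair_sigma_finite "haar :: (real^'n^'n) measure" M1 ..
    show "M1 = ?N"
    proof (rule measure_eqI)
      fix A assume "A \<in> sets M1"
      then have A[measurable]: "A \<in> sets ?G" by simp
      have m: "(\<lambda>(M, L). indicator A ((*v) M ` L) :: ennreal) \<in> borel_measurable (haar \<Otimes>\<^sub>M M1)"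
      proof -
        have "(\<lambda>p. (*v) (fst p) ` (snd p)) \<in> measurable (haar \<Otimes>\<^sub>M M1) ?G"
          by (rule measurable_action_Grass) (auto simp: measurable_cong_sets[OF refl s[symmetric]])
        then have "(\<lambda>p. indicator A ((*v) (fst p) ` (snd p)) :: ennreal) \<in> borel_measurable (haar \<Otimes>\<^sub>M M1)"
          by (rule measurable_compose) simp
        then show ?thesis by (simp add: case_prod_beta')
      qed
      have inv: "(\<integral>\<^sup>+L. indicator A ((*v) M ` L) \<partial>M1) = emeasure M1 A" if "M \<in> SO" for M :: "real^'n^'n"
      proof -
        have "(\<integral>\<^sup>+L. indicator A ((*v) M ` L) \<partial>M1) = (\<integral>\<^sup>+L. indicator A L \<partial>distr M1 M1 (\<lambda>L. (*v) M ` L))"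
          by (rule nn_integral_distr[symmetric])
            (use rot[OF SO_rotation[OF that]] in \<open>auto simp: measurable_cong_sets[OF s s]\<close>)
        also have "\<dots> = (\<integral>\<^sup>+L. indicator A L \<partial>M1)" using M1 SO_rotation[OF that] by metis
        finally show ?thesis by simp
      qed
      have "emeasure M1 A = (\<integral>\<^sup>+M. \<integral>\<^sup>+L. indicator A ((*v) M ` L) \<partial>M1 \<partial>haar)"
        by (subst nn_integral_haar_const[of "emeasure M1 A", symmetric], rule nn_integral_cong) (simp add: inv)
      also have "\<dots> = (\<integral>\<^sup>+L. \<integral>\<^sup>+M. indicator A ((*v) M ` L) \<partial>haar \<partial>M1)"
        by (rule P.Fubini'[symmetric]) (use m in simp)
      also have "\<dots> = (\<integral>\<^sup>+L. \<integral>\<^sup>+M. indicator A ((*v) M ` L0) \<partial>haar \<partial>M1)"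
      proof (rule nn_integral_cong)
        fix L assume "L \<in> space M1"
        then have L: "L \<in> Grass k" by simp
        show "(\<integral>\<^sup>+M. indicator A ((*v) M ` L) \<partial>haar) = (\<integral>\<^sup>+M. indicator A ((*v) M ` L0) \<partial>haar)"
          using L L0 Grass_sub_AffGrass[of k]
          by (intro haar_orbit_AffGrass[OF n, of _ _ "Grass k"]) (auto simp: SO_image_Grass GrassD(1) subspace_0)
      qed
      also have "\<dots> = (\<integral>\<^sup>+M. indicator A ((*v) M ` L0) \<partial>haar)" using M1.emeasure_space_1 by simp
      also have "\<dots> = (\<integral>\<^sup>+L. indicator A L \<partial>?N)" by (rule N[symmetric]) simp
      finally show "emeasure M1 A = emeasure ?N A" by simp
    qed simp
  qed simp
qed

lemma nu_spec:
  assumes n: "CARD('n) \<ge> 2" "k < CARD('n)"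
  shows "sets (nu k :: (real^'n) set measure) = sets (set_sigma (Grass k))"
    and "prob_space (nu k :: (real^'n) set measure)"
proof -
  obtain L0 :: "(real^'n) set" where L0: "L0 \<in> Grass k" using Grass_exists[of k, where 'n='n] n by auto
  show "sets (nu k :: (real^'n) set measure) = sets (set_sigma (Grass k))"
    using nu_eq[OF n L0] by simp
  show "prob_space (nu k :: (real^'n) set measure)"
    unfolding nu_eq[OF n L0]
    by (rule prob_space.prob_space_distr[OF haar_spec(1)], rule measurable_action_Grass) (use L0 in auto)
qed

lemma nn_integral_nu_haar:
  fixes L0 :: "(real^'n) set"
  assumes n: "CARD('n) \<ge> 2" "k < CARD('n)" and L0: "L0 \<in> Grass k"
    and f: "f \<in> borel_measurable (set_sigma (Grass k))"
  shows "(\<integral>\<^sup>+L. f L \<partial>nu k) = (\<integral>\<^sup>+M. f ((*v) M ` L0) \<partial>haar)"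
  unfolding nu_eq[OF n L0]
  by (rule nn_integral_distr, rule measurable_action_Grass) (use L0 f in auto)

lemma nu_invariant:
  fixes f :: "(real^'n) set \<Rightarrow> ennreal"
  assumes n: "CARD('n) \<ge> 2" "k < CARD('n)" and M: "M \<in> SO"
    and f: "f \<in> borel_measurable (set_sigma (Grass k))"
  shows "(\<integral>\<^sup>+L. f ((*v) M ` L) \<partial>nu k) = (\<integral>\<^sup>+L. f L \<partial>nu k)"
proof -
  obtain L0 :: "(real^'n) set" where L0: "L0 \<in> Grass k" using Grass_exists[of k, where 'n='n] n by auto
  have "(\<lambda>L. (*v) M ` L) \<in> measurable (set_sigma (Grass k)) (set_sigma (Grass k))"
    by (rule measurable_action_Grass) (use M in auto)
  from nn_integral_nu_haar[OF n L0 measurable_compose[OF this f]]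
  have "(\<integral>\<^sup>+L. f ((*v) M ` L) \<partial>nu k) = (\<integral>\<^sup>+N. f ((*v) (M ** N) ` L0) \<partial>haar)"
    by (simp add: image_image flip: matrix_vector_mul_assoc)
  also have "\<dots> = (\<integral>\<^sup>+N. f ((*v) N ` L0) \<partial>haar)"
  proof (rule haar_left[OF M])
    have "(\<lambda>N. (*v) N ` L0) \<in> measurable haar (set_sigma (Grass k))"
      by (rule measurable_action_Grass) (use L0 in auto)
    then show "(\<lambda>N. f ((*v) N ` L0)) \<in> borel_measurable haar" using f by (rule measurable_compose)
  qed
  also have "\<dots> = (\<integral>\<^sup>+L. f L \<partial>nu k)" by (rule nn_integral_nu_haar[OF n L0 f, symmetric])
  finally show ?thesis .
qed

subsection \<open>Lebesgue measure on subspaces\<close>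

text \<open>For the standard basis the image measure agrees with Lebesgue measure on boxes. Any
  other orthonormal basis arises from it by an orthogonal map, under which \<open>lborel\<close> is
  invariant.\<close>

lemma lborel_ons:
  fixes b :: "nat \<Rightarrow> 'a::euclidean_space"
  assumes b: "ons b DIM('a)"
  shows "distr (PiM {..<DIM('a)} (\<lambda>_. lborel)) borel (\<lambda>c. \<Sum>i<DIM('a). c i *\<^sub>R b i) = lborel"
proof -
  interpret product_sigma_finite "\<lambda>_::nat. lborel :: real measure" by standard
  obtain h where h: "bij_betw h {..<DIM('a)} (Basis :: 'a set)"
    using ex_bij_betw_nat_finite[of "Basis :: 'a set"] by (auto simp: atLeast0LessThan)
  have hB: "h i \<in> Basis" if "i < DIM('a)" for i using h that by (auto simp: bij_betw_def)
  have hinj: "h i = h j \<longleftrightarrow> i = j" if "i < DIM('a)" "j < DIM('a)" for i j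
    using h that by (auto simp: bij_betw_def inj_on_def)
  have oh: "ons h DIM('a)" using hB hinj by (auto simp: ons_def inner_Basis)
  let ?P = "PiM {..<DIM('a)} (\<lambda>_. lborel :: real measure)"
  let ?h = "\<lambda>c. \<Sum>i<DIM('a). c i *\<^sub>R h i"
  have hm[measurable]: "?h \<in> borel_measurable ?P" by measurable
  have h_eq: "distr ?P borel ?h = lborel"
  proof (rule lborel_eqI[symmetric])
    fix l u :: 'a assume le: "\<And>b. b \<in> Basis \<Longrightarrow> l \<bullet> b \<le> u \<bullet> b"
    have bx: "x \<in> box l u \<longleftrightarrow> (\<forall>i<DIM('a). l \<bullet> h i < x \<bullet> h i \<and> x \<bullet> h i < u \<bullet> h i)" for x
      using h by (force simp: mem_box bij_betw_def)
    have "?h -` box l u \<inter> space ?P = (\<Pi>\<^sub>E i\<in>{..<DIM('a)}. {l \<bullet> h i<..<u \<bullet> h i})"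
      by (auto simp: space_PiM bx ons_inner_sum[OF oh] PiE_def Pi_def)
    then have "emeasure (distr ?P borel ?h) (box l u) = emeasure ?P (\<Pi>\<^sub>E i\<in>{..<DIM('a)}. {l \<bullet> h i<..<u \<bullet> h i})"
      by (subst emeasure_distr) auto
    also have "\<dots> = (\<Prod>i<DIM('a). ennreal (u \<bullet> h i - l \<bullet> h i))"
      by (subst emeasure_PiM) (auto intro!: prod.cong simp: le hB)
    also have "\<dots> = ennreal (\<Prod>i<DIM('a). (u - l) \<bullet> h i)"
      by (subst prod_ennreal) (auto simp: le hB inner_diff_left)
    also have "(\<Prod>i<DIM('a). (u - l) \<bullet> h i) = (\<Prod>b\<in>Basis. (u - l) \<bullet> b)"
      by (rule prod.reindex_bij_betw[OF h])
    finally show "emeasure (distr ?P borel ?h) (box l u) = ennreal (\<Prod>b\<in>Basis. (u - l) \<bullet> b)" .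
  qed simp
  obtain R where R: "orthogonal_transformation R" "\<And>i. i < DIM('a) \<Longrightarrow> R (h i) = b i"
    using ons_orthogonal_transformation[OF oh b] by blast
  note orthogonal_transformation_measurable[OF R(1), measurable]
  have lin: "linear R" using R orthogonal_transformation_linear by blast
  have "lborel = distr lborel borel R" by (simp only: lborel_orthogonal[OF R(1)])
  also have "\<dots> = distr (distr ?P borel ?h) borel R" by (simp only: h_eq)
  also have "\<dots> = distr ?P borel (\<lambda>c. R (?h c))" by (subst distr_distr) (auto simp: comp_def)
  also have "(\<lambda>c. R (?h c)) = (\<lambda>c. \<Sum>i<DIM('a). c i *\<^sub>R b i)"
    using R(2) by (simp add: linear_sum[OF lin] linear_scale[OF lin])
  finally show ?thesis by simp
qed

text \<open>The factor \<open>pi\<close> in the exponent makes the integral over the line exactly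
  one, so products of this weight have mass one in every dimension and no normalising constants
  appear.\<close>

definition gw :: "real \<Rightarrow> ennreal" where
  "gw t = ennreal (exp (- pi * t\<^sup>2))"

lemma gw_measurable [measurable]: "gw \<in> borel_measurable borel"
  unfolding gw_def by measurable

lemma nn_integral_gw: "(\<integral>\<^sup>+t. gw t \<partial>lborel) = 1"
proof -
  \<comment> \<open>The deviation for which the normal density has this exponent and its prefactor
    becomes 1.\<close>
  let ?s = "1 / sqrt (2 * pi)"
  have "normal_density 0 ?s t = exp (- pi * t\<^sup>2)" for t
    by (simp add: normal_density_def power_divide)
  moreover have "(\<integral>\<^sup>+t. ennreal (normal_density 0 ?s t) \<partial>lborel) = 1"
    using prob_space.emeasure_space_1[OF prob_space_normal_density[of ?s 0]]
    by (simp add: emeasure_density)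
  ultimately show ?thesis by (simp add: gw_def)
qed

text \<open>The Gaussian factor integrates to one over the orthogonal complement. The right-hand side
  does not involve the basis, and depends measurably on the subspace.\<close>

lemma nn_integral_ons:
  fixes b :: "nat \<Rightarrow> 'a::euclidean_space"
  assumes b: "ons b d" and V: "span (b ` {..<d}) = V" and g[measurable]: "g \<in> borel_measurable borel"
  shows "(\<integral>\<^sup>+c. g (\<Sum>i<d. c i *\<^sub>R b i) \<partial>PiM {..<d} (\<lambda>_. lborel))
    = (\<integral>\<^sup>+x. g (proj V x) * gw (norm (x - proj V x)) \<partial>lborel)"
proof -
  interpret product_sigma_finite "\<lambda>_::nat. lborel :: real measure" by standard
  let ?n = "DIM('a)"
  obtain c where c: "\<forall>i<d. c i = b i" "ons c ?n"
    using ons_extend[OF b subspace_UNIV] by auto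
  have dn: "d \<le> ?n" using ons_dim[OF b] dim_subset_UNIV[of "span (b ` {..<d})"] by simp
  have V': "V = span (c ` {..<d})" unfolding V[symmetric] using c by (intro arg_cong[of _ _ span] image_cong) auto
  have cd: "ons c d" using c dn ons_mono by blast
  have sV: "subspace V" using V by auto
  have U: "{..<?n} = {..<d} \<union> {d..<?n}" using dn by auto
  have pm[measurable]: "(\<lambda>x. proj V x) \<in> borel_measurable borel"
    by (rule measurable_proj_joint) (use sV in auto)
  have p: "proj V (\<Sum>i<?n. y i *\<^sub>R c i) = (\<Sum>i<d. y i *\<^sub>R b i)" for y
    unfolding V' ons_proj[OF cd] using dn c(1) ons_inner_sum[OF c(2), of _ y] by (intro sum.cong) (simp, metis lessThan_iff order_less_le_trans)
  have sp: "(\<Sum>i<?n. y i *\<^sub>R c i) = (\<Sum>i<d. y i *\<^sub>R c i) + (\<Sum>i=d..<?n. y i *\<^sub>R c i)" for y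
    unfolding U by (rule sum.union_disjoint) auto
  have q: "(norm ((\<Sum>i<?n. y i *\<^sub>R c i) - proj V (\<Sum>i<?n. y i *\<^sub>R c i)))\<^sup>2 = (\<Sum>i=d..<?n. (y i)\<^sup>2)" for y
  proof -
    have "(\<Sum>i<?n. y i *\<^sub>R c i) - proj V (\<Sum>i<?n. y i *\<^sub>R c i) = (\<Sum>i=d..<?n. y i *\<^sub>R c i)"
      unfolding p unfolding sp using c(1) by simp
    also have "\<dots> = (\<Sum>i<?n. (if d \<le> i then y i else 0) *\<^sub>R c i)"
      by (rule sum.mono_neutral_cong_left) auto
    finally have "(norm ((\<Sum>i<?n. y i *\<^sub>R c i) - proj V (\<Sum>i<?n. y i *\<^sub>R c i)))\<^sup>2
      = (\<Sum>i<?n. (if d \<le> i then y i else 0)\<^sup>2)" by (simp only: ons_norm_sum[OF c(2)])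
    also have "\<dots> = (\<Sum>i=d..<?n. (y i)\<^sup>2)" by (rule sum.mono_neutral_cong_right) auto
    finally show ?thesis .
  qed
  let ?g = "\<lambda>x. g (proj V x) * gw (norm (x - proj V x))"
  have "(\<integral>\<^sup>+x. ?g x \<partial>lborel) = (\<integral>\<^sup>+y. ?g (\<Sum>i<?n. y i *\<^sub>R c i) \<partial>PiM {..<?n} (\<lambda>_. lborel))"
    by (subst lborel_ons[OF c(2), symmetric], subst nn_integral_distr) auto
  also have "\<dots> = (\<integral>\<^sup>+y. g (\<Sum>i<d. y i *\<^sub>R b i) * (\<Prod>i=d..<?n. gw (y i)) \<partial>PiM {..<?n} (\<lambda>_. lborel))"
    by (simp only: gw_def q, simp add: p sum_distrib_left sum_negf[symmetric] exp_sum prod_ennreal)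
  also have "\<dots> = (\<integral>\<^sup>+y. \<integral>\<^sup>+z. g (\<Sum>i<d. y i *\<^sub>R b i) * (\<Prod>i=d..<?n. gw (z i)) \<partial>PiM {d..<?n} (\<lambda>_. lborel) \<partial>PiM {..<d} (\<lambda>_. lborel))"
    unfolding U
    by (subst product_nn_integral_fold) (auto simp: merge_def intro!: nn_integral_cong)
  also have "\<dots> = (\<integral>\<^sup>+y. g (\<Sum>i<d. y i *\<^sub>R b i) \<partial>PiM {..<d} (\<lambda>_. lborel))"
  proof -
    have "(\<integral>\<^sup>+z. (\<Prod>i=d..<?n. gw (z i)) \<partial>PiM {d..<?n} (\<lambda>_. lborel)) = 1"
      by (subst product_nn_integral_prod) (auto simp: nn_integral_gw)
    then show ?thesis by (subst nn_integral_cmult) auto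
  qed
  finally show ?thesis by simp
qed

lemma onb_spec:
  fixes V :: "(real^'n) set"
  assumes "subspace V"
  shows "ons (onb V) (dim V) \<and> span (onb V ` {..<dim V}) = V"
proof -
  have "\<exists>b. ons b (dim V) \<and> span (b ` {..<dim V}) = V" using ons_exists[OF assms] by metis
  then show ?thesis unfolding onb_def ons_def by (rule someI_ex)
qed

lemma nn_integral_lebesgue_sub:
  fixes V :: "(real^'n) set"
  assumes V: "subspace V" and g[measurable]: "g \<in> borel_measurable borel"
  shows "(\<integral>\<^sup>+x. g x \<partial>lebesgue_sub V) = (\<integral>\<^sup>+x. g (proj V x) * gw (norm (x - proj V x)) \<partial>lborel)"
proof -
  have "(\<integral>\<^sup>+x. g x \<partial>lebesgue_sub V) = (\<integral>\<^sup>+c. g (\<Sum>i<dim V. c i *\<^sub>R onb V i) \<partial>PiM {..<dim V} (\<lambda>_. lborel))"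
    unfolding lebesgue_sub_def by (subst nn_integral_distr) auto
  then show ?thesis using nn_integral_ons[of "onb V" "dim V" V g] onb_spec[OF V] by simp
qed

text \<open>Both sides equal the same basis-free integral, so the basis hidden in
  \<open>lebesgue_sub\<close> can be exchanged for any adapted one.\<close>

lemma nn_integral_lebesgue_sub_ons:
  fixes V :: "(real^'n) set"
  assumes b: "ons b d" "span (b ` {..<d}) = V" and g: "g \<in> borel_measurable borel"
  shows "(\<integral>\<^sup>+x. g x \<partial>lebesgue_sub V) = (\<integral>\<^sup>+c. g (\<Sum>i<d. c i *\<^sub>R b i) \<partial>PiM {..<d} (\<lambda>_. lborel))"
  using nn_integral_lebesgue_sub[OF _ g, of V] nn_integral_ons[OF b g] b by auto

lemma proj_orthogonal_comp:
  assumes "subspace L"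
  shows "proj (orthogonal_comp L) x = x - proj L x"
  by (rule proj_eqI[OF subspace_orthogonal_comp])
    (use assms proj_orth[OF assms] proj_in[OF assms] in
      \<open>auto simp: orthogonal_comp_def orthogonal_def inner_commute\<close>)

lemma dim_orthogonal_comp:
  fixes L :: "'a::euclidean_space set"
  assumes "subspace L"
  shows "dim (orthogonal_comp L) = DIM('a) - dim L"
  using dim_subspace_orthogonal_to_vectors[OF assms subspace_UNIV]
  by (simp add: orthogonal_comp_def)

subsection \<open>The invariant measure on flats\<close>

lemma translate_proj:
  assumes "subspace L"
  shows "(\<lambda>y. y + (x - proj L x)) ` L = (\<lambda>y. y + x) ` L"
  by (rule translate_eq[OF assms]) (simp add: subspace_neg proj_in assms)

text \<open>Joint measurability in subspace and translation, as Fubini requires. The Gaussian factor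
  belongs to \<open>L\<close>, the complement of the space \<open>orthogonal_comp L\<close> of
  translations.\<close>

lemma measurable_flat_kernel:
  assumes g: "g \<in> borel_measurable (set_sigma (AffGrass k))"
  shows "(\<lambda>(L, x). g ((\<lambda>y. y + x) ` L) * gw (norm (proj L x))) \<in> borel_measurable (set_sigma (Grass k) \<Otimes>\<^sub>M lborel)"
proof -
  have [measurable]: "(\<lambda>p. (\<lambda>y. y + snd p) ` fst p) \<in> measurable (set_sigma (Grass k) \<Otimes>\<^sub>M lborel) (set_sigma (AffGrass k))"
    by (rule measurable_translate) measurable
  have [measurable]: "(\<lambda>p. proj (fst p) (snd p)) \<in> borel_measurable (set_sigma (Grass k) \<Otimes>\<^sub>M lborel)"
    by (rule measurable_proj_joint)
      (auto simp: space_pair_measure GrassD(1) intro!: measurable_infdist_comp[OF measurable_fst])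
  note g[measurable]
  show ?thesis by (simp add: case_prod_beta')
qed

text \<open>A genuine measure, being an image of a product measure with density, whereas the set
  function in \<open>mu\<close> gives its values only once it is known to be a measure. The density
  integrates out the component of \<open>x\<close> along \<open>L\<close>, which does not affect the
  translated flat.\<close>

definition flat_measure :: "nat \<Rightarrow> (real^'n) set measure" where
  "flat_measure k = distr (density (nu k \<Otimes>\<^sub>M lborel) (\<lambda>(L, x). gw (norm (proj L x))))
     (set_sigma (AffGrass k)) (\<lambda>(L, x). (\<lambda>y. y + x) ` L)"

lemma nn_integral_flat_measure:
  assumes n: "CARD('n) \<ge> 2" "k < CARD('n)"
    and g: "g \<in> borel_measurable (set_sigma (AffGrass k :: (real^'n) set set))"
  shows "(\<integral>\<^sup>+E. g E \<partial>flat_measure k) = (\<integral>\<^sup>+L. \<integral>\<^sup>+x. g ((\<lambda>y. y + x) ` L) * gw (norm (proj L x)) \<partial>lborel \<partial>nu k)"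
proof -
  interpret prob_space "nu k :: (real^'n) set measure" by (rule nu_spec[OF n])
  interpret pair_sigma_finite "nu k :: (real^'n) set measure" "lborel :: (real^'n) measure" ..
  note nu_spec(1)[OF n, measurable_cong]
  have s: "sets ((nu k :: (real^'n) set measure) \<Otimes>\<^sub>M (lborel :: (real^'n) measure)) = sets (set_sigma (Grass k) \<Otimes>\<^sub>M (lborel :: (real^'n) measure))"
    by (rule sets_pair_measure_cong[OF nu_spec(1)[OF n] refl])
  have mk: "(\<lambda>(L, x). g ((\<lambda>y. y + x) ` L) * gw (norm (proj L x))) \<in> borel_measurable (nu k \<Otimes>\<^sub>M lborel)"
    if "g \<in> borel_measurable (set_sigma (AffGrass k))" for g :: "(real^'n) set \<Rightarrow> ennreal"
    using measurable_flat_kernel[OF that] by (simp only: measurable_cong_sets[OF s refl])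
  have [measurable]: "(\<lambda>(L, x). gw (norm (proj L x))) \<in> borel_measurable (nu k \<Otimes>\<^sub>M (lborel :: (real^'n) measure))"
    using mk[of "\<lambda>_. 1"] by simp
  have T[measurable]: "(\<lambda>(L, x). (\<lambda>y. y + x) ` L) \<in> measurable (nu k \<Otimes>\<^sub>M lborel) (set_sigma (AffGrass k :: (real^'n) set set))"
    unfolding case_prod_beta'
    by (rule measurable_translate) (auto simp: measurable_cong_sets[OF s refl])
  have "(\<integral>\<^sup>+E. g E \<partial>flat_measure k) = (\<integral>\<^sup>+p. g ((\<lambda>(L, x). (\<lambda>y. y + x) ` L) p) \<partial>density (nu k \<Otimes>\<^sub>M lborel) (\<lambda>(L, x). gw (norm (proj L x))))"
    unfolding flat_measure_def by (rule nn_integral_distr) (use g in auto)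
  also have "\<dots> = (\<integral>\<^sup>+p. (\<lambda>(L, x). gw (norm (proj L x))) p * g ((\<lambda>(L, x). (\<lambda>y. y + x) ` L) p) \<partial>(nu k \<Otimes>\<^sub>M lborel))"
    by (rule nn_integral_density) (use measurable_compose[OF T g] in auto)
  also have "\<dots> = (\<integral>\<^sup>+p. (\<lambda>(L, x). g ((\<lambda>y. y + x) ` L) * gw (norm (proj L x))) p \<partial>(nu k \<Otimes>\<^sub>M lborel))"
    by (simp add: case_prod_beta' mult.commute)
  also have "\<dots> = (\<integral>\<^sup>+L. \<integral>\<^sup>+x. g ((\<lambda>y. y + x) ` L) * gw (norm (proj L x)) \<partial>lborel \<partial>nu k)"
    by (subst lborel.nn_integral_fst[OF mk[OF g], symmetric]) simp
  finally show ?thesis .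
qed

text \<open>On measurable sets the set function in \<open>mu\<close> agrees with
  \<open>flat_measure k\<close>, because Lebesgue measure on \<open>orthogonal_comp L\<close> can be
  written with the Gaussian weight on \<open>L\<close>. Hence \<open>measure_of\<close> returns that
  measure instead of a default.\<close>

lemma mu_eq:
  assumes n: "CARD('n) \<ge> 2" "k < CARD('n)"
  shows "mu k = (flat_measure k :: (real^'n) set measure)"
proof -
  let ?A = "set_sigma (AffGrass k) :: (real^'n) set measure"
  let ?K = "flat_measure k :: (real^'n) set measure"
  have sK: "sets ?K = sets ?A" "space ?K = AffGrass k" by (simp_all add: flat_measure_def)
  have spnu: "space (nu k) = (Grass k :: (real^'n) set set)"
    using sets_eq_imp_space_eq[OF nu_spec(1)[OF n]] by simp
  have "mu k = measure_of (AffGrass k) (sets ?A) (emeasure ?K)"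
    unfolding mu_def
  proof (rule measure_of_eq)
    show "sets ?A \<subseteq> Pow (AffGrass k)" using sets.space_closed[of ?A] by simp
    fix A assume "A \<in> sigma_sets (AffGrass k) (sets ?A)"
    then have A[measurable]: "A \<in> sets ?A" using sets.sigma_sets_eq[of ?A] by simp
    have "(\<integral>\<^sup>+L. \<integral>\<^sup>+x. indicator A ((\<lambda>y. y + x) ` L) \<partial>lebesgue_sub (orthogonal_comp L) \<partial>nu k)
      = (\<integral>\<^sup>+L. \<integral>\<^sup>+x. indicator A ((\<lambda>y. y + x) ` L) * gw (norm (proj L x)) \<partial>lborel \<partial>nu k)"
    proof (rule nn_integral_cong)
      fix L :: "(real^'n) set" assume "L \<in> space (nu k)"
      then have L: "L \<in> Grass k" and sL: "subspace L" using spnu by (auto simp: GrassD)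
      have "(\<lambda>x. (\<lambda>y. y + x) ` L) \<in> measurable borel ?A"
        by (rule measurable_translate) (use L in auto)
      then have "(\<lambda>x. indicator A ((\<lambda>y. y + x) ` L) :: ennreal) \<in> borel_measurable borel"
        by (rule measurable_compose) simp
      from nn_integral_lebesgue_sub[OF subspace_orthogonal_comp this, of L]
      show "(\<integral>\<^sup>+x. indicator A ((\<lambda>y. y + x) ` L) \<partial>lebesgue_sub (orthogonal_comp L))
        = (\<integral>\<^sup>+x. indicator A ((\<lambda>y. y + x) ` L) * gw (norm (proj L x)) \<partial>lborel)"
        by (simp add: proj_orthogonal_comp[OF sL] translate_proj[OF sL])
    qed
    also have "\<dots> = (\<integral>\<^sup>+E. indicator A E \<partial>?K)" by (rule nn_integral_flat_measure[OF n, symmetric]) simp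
    also have "\<dots> = emeasure ?K A" using sK by simp
    finally show "(\<integral>\<^sup>+L. \<integral>\<^sup>+x. indicator A ((\<lambda>y. y + x) ` L) \<partial>lebesgue_sub (orthogonal_comp L) \<partial>nu k) = emeasure ?K A" .
  qed
  also have "\<dots> = ?K" using measure_of_of_measure[of ?K] unfolding sK .
  finally show ?thesis .
qed

lemma sets_mu:
  assumes n: "CARD('n) \<ge> 2" "k < CARD('n)"
  shows "sets (mu k) = sets (set_sigma (AffGrass k :: (real^'n) set set))"
  by (simp add: mu_eq[OF n] flat_measure_def)

lemma space_mu:
  assumes n: "CARD('n) \<ge> 2" "k < CARD('n)"
  shows "space (mu k) = (AffGrass k :: (real^'n) set set)"
  using sets_eq_imp_space_eq[OF sets_mu[OF n]] by simp

lemma space_nu: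
  assumes n: "CARD('n) \<ge> 2" "k < CARD('n)"
  shows "space (nu k) = (Grass k :: (real^'n) set set)"
  using sets_eq_imp_space_eq[OF nu_spec(1)[OF n]] by simp

lemma nn_integral_mu:
  assumes n: "CARD('n) \<ge> 2" "k < CARD('n)"
    and g: "g \<in> borel_measurable (set_sigma (AffGrass k :: (real^'n) set set))"
  shows "(\<integral>\<^sup>+E. g E \<partial>mu k) = (\<integral>\<^sup>+L. \<integral>\<^sup>+x. g ((\<lambda>y. y + x) ` L) * gw (norm (proj L x)) \<partial>lborel \<partial>nu k)"
  unfolding mu_eq[OF n] by (rule nn_integral_flat_measure[OF n g])

text \<open>The substitution of \<open>M *v x\<close> for \<open>x\<close> preserves
  \<open>lborel\<close> and carries projections onto \<open>L\<close> to projections onto the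
  rotated subspace; the remaining change of \<open>L\<close> is absorbed by
  \<open>nu_invariant\<close>.\<close>

lemma mu_invariant:
  fixes g :: "(real^'n) set \<Rightarrow> ennreal"
  assumes n: "CARD('n) \<ge> 2" "k < CARD('n)"
    and M: "M \<in> SO" and g: "g \<in> borel_measurable (set_sigma (AffGrass k))"
  shows "(\<integral>\<^sup>+E. g ((*v) M ` E) \<partial>mu k) = (\<integral>\<^sup>+E. g E \<partial>mu k)"
proof -
  let ?A = "set_sigma (AffGrass k) :: (real^'n) set measure"
  let ?G = "\<lambda>L. \<integral>\<^sup>+x. g ((\<lambda>y. y + x) ` L) * gw (norm (proj L x)) \<partial>lborel"
  have ot: "orthogonal_transformation ((*v) M)" using M SO_orthogonal by blast
  have lin: "linear ((*v) M)" using ot orthogonal_transformation_linear by blast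
  have "(\<lambda>E. (*v) M ` E) \<in> measurable ?A ?A"
    by (rule measurable_action_AffGrass) (use M in auto)
  then have gM: "(\<lambda>E. g ((*v) M ` E)) \<in> borel_measurable ?A" using g by (rule measurable_compose)
  have Gm: "?G \<in> borel_measurable (set_sigma (Grass k))"
    using lborel.borel_measurable_nn_integral_fst[OF measurable_flat_kernel[OF g]] by simp
  have "(\<integral>\<^sup>+E. g ((*v) M ` E) \<partial>mu k) = (\<integral>\<^sup>+L. ?G ((*v) M ` L) \<partial>nu k)"
    unfolding nn_integral_mu[OF n gM]
  proof (rule nn_integral_cong)
    fix L :: "(real^'n) set" assume "L \<in> space (nu k)"
    then have L: "L \<in> Grass k" and sL: "subspace L" by (auto simp: GrassD space_nu[OF n])
    have mL: "(*v) M ` L \<in> Grass k" and sML: "subspace ((*v) M ` L)" using SO_image_Grass[OF M L] GrassD(1) by auto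
    have im: "(*v) M ` (\<lambda>y. y + x) ` L = (\<lambda>y. y + M *v x) ` (*v) M ` L" for x
      by (simp add: image_image matrix_vector_right_distrib)
    have "proj ((*v) M ` L) (M *v x) = M *v proj L x" for x
    proof (rule proj_eqI[OF sML])
      show "M *v proj L x \<in> (*v) M ` L" using proj_in[OF sL] by blast
      fix w assume "w \<in> (*v) M ` L"
      then obtain v where v: "w = M *v v" "v \<in> L" by blast
      have "(M *v x - M *v proj L x) \<bullet> w = (M *v (x - proj L x)) \<bullet> (M *v v)"
        by (simp add: v matrix_vector_mult_diff_distrib)
      also have "\<dots> = 0" using ot proj_orth[OF sL v(2)] by (simp add: orthogonal_transformation_def)
      finally show "(M *v x - M *v proj L x) \<bullet> w = 0" .
    qed
    then have np: "norm (proj L x) = norm (proj ((*v) M ` L) (M *v x))" for x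
      using ot by (simp add: orthogonal_transformation)
    have "(\<lambda>x. (\<lambda>y. y + x) ` (*v) M ` L) \<in> measurable borel ?A"
      by (rule measurable_translate) (use mL in auto)
    from measurable_compose[OF this g] have [measurable]: "(\<lambda>x. g ((\<lambda>y. y + x) ` (*v) M ` L)) \<in> borel_measurable borel" .
    have [measurable]: "(\<lambda>x. proj ((*v) M ` L) x) \<in> borel_measurable borel"
      by (rule measurable_proj_joint) (use sML in auto)
    show "(\<integral>\<^sup>+x. g ((*v) M ` (\<lambda>y. y + x) ` L) * gw (norm (proj L x)) \<partial>lborel) = ?G ((*v) M ` L)"
      unfolding im np
      by (rule nn_integral_lborel_orthogonal[OF ot, of "\<lambda>x. g ((\<lambda>y. y + x) ` (*v) M ` L) * gw (norm (proj ((*v) M ` L) x))"])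
        measurable
  qed
  also have "\<dots> = (\<integral>\<^sup>+L. ?G L \<partial>nu k)" by (rule nu_invariant[OF n M Gm])
  also have "\<dots> = (\<integral>\<^sup>+E. g E \<partial>mu k)" by (rule nn_integral_mu[OF n g, symmetric])
  finally show ?thesis .
qed

subsection \<open>Polar coordinates\<close>

lemma measure_eqI_atMost:
  fixes M N :: "real measure"
  assumes "sets M = sets borel" "sets N = sets borel"
    and "\<And>r. emeasure M {..r} = emeasure N {..r}" "\<And>r. emeasure M {..r} \<noteq> \<infinity>"
  shows "M = N"
proof (rule measure_eqI_generator_eq)
  have b: "sets borel = sigma_sets UNIV (range (\<lambda>a. {..a::real}))"
    by (subst borel_eq_atMost) simp
  show "sets M = sigma_sets UNIV (range (\<lambda>a. {..a}))" "sets N = sigma_sets UNIV (range (\<lambda>a. {..a}))"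
    using assms b by auto
  show "Int_stable (range (\<lambda>a::real. {..a}))" by (auto simp: Int_stable_def)
  show "range (\<lambda>n. {..real n}) \<subseteq> range (\<lambda>a. {..a})" by auto
  show "(\<Union>n. {..real n}) = UNIV" using real_arch_simple by auto
qed (use assms in auto)

lemma omega_pos: "0 < d \<Longrightarrow> 0 < omega d"
  by (simp add: omega_def Gamma_real_pos)

lemma omega_unit_ball_vol:
  assumes "0 < d"
  shows "omega d = real d * unit_ball_vol (real d)"
proof -
  have pos: "real d / 2 > 0" using assms by simp
  have "real d / 2 \<notin> \<int>\<^sub>\<le>\<^sub>0" using pos by (auto simp: nonpos_Ints_def)
  then have g: "Gamma (real d / 2 + 1) = real d / 2 * Gamma (real d / 2)" by (rule Gamma_plus1)
  show ?thesis unfolding omega_def unit_ball_vol_def g using assms Gamma_real_pos[OF pos] by simp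
qed

text \<open>The density of the norm under \<open>d\<close>-dimensional Lebesgue measure. It vanishes
  for \<open>r \<le> 0\<close>, so integrals against it live on the open half-line, where
  substitutions by scaling apply.\<close>

definition rad :: "nat \<Rightarrow> real \<Rightarrow> ennreal" where
  "rad d r = ennreal (omega d * r ^ (d - 1)) * indicator {0<..} r"

lemma rad_measurable [measurable]: "rad d \<in> borel_measurable borel"
  unfolding rad_def by measurable

lemma emeasure_rad:
  assumes d: "0 < d" and r: "0 \<le> r"
  shows "(\<integral>\<^sup>+t. rad d t * indicator {..r} t \<partial>lborel) = ennreal (unit_ball_vol (real d) * r ^ d)"
proof -
  have "(\<integral>\<^sup>+t. rad d t * indicator {..r} t \<partial>lborel) = (\<integral>\<^sup>+t. ennreal (omega d * t ^ (d - 1)) * indicator {0..r} t \<partial>lborel)"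
    by (rule nn_integral_cong_AE, rule AE_mp[OF AE_lborel_singleton[of 0]])
      (auto simp: rad_def indicator_def)
  also have "\<dots> = ennreal (unit_ball_vol (real d) * r ^ d - unit_ball_vol (real d) * 0 ^ d)"
  proof (rule nn_integral_FTC_Icc)
    fix x :: real assume "x \<in> {0..r}"
    then have x: "0 \<le> x" by simp
    show "((\<lambda>x. unit_ball_vol (real d) * x ^ d) has_real_derivative omega d * x ^ (d - 1)) (at x)"
      using d by (auto intro!: derivative_eq_intros simp: omega_unit_ball_vol)
    show "0 \<le> omega d * x ^ (d - 1)" using omega_pos[OF d] x by simp
  qed (use r in auto)
  finally show ?thesis using d by (simp add: zero_power)
qed

text \<open>The law of the norm is compared with \<open>density lborel (rad d)\<close> on the
  half-lines \<open>{..r}\<close>, where both give the volume of a ball. The index set is arbitrary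
  because coordinates are later split into blocks.\<close>

lemma nn_integral_radial:
  assumes A: "finite A" "card A = d" "0 < d" and [measurable]: "\<phi> \<in> borel_measurable borel"
  shows "(\<integral>\<^sup>+c. \<phi> (sqrt (\<Sum>i\<in>A. (c i)\<^sup>2)) \<partial>PiM A (\<lambda>_. lborel)) = (\<integral>\<^sup>+r. \<phi> r * rad d r \<partial>lborel)"
proof -
  interpret product_sigma_finite "\<lambda>_. lborel :: real measure" by standard
  let ?P = "PiM A (\<lambda>_. lborel :: real measure)"
  let ?N = "\<lambda>c. sqrt (\<Sum>i\<in>A. (c i)\<^sup>2)"
  have [measurable]: "?N \<in> borel_measurable ?P" by measurable
  have "distr ?P borel ?N = density lborel (rad d)"
  proof (rule measure_eqI_atMost)
    fix r :: real
    have e1: "emeasure (distr ?P borel ?N) {..r} = emeasure ?P ({f. ?N f \<le> r} \<inter> space ?P)"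
      by (subst emeasure_distr) (auto intro!: arg_cong[of _ _ "emeasure ?P"])
    have e2: "emeasure (density lborel (rad d)) {..r} = (\<integral>\<^sup>+t. rad d t * indicator {..r} t \<partial>lborel)"
      by (simp add: emeasure_density)
    \<comment> \<open>The known volume formula concerns positive radii. At radius 0 only the origin
      remains, which is null since \<open>d\<close> is positive; for negative radii both sides are
      0.\<close>
    consider "r > 0" | "r = 0" | "r < 0" by linarith
    then have "emeasure (distr ?P borel ?N) {..r} = emeasure (density lborel (rad d)) {..r}
      \<and> emeasure (distr ?P borel ?N) {..r} \<noteq> \<infinity>"
    proof cases
      case 1
      then show ?thesis
        using emeasure_cball_aux[OF A(1) 1] emeasure_rad[OF A(3), of r] by (simp add: e1 e2 A)
    next
      case 2
      have "emeasure ?P ({f. ?N f \<le> r} \<inter> space ?P) \<le> emeasure ?P (\<Pi>\<^sub>E i\<in>A. {0})"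
      proof (rule emeasure_mono)
        show "{f. ?N f \<le> r} \<inter> space ?P \<subseteq> (\<Pi>\<^sub>E i\<in>A. {0})"
          using A(1) 2 by (auto simp: space_PiM PiE_def Pi_def sum_nonneg_eq_0_iff sum_nonneg antisym_conv extensional_def)
        show "(\<Pi>\<^sub>E i\<in>A. {0::real}) \<in> sets ?P" using A(1) by (intro sets_PiM_I_finite) auto
      qed
      also have "\<dots> = 0" using A by (subst emeasure_PiM) auto
      finally have z: "emeasure ?P ({f. ?N f \<le> r} \<inter> space ?P) = 0" by simp
      show ?thesis unfolding e1 e2 z using 2 emeasure_rad[OF A(3), of r] A(3) by (simp add: zero_power)
    next
      case 3
      have "{f. ?N f \<le> r} \<inter> space ?P = {}"
      proof -
        have "0 \<le> ?N x" for x by (simp add: sum_nonneg)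
        with 3 have "\<not> ?N x \<le> r" for x by (meson le_less_trans not_le)
        then show ?thesis by blast
      qed
      moreover have "(\<lambda>t. rad d t * indicator {..r} t) = (\<lambda>_. 0)" using 3 by (auto simp: rad_def indicator_def)
      ultimately show ?thesis by (simp add: e1 e2)
    qed
    then show "emeasure (distr ?P borel ?N) {..r} = emeasure (density lborel (rad d)) {..r}"
      "emeasure (distr ?P borel ?N) {..r} \<noteq> \<infinity>" by blast+
  qed simp_all
  then have "(\<integral>\<^sup>+r. \<phi> r \<partial>distr ?P borel ?N) = (\<integral>\<^sup>+r. \<phi> r \<partial>density lborel (rad d))" by simp
  then show ?thesis
    by (subst (asm) nn_integral_distr, simp, simp, subst (asm) nn_integral_density) (simp_all add: mult.commute)
qed

lemma nn_integral_lebesgue_sub_radial: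
  fixes V :: "(real^'n) set"
  assumes V: "subspace V" "dim V = d" "0 < d" and \<phi>: "\<phi> \<in> borel_measurable borel"
  shows "(\<integral>\<^sup>+x. \<phi> (norm x) \<partial>lebesgue_sub V) = (\<integral>\<^sup>+r. \<phi> r * rad d r \<partial>lborel)"
proof -
  note \<phi>[measurable]
  obtain b where b: "ons b d" "span (b ` {..<d}) = V" using ons_exists[OF V(1)] V(2) by metis
  have nrm: "norm (\<Sum>i<d. c i *\<^sub>R b i) = sqrt (\<Sum>i<d. (c i)\<^sup>2)" for c
    using ons_norm_sum[OF b(1), of c] by (simp add: real_sqrt_unique)
  have "(\<integral>\<^sup>+x. \<phi> (norm x) \<partial>lebesgue_sub V) = (\<integral>\<^sup>+c. \<phi> (norm (\<Sum>i<d. c i *\<^sub>R b i)) \<partial>PiM {..<d} (\<lambda>_. lborel))"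
    by (rule nn_integral_lebesgue_sub_ons[OF b]) measurable
  also have "\<dots> = (\<integral>\<^sup>+r. \<phi> r * rad d r \<partial>lborel)"
    unfolding nrm by (rule nn_integral_radial) (use V in auto)
  finally show ?thesis .
qed

text \<open>The distance of a translate of \<open>L\<close> by \<open>x\<close> from the origin is
  the length of the component of \<open>x\<close> in \<open>orthogonal_comp L\<close>, a space of
  dimension \<open>CARD('n) - k\<close>. The inner integral is therefore independent of
  \<open>L\<close>, and \<open>nu k\<close> has mass one.\<close>

lemma nn_integral_mu_radial:
  assumes n: "CARD('n) \<ge> 2" "k < CARD('n)" and \<phi>[measurable]: "\<phi> \<in> borel_measurable borel"
  shows "(\<integral>\<^sup>+E. \<phi> (infdist (0::real^'n) E) \<partial>mu k) = (\<integral>\<^sup>+r. \<phi> r * rad (CARD('n) - k) r \<partial>lborel)"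
proof -
  interpret prob_space "nu k :: (real^'n) set measure" by (rule nu_spec[OF n])
  have m: "(\<lambda>E. \<phi> (infdist (0::real^'n) E)) \<in> borel_measurable (set_sigma (AffGrass k))"
    using measurable_infdist_set_sigma \<phi> by (rule measurable_compose)
  have "(\<integral>\<^sup>+E. \<phi> (infdist (0::real^'n) E) \<partial>mu k)
    = (\<integral>\<^sup>+L. \<integral>\<^sup>+x. \<phi> (infdist (0::real^'n) ((\<lambda>y. y + x) ` L)) * gw (norm (proj L x)) \<partial>lborel \<partial>nu k)"
    by (rule nn_integral_mu[OF n m])
  also have "\<dots> = (\<integral>\<^sup>+L. \<integral>\<^sup>+r. \<phi> r * rad (CARD('n) - k) r \<partial>lborel \<partial>(nu k :: (real^'n) set measure))"
  proof (rule nn_integral_cong)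
    fix L :: "(real^'n) set" assume "L \<in> space (nu k)"
    then have L: "subspace L" "dim L = k" by (auto simp: GrassD space_nu[OF n])
    have i: "infdist 0 ((\<lambda>y. y + x) ` L) = norm (proj (orthogonal_comp L) x)" for x
      using infdist_0_translate[OF L(1) proj_in[OF subspace_orthogonal_comp], of x]
      by (simp add: proj_orthogonal_comp[OF L(1)] translate_proj[OF L(1)])
    have "(\<integral>\<^sup>+x. \<phi> (infdist 0 ((\<lambda>y. y + x) ` L)) * gw (norm (proj L x)) \<partial>lborel)
      = (\<integral>\<^sup>+x. \<phi> (norm x) \<partial>lebesgue_sub (orthogonal_comp L))"
      by (subst nn_integral_lebesgue_sub[OF subspace_orthogonal_comp])
        (simp_all add: i, simp add: proj_orthogonal_comp[OF L(1)])
    also have "\<dots> = (\<integral>\<^sup>+r. \<phi> r * rad (CARD('n) - k) r \<partial>lborel)"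
      by (rule nn_integral_lebesgue_sub_radial)
        (use n L \<phi> in \<open>auto simp: subspace_orthogonal_comp dim_orthogonal_comp\<close>)
    finally show "(\<integral>\<^sup>+x. \<phi> (infdist 0 ((\<lambda>y. y + x) ` L)) * gw (norm (proj L x)) \<partial>lborel)
      = (\<integral>\<^sup>+r. \<phi> r * rad (CARD('n) - k) r \<partial>lborel)" .
  qed
  also have "\<dots> = (\<integral>\<^sup>+r. \<phi> r * rad (CARD('n) - k) r \<partial>lborel)"
    by (simp only: nn_integral_const emeasure_space_1 mult_1_right)
  finally show ?thesis .
qed

text \<open>Flats within a bounded distance of the origin have finite measure; Fubini's theorem with
  \<open>mu\<close> relies on this.\<close>

lemma sigma_finite_mu:
  assumes n: "CARD('n) \<ge> 2" "k < CARD('n)"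
  shows "sigma_finite_measure (mu k :: (real^'n) set measure)"
proof
  let ?A = "\<lambda>m::nat. {E\<in>space (mu k). infdist (0::real^'n) E \<in> {..real m}}"
  have meas: "(\<lambda>E. infdist (0::real^'n) E) \<in> borel_measurable (mu k)"
    by (simp add: measurable_cong_sets[OF sets_mu[OF n] refl] measurable_infdist_set_sigma)
  have sA: "?A m \<in> sets (mu k)" for m
    using measurable_sets[OF meas, of "{..real m}"] by (simp add: vimage_def Int_def conj_commute)
  have "emeasure (mu k) (?A m) \<noteq> \<infinity>" for m
  proof -
    have "emeasure (mu k) (?A m) = (\<integral>\<^sup>+E. indicator (?A m) E \<partial>mu k)" using sA by simp
    also have "\<dots> = (\<integral>\<^sup>+E. indicator {..real m} (infdist (0::real^'n) E) \<partial>mu k)"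
      by (rule nn_integral_cong) (auto simp: indicator_def)
    also have "\<dots> = (\<integral>\<^sup>+r. rad (CARD('n) - k) r * indicator {..real m} r \<partial>lborel)"
      by (subst nn_integral_mu_radial[OF n]) (simp_all add: mult.commute)
    also have "\<dots> \<noteq> \<infinity>" using n by (subst emeasure_rad) auto
    finally show ?thesis .
  qed
  then show "\<exists>A. countable A \<and> A \<subseteq> sets (mu k) \<and> \<Union> A = space (mu k :: (real^'n) set measure) \<and> (\<forall>a\<in>A. emeasure (mu k) a \<noteq> \<infinity>)"
    using sA real_arch_simple by (intro exI[of _ "range ?A"]) auto
qed

subsection \<open>The projection of a random vector onto a subspace\<close>

lemma nn_integral_scale:
  fixes c :: real
  assumes c: "c > 0" and f: "f \<in> borel_measurable borel"
  shows "(\<integral>\<^sup>+x. f x * indicator {0<..} x \<partial>lborel) = ennreal c * (\<integral>\<^sup>+x. f (c * x) * indicator {0<..} x \<partial>lborel)"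
proof -
  note f[measurable]
  have "(\<integral>\<^sup>+x. f x * indicator {0<..} x \<partial>lborel) = ennreal \<bar>c\<bar> * (\<integral>\<^sup>+x. f (0 + c * x) * indicator {0<..} (0 + c * x) \<partial>lborel)"
    by (rule nn_integral_real_affine) (use c in auto)
  then show ?thesis using c by (simp add: indicator_def zero_less_mult_iff)
qed

text \<open>The substitution passes from the tangent of an angle to its sine. It maps an interval
  with a singular right end onto a half-line; comparing measures on the sets \<open>{..r}\<close>
  reduces it to the fundamental theorem of calculus on compact intervals.\<close>

lemma tangent_substitution:
  fixes k :: "real \<Rightarrow> ennreal"
  assumes k[measurable]: "k \<in> borel_measurable borel"
  shows "(\<integral>\<^sup>+c. k c * indicator {0<..} c \<partial>lborel)
    = (\<integral>\<^sup>+z. k (z / sqrt (1 - z\<^sup>2)) * ennreal ((1 - z\<^sup>2) powr (- 3 / 2)) * indicator {0<..<1} z \<partial>lborel)"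
proof -
  let ?g = "\<lambda>z::real. z / sqrt (1 - z\<^sup>2)"
  let ?w = "\<lambda>z::real. ennreal ((1 - z\<^sup>2) powr (- 3 / 2)) * indicator {0<..<1} z"
  have pos: "1 - z\<^sup>2 > 0" if "0 \<le> z" "z < 1" for z :: real using that by (simp add: power_less_one_iff)
  have "density lborel (indicator {0<..}) = distr (density lborel ?w) borel ?g"
  proof (rule measure_eqI_atMost)
    fix r :: real
    have e1: "emeasure (density lborel (indicator {0<..})) {..r} = emeasure lborel ({0<..r} :: real set)"
      by (subst emeasure_density) (auto simp: indicator_inter_arith[symmetric] greaterThanAtMost_def)
    have e2: "emeasure (distr (density lborel ?w) borel ?g) {..r} = (\<integral>\<^sup>+z. ?w z * indicator {..r} (?g z) \<partial>lborel)"
      by (subst emeasure_distr, simp, simp, subst emeasure_density) (auto simp: indicator_def vimage_def intro!: nn_integral_cong)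
    show "emeasure (density lborel (indicator {0<..})) {..r} \<noteq> \<infinity>"
      by (cases "0 \<le> r") (simp_all add: e1)
    show "emeasure (density lborel (indicator {0<..})) {..r} = emeasure (distr (density lborel ?w) borel ?g) {..r}"
    proof (cases "r > 0")
      case False
      have "?w z * indicator {..r} (?g z) = 0" for z
      proof (cases "0 < z \<and> z < 1")
        case True
        then have "?g z > 0" using pos[of z] by simp
        then show ?thesis using False by (simp add: indicator_def)
      qed auto
      then show ?thesis using False by (simp only: e1 e2) simp
    next
      case True
      \<comment> \<open>The point that the substitution sends to \<open>r\<close>.\<close>
      let ?\<rho> = "r / sqrt (1 + r\<^sup>2)"
      have s: "sqrt (1 + r\<^sup>2) > 0" "sqrt (1 + r\<^sup>2) > r"
        using True by (auto simp: add_pos_nonneg intro!: real_less_rsqrt)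
      have \<rho>: "0 < ?\<rho>" "?\<rho> < 1" using s True by auto
      have sq: "1 - ?\<rho>\<^sup>2 = 1 / (1 + r\<^sup>2)"
      proof -
        have "1 + r\<^sup>2 > 0" by (simp add: add_pos_nonneg)
        then show ?thesis by (simp add: power_divide field_simps)
      qed
      have g\<rho>: "?g ?\<rho> = r"
        unfolding sq using s by (simp add: real_sqrt_divide)
      have mono: "?g x < ?g y" if "0 \<le> x" "x < y" "y < 1" for x y
      proof -
        have "x\<^sup>2 \<le> y\<^sup>2" using that by (intro power_mono) auto
        then have "sqrt (1 - y\<^sup>2) \<le> sqrt (1 - x\<^sup>2)" by simp
        then show ?thesis using that pos[of y] pos[of x] by (intro frac_less) auto
      qed
      have iff: "?g z \<le> r \<longleftrightarrow> z \<le> ?\<rho>" if "0 < z" "z < 1" for z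
        using mono[of z ?\<rho>] mono[of ?\<rho> z] that \<rho> g\<rho> by (cases z ?\<rho> rule: linorder_cases) auto
      have "(\<integral>\<^sup>+z. ?w z * indicator {..r} (?g z) \<partial>lborel) = (\<integral>\<^sup>+z. ennreal ((1 - z\<^sup>2) powr (- 3 / 2)) * indicator {0..?\<rho>} z \<partial>lborel)"
        by (rule nn_integral_cong_AE, rule AE_mp[OF AE_lborel_singleton[of 0]])
          (use iff \<rho> in \<open>auto simp: indicator_def intro!: AE_I2\<close>)
      also have "\<dots> = ennreal (?g ?\<rho> - ?g 0)"
      proof (rule nn_integral_FTC_Icc)
        fix z :: real assume "z \<in> {0..?\<rho>}"
        then have z: "0 \<le> z" "z \<le> ?\<rho>" by auto
        then have p: "1 - z\<^sup>2 > 0" using pos \<rho> by auto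
        have q: "(1 - z\<^sup>2) powr (- 3 / 2) = 1 / (sqrt (1 - z\<^sup>2) * (1 - z\<^sup>2))"
        proof -
          have "(1 - z\<^sup>2) powr (- 3 / 2) = (1 - z\<^sup>2) powr (- (1/2) + (- 1))" by simp
          also have "\<dots> = (1 - z\<^sup>2) powr (- (1/2)) * (1 - z\<^sup>2) powr (- 1)" by (rule powr_add)
          also have "\<dots> = 1 / (sqrt (1 - z\<^sup>2) * (1 - z\<^sup>2))"
            using p by (simp add: powr_minus powr_half_sqrt field_simps)
          finally show ?thesis .
        qed
        show "(?g has_real_derivative (1 - z\<^sup>2) powr (- 3 / 2)) (at z)"
          unfolding q using p
          by (auto intro!: derivative_eq_intros simp: divide_simps) (simp add: power2_eq_square algebra_simps)
      qed (use \<rho> in auto)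
      also have "\<dots> = ennreal r" unfolding g\<rho> by simp
      finally show ?thesis using True by (simp only: e1 e2) simp
    qed
  qed simp_all
  then have "(\<integral>\<^sup>+c. k c \<partial>density lborel (indicator {0<..})) = (\<integral>\<^sup>+c. k c \<partial>distr (density lborel ?w) borel ?g)" by simp
  then have "(\<integral>\<^sup>+c. indicator {0<..} c * k c \<partial>lborel) = (\<integral>\<^sup>+z. ?w z * k (?g z) \<partial>lborel)"
    by (subst (asm) nn_integral_density, simp, simp, subst (asm) nn_integral_distr, simp, simp,
        subst (asm) nn_integral_density) simp_all
  then show ?thesis by (simp add: ac_simps)
qed

text \<open>Unnormalised density of the length of the projection of a uniform unit vector in
  dimension \<open>p + m\<close> onto a \<open>p\<close>-dimensional subspace; the square of this
  length has the beta law with parameters \<open>p / 2\<close> and \<open>m / 2\<close>.\<close>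

definition beta_w :: "nat \<Rightarrow> nat \<Rightarrow> real \<Rightarrow> ennreal" where
  "beta_w p m z = ennreal (z ^ (p - 1) * (1 - z\<^sup>2) powr (real m / 2 - 1)) * indicator {0<..<1} z"

lemma beta_w_measurable [measurable]: "beta_w p m \<in> borel_measurable borel"
  unfolding beta_w_def by measurable

text \<open>Substitute \<open>a = b c\<close>, then \<open>b = t / sqrt (1 + c\<^sup>2)\<close>, and finally \<open>c = z / sqrt (1 - z\<^sup>2)\<close>.\<close>

lemma quadrant_polar:
  fixes \<psi> h :: "real \<Rightarrow> ennreal"
  assumes p: "0 < p" and m: "0 < m" and \<psi>[measurable]: "\<psi> \<in> borel_measurable borel" and h[measurable]: "h \<in> borel_measurable borel"
  shows "(\<integral>\<^sup>+a. \<integral>\<^sup>+b. \<psi> (sqrt (a\<^sup>2 + b\<^sup>2)) * h (a / sqrt (a\<^sup>2 + b\<^sup>2)) * rad m b \<partial>lborel * rad p a \<partial>lborel)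
    = ennreal (omega p * omega m) * (\<integral>\<^sup>+t. \<psi> t * ennreal (t ^ (p + m - 1)) * indicator {0<..} t \<partial>lborel)
      * (\<integral>\<^sup>+z. h z * beta_w p m z \<partial>lborel)"
proof -
  have op: "0 < omega p" "0 < omega m" using p m omega_pos by auto
  let ?I = "\<lambda>x. indicator {0<..} x :: ennreal"
  let ?G = "\<lambda>a b. \<psi> (sqrt (a\<^sup>2 + b\<^sup>2)) * h (a / sqrt (a\<^sup>2 + b\<^sup>2))"
  let ?s = "\<lambda>c::real. sqrt (1 + c\<^sup>2)"
  let ?C = "ennreal (omega p * omega m)"
  let ?hc = "\<lambda>c. h (c / ?s c) * ennreal (c ^ (p - 1)) * ?I c"
  let ?\<psi>b = "\<lambda>b c. \<psi> (b * ?s c) * ennreal (b ^ (p + m - 1)) * ?I b"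
  let ?wc = "\<lambda>c. (1 + c\<^sup>2) powr (- real (p + m) / 2)"
  let ?T = "\<integral>\<^sup>+t. \<psi> t * ennreal (t ^ (p + m - 1)) * ?I t \<partial>lborel"
  have s0: "?s c > 0" for c by (simp add: add_pos_nonneg)
  have "(\<integral>\<^sup>+a. \<integral>\<^sup>+b. ?G a b * rad m b \<partial>lborel * rad p a \<partial>lborel) = (\<integral>\<^sup>+a. \<integral>\<^sup>+b. ?G a b * rad m b * rad p a \<partial>lborel \<partial>lborel)"
    by (intro nn_integral_cong nn_integral_multc[symmetric]) measurable
  also have "\<dots> = (\<integral>\<^sup>+b. \<integral>\<^sup>+a. ?G a b * rad m b * rad p a \<partial>lborel \<partial>lborel)"
    by (rule lborel_pair.Fubini') measurable
  also have "\<dots> = (\<integral>\<^sup>+b. \<integral>\<^sup>+c. ?C * ?hc c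
      * ?\<psi>b b c \<partial>lborel \<partial>lborel)"
  proof (rule nn_integral_cong)
    fix b :: real
    show "(\<integral>\<^sup>+a. ?G a b * rad m b * rad p a \<partial>lborel) = (\<integral>\<^sup>+c. ?C * ?hc c
      * ?\<psi>b b c \<partial>lborel)"
    proof (cases "b > 0")
      case True
      have "(\<integral>\<^sup>+a. ?G a b * rad m b * rad p a \<partial>lborel)
        = (\<integral>\<^sup>+a. (?G a b * rad m b * ennreal (omega p * a ^ (p - 1))) * ?I a \<partial>lborel)"
        by (simp add: rad_def mult.assoc)
      also have "\<dots> = ennreal b * (\<integral>\<^sup>+c. (?G (b * c) b * rad m b * ennreal (omega p * (b * c) ^ (p - 1))) * ?I c \<partial>lborel)"
        by (rule nn_integral_scale[OF True]) measurable
      also have "\<dots> = (\<integral>\<^sup>+c. ennreal b * ((?G (b * c) b * rad m b * ennreal (omega p * (b * c) ^ (p - 1))) * ?I c) \<partial>lborel)"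
        by (rule nn_integral_cmult[symmetric]) measurable
      also have "\<dots> = (\<integral>\<^sup>+c. ?C * ?hc c
        * ?\<psi>b b c \<partial>lborel)"
      proof (rule nn_integral_cong)
        fix c :: real
        show "ennreal b * ((?G (b * c) b * rad m b * ennreal (omega p * (b * c) ^ (p - 1))) * ?I c)
          = ?C * ?hc c
          * ?\<psi>b b c"
        proof (cases "c > 0")
          case c: True
          have sq: "sqrt ((b * c)\<^sup>2 + b\<^sup>2) = b * ?s c"
          proof -
            have "(b * c)\<^sup>2 + b\<^sup>2 = b\<^sup>2 * (1 + c\<^sup>2)" by (simp add: power_mult_distrib algebra_simps)
            then show ?thesis using True by (simp add: real_sqrt_mult)
          qed
          have hq: "b * c / (b * ?s c) = c / ?s c" using True by simp
          have pw: "b * (b ^ (m - 1) * b ^ (p - 1)) = b ^ (p + m - 1)"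
            using p m by (cases p; cases m) (simp_all add: power_add)
          have "ennreal b * (ennreal (omega m * b ^ (m - 1)) * ennreal (omega p * (b * c) ^ (p - 1)))
            = ennreal (b * ((omega m * b ^ (m - 1)) * (omega p * (b * c) ^ (p - 1))))"
            using True c op by (simp add: ennreal_mult)
          also have "b * ((omega m * b ^ (m - 1)) * (omega p * (b * c) ^ (p - 1)))
            = (omega p * omega m) * (c ^ (p - 1) * (b * (b ^ (m - 1) * b ^ (p - 1))))"
            by (simp add: power_mult_distrib)
          also have "ennreal \<dots> = ?C * (ennreal (c ^ (p - 1)) * ennreal (b ^ (p + m - 1)))"
            using True c op unfolding pw by (simp add: ennreal_mult)
          finally have e: "ennreal b * (ennreal (omega m * b ^ (m - 1)) * ennreal (omega p * (b * c) ^ (p - 1)))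
            = ?C * (ennreal (c ^ (p - 1)) * ennreal (b ^ (p + m - 1)))" .
          have "ennreal b * ((?G (b * c) b * rad m b * ennreal (omega p * (b * c) ^ (p - 1))) * ?I c)
            = \<psi> (b * ?s c) * h (c / ?s c) * (ennreal b * (ennreal (omega m * b ^ (m - 1)) * ennreal (omega p * (b * c) ^ (p - 1))))"
            unfolding sq hq rad_def using True c by (simp add: ac_simps)
          then show ?thesis unfolding e using True c by (simp add: ac_simps)
        qed simp
      qed
      finally show ?thesis .
    qed (simp add: rad_def)
  qed
  also have "\<dots> = (\<integral>\<^sup>+c. \<integral>\<^sup>+b. ?C * ?hc c
      * ?\<psi>b b c \<partial>lborel \<partial>lborel)"
    by (rule lborel_pair.Fubini') measurable
  also have "\<dots> = (\<integral>\<^sup>+c. ?C * ?T * (h (c / ?s c) * ennreal (c ^ (p - 1) * ?wc c) * ?I c) \<partial>lborel)"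
  proof (rule nn_integral_cong)
    fix c :: real
    have "?T = ennreal (?s c) * (\<integral>\<^sup>+b. (\<psi> (?s c * b) * ennreal ((?s c * b) ^ (p + m - 1))) * ?I b \<partial>lborel)"
      by (rule nn_integral_scale[OF s0]) measurable
    also have "\<dots> = ennreal (?s c) * (\<integral>\<^sup>+b. ennreal (?s c ^ (p + m - 1)) * ?\<psi>b b c \<partial>lborel)"
    proof (intro arg_cong[of _ _ "\<lambda>x. ennreal (?s c) * x"] nn_integral_cong)
      fix b :: real
      show "\<psi> (?s c * b) * ennreal ((?s c * b) ^ (p + m - 1)) * ?I b
        = ennreal (?s c ^ (p + m - 1)) * ?\<psi>b b c"
      proof (cases "b > 0")
        case True
        then have "ennreal ((?s c * b) ^ (p + m - 1)) = ennreal (?s c ^ (p + m - 1)) * ennreal (b ^ (p + m - 1))"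
          using s0[of c] by (simp only: power_mult_distrib) (rule ennreal_mult, simp_all add: less_imp_le)
        then show ?thesis by (simp only: mult.commute[of "?s c" b]) (simp only: ac_simps)
      qed simp
    qed
    also have "\<dots> = ennreal (?s c) * (ennreal (?s c ^ (p + m - 1)) * (\<integral>\<^sup>+b. ?\<psi>b b c \<partial>lborel))"
      by (subst nn_integral_cmult) auto
    also have "\<dots> = ennreal (?s c ^ (p + m)) * (\<integral>\<^sup>+b. ?\<psi>b b c \<partial>lborel)"
    proof -
      have "?s c * ?s c ^ (p + m - 1) = ?s c ^ (p + m)" using p by (cases p) simp_all
      then show ?thesis using s0[of c] by (simp add: mult.assoc[symmetric] ennreal_mult[symmetric] less_imp_le)
    qed
    finally have T: "?T = ennreal (?s c ^ (p + m)) * (\<integral>\<^sup>+b. ?\<psi>b b c \<partial>lborel)" .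
    have "?wc c * ?s c ^ (p + m) = 1"
    proof -
      have "?s c ^ (p + m) = ?s c powr real (p + m)" using powr_realpow[OF s0[of c], of "p + m"] by (rule sym)
      also have "\<dots> = (1 + c\<^sup>2) powr (real (p + m) / 2)"
        using s0[of c] by (simp add: powr_half_sqrt[symmetric] powr_powr)
      finally have e: "?s c ^ (p + m) = (1 + c\<^sup>2) powr (real (p + m) / 2)" .
      have "1 + c\<^sup>2 > 0" by (simp add: add_pos_nonneg)
      then show ?thesis unfolding e by (subst powr_add[symmetric]) (simp del: of_nat_add)
    qed
    then have "ennreal (?wc c) * ennreal (?s c ^ (p + m)) = 1"
      using s0[of c] by (simp add: ennreal_mult[symmetric] less_imp_le)
    then have J: "ennreal (?wc c) * ?T = (\<integral>\<^sup>+b. ?\<psi>b b c \<partial>lborel)"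
      unfolding T by (simp add: mult.assoc[symmetric])
    show "(\<integral>\<^sup>+b. ?C * ?hc c
      * ?\<psi>b b c \<partial>lborel)
      = ?C * ?T * (h (c / ?s c) * ennreal (c ^ (p - 1) * ?wc c) * ?I c)"
      by (subst nn_integral_cmult, simp, subst J[symmetric])
        (auto simp: indicator_def ennreal_mult ac_simps)
  qed
  also have "\<dots> = ?C * ?T * (\<integral>\<^sup>+c. h (c / ?s c) * ennreal (c ^ (p - 1) * ?wc c) * ?I c \<partial>lborel)"
    by (rule nn_integral_cmult) measurable
  also have "(\<integral>\<^sup>+c. h (c / ?s c) * ennreal (c ^ (p - 1) * ?wc c) * ?I c \<partial>lborel)
    = (\<integral>\<^sup>+z. h z * beta_w p m z \<partial>lborel)"
  proof (subst tangent_substitution, measurable, rule nn_integral_cong)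
    fix z :: real
    let ?c = "z / sqrt (1 - z\<^sup>2)"
    show "h (?c / ?s ?c) * ennreal (?c ^ (p - 1) * (1 + ?c\<^sup>2) powr (- real (p + m) / 2)) * ennreal ((1 - z\<^sup>2) powr (- 3 / 2)) * indicator {0<..<1} z
      = h z * beta_w p m z"
    proof (cases "0 < z \<and> z < 1")
      case True
      then have q: "1 - z\<^sup>2 > 0" by (simp add: power_less_one_iff)
      have e1: "1 + ?c\<^sup>2 = 1 / (1 - z\<^sup>2)" using q by (simp add: power_divide field_simps)
      have e2: "?c / ?s ?c = z" unfolding e1 using q by (simp add: real_sqrt_divide)
      have e3: "?c ^ (p - 1) = z ^ (p - 1) * (1 - z\<^sup>2) powr (- (real (p - 1) / 2))"
        using q by (simp add: power_divide powr_minus powr_half_sqrt[symmetric] powr_powr powr_realpow[symmetric] field_simps)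
      have e4: "(1 / (1 - z\<^sup>2)) powr (- real (p + m) / 2) = (1 - z\<^sup>2) powr (real (p + m) / 2)"
      proof -
        have "(1 / (1 - z\<^sup>2)) powr x = (1 - z\<^sup>2) powr (- x)" for x
          using q by (simp add: powr_divide powr_minus_divide)
        then show ?thesis by (simp del: of_nat_add)
      qed
      have "?c ^ (p - 1) * (1 + ?c\<^sup>2) powr (- real (p + m) / 2) * (1 - z\<^sup>2) powr (- 3 / 2)
        = z ^ (p - 1) * ((1 - z\<^sup>2) powr (- (real (p - 1) / 2)) * (1 - z\<^sup>2) powr (real (p + m) / 2) * (1 - z\<^sup>2) powr (- 3 / 2))"
        unfolding e1 e3 e4 by simp
      also have "\<dots> = z ^ (p - 1) * (1 - z\<^sup>2) powr (real m / 2 - 1)"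
      proof -
        \<comment> \<open>The three exponents come from the power of \<open>?c\<close>, from the
          factor separated off by scaling the \<open>b\<close>-integral, and from the derivative of
          the substitution.\<close>
        have "- (real (p - 1) / 2) + real (p + m) / 2 + - 3 / 2 = real m / 2 - 1"
          using p by (simp add: of_nat_diff field_simps)
        then show ?thesis by (simp only: powr_add[symmetric])
      qed
      finally have e5: "?c ^ (p - 1) * (1 + ?c\<^sup>2) powr (- real (p + m) / 2) * (1 - z\<^sup>2) powr (- 3 / 2)
        = z ^ (p - 1) * (1 - z\<^sup>2) powr (real m / 2 - 1)" .
      have nn: "0 \<le> ?c ^ (p - 1) * (1 + ?c\<^sup>2) powr (- real (p + m) / 2)" using True q by simp
      have em: "ennreal (?c ^ (p - 1) * (1 + ?c\<^sup>2) powr (- real (p + m) / 2)) * ennreal ((1 - z\<^sup>2) powr (- 3 / 2))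
        = ennreal (z ^ (p - 1) * (1 - z\<^sup>2) powr (real m / 2 - 1))"
        unfolding e5[symmetric] by (rule ennreal_mult[symmetric]) (use nn in auto)
      show ?thesis unfolding e2 beta_w_def em[symmetric] by (simp only: mult.assoc)
    qed (simp add: beta_w_def)
  qed
  finally show ?thesis .
qed

lemma nn_integral_gw_sub:
  fixes V :: "(real^'n) set"
  assumes V: "subspace V"
  shows "(\<integral>\<^sup>+v. gw (norm v) \<partial>lebesgue_sub V) = 1"
proof -
  interpret product_sigma_finite "\<lambda>_::nat. lborel :: real measure" by standard
  obtain b where b: "ons b (dim V)" "span (b ` {..<dim V}) = V" using ons_exists[OF V] .
  have "gw (norm (\<Sum>i<dim V. c i *\<^sub>R b i)) = (\<Prod>i<dim V. gw (c i))" for c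
    unfolding gw_def ons_norm_sum[OF b(1)]
    by (simp add: sum_distrib_left sum_negf[symmetric] exp_sum prod_ennreal)
  then have "(\<integral>\<^sup>+v. gw (norm v) \<partial>lebesgue_sub V) = (\<integral>\<^sup>+c. (\<Prod>i<dim V. gw (c i)) \<partial>PiM {..<dim V} (\<lambda>_. lborel))"
    by (subst nn_integral_lebesgue_sub_ons[OF b]) auto
  also have "\<dots> = 1" by (subst product_nn_integral_prod) (auto simp: nn_integral_gw)
  finally show ?thesis .
qed

text \<open>In a basis adapted to \<open>X\<close> and \<open>W\<close> a Gaussian vector splits
  into independent blocks of \<open>p\<close> and \<open>m\<close> coordinates, and only their
  lengths \<open>a\<close> and \<open>b\<close> matter. \<open>quadrant_polar\<close> then separates
  the total length from the ratio \<open>a / sqrt (a\<^sup>2 + b\<^sup>2)\<close>.\<close>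

lemma beta_law:
  fixes W X :: "(real^'n) set"
  assumes W: "subspace W" "dim W = p + m" and X: "subspace X" "dim X = p" "X \<subseteq> W"
    and p: "0 < p" and m: "0 < m" and h[measurable]: "h \<in> borel_measurable borel"
  shows "(\<integral>\<^sup>+v. gw (norm v) * h (norm (proj X v) / norm v) \<partial>lebesgue_sub W)
    = ennreal (omega p * omega m / omega (p + m)) * (\<integral>\<^sup>+z. h z * beta_w p m z \<partial>lborel)"
proof -
  interpret product_sigma_finite "\<lambda>_::nat. lborel :: real measure" by standard
  let ?d = "p + m"
  obtain b0 where b0: "ons b0 p" "span (b0 ` {..<p}) = X" using ons_exists[OF X(1)] X(2) by metis
  obtain b where b: "\<forall>i<p. b i = b0 i" "ons b ?d" "span (b ` {..<?d}) = W"
    using ons_extend[OF b0(1) W(1)] b0(2) X(3) W(2) by auto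
  have bX: "X = span (b ` {..<p})" unfolding b0(2)[symmetric] using b(1) by (intro arg_cong[of _ _ span] image_cong) auto
  have bp: "ons b p" using b(2) ons_mono[of b ?d p] by simp
  have [measurable]: "(\<lambda>x. proj X x) \<in> borel_measurable borel"
    by (rule measurable_proj_joint) (use X in auto)
  have nrm: "norm (\<Sum>i<?d. c i *\<^sub>R b i) = sqrt (\<Sum>i<?d. (c i)\<^sup>2)" for c
    using ons_norm_sum[OF b(2), of c] by (simp add: real_sqrt_unique)
  have "proj X (\<Sum>i<?d. c i *\<^sub>R b i) = (\<Sum>i<p. c i *\<^sub>R b i)" for c
    unfolding bX ons_proj[OF bp] using ons_inner_sum[OF b(2), of _ c] by (intro sum.cong) simp_all
  then have prj: "norm (proj X (\<Sum>i<?d. c i *\<^sub>R b i)) = sqrt (\<Sum>i<p. (c i)\<^sup>2)" for c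
    using ons_norm_sum[OF bp, of c] by (simp add: real_sqrt_unique)
  have U: "{..<?d} = {..<p} \<union> {p..<?d}" by auto
  have sp: "(\<Sum>i<?d. (c i)\<^sup>2) = (\<Sum>i<p. (c i)\<^sup>2) + (\<Sum>i=p..<?d. (c i)\<^sup>2)" for c :: "nat \<Rightarrow> real"
    unfolding U by (rule sum.union_disjoint) auto
  let ?F = "\<lambda>a b. gw (sqrt (a\<^sup>2 + b\<^sup>2)) * h (a / sqrt (a\<^sup>2 + b\<^sup>2))"
  have "(\<integral>\<^sup>+v. gw (norm v) * h (norm (proj X v) / norm v) \<partial>lebesgue_sub W)
    = (\<integral>\<^sup>+c. gw (norm (\<Sum>i<?d. c i *\<^sub>R b i)) * h (norm (proj X (\<Sum>i<?d. c i *\<^sub>R b i)) / norm (\<Sum>i<?d. c i *\<^sub>R b i)) \<partial>PiM {..<?d} (\<lambda>_. lborel))"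
    by (rule nn_integral_lebesgue_sub_ons[OF b(2,3)]) measurable
  also have "\<dots> = (\<integral>\<^sup>+c. ?F (sqrt (\<Sum>i<p. (c i)\<^sup>2)) (sqrt (\<Sum>i=p..<?d. (c i)\<^sup>2)) \<partial>PiM {..<?d} (\<lambda>_. lborel))"
    unfolding nrm prj sp by (simp add: sum_nonneg)
  also have "\<dots> = (\<integral>\<^sup>+y. \<integral>\<^sup>+w. ?F (sqrt (\<Sum>i<p. (y i)\<^sup>2)) (sqrt (\<Sum>i=p..<?d. (w i)\<^sup>2)) \<partial>PiM {p..<?d} (\<lambda>_. lborel) \<partial>PiM {..<p} (\<lambda>_. lborel))"
    unfolding U by (subst product_nn_integral_fold) (auto simp: merge_def intro!: nn_integral_cong)
  also have "\<dots> = (\<integral>\<^sup>+y. \<integral>\<^sup>+b. ?F (sqrt (\<Sum>i<p. (y i)\<^sup>2)) b * rad m b \<partial>lborel \<partial>PiM {..<p} (\<lambda>_. lborel))"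
    by (intro nn_integral_cong nn_integral_radial) (use m in auto)
  also have "\<dots> = (\<integral>\<^sup>+a. (\<integral>\<^sup>+b. ?F a b * rad m b \<partial>lborel) * rad p a \<partial>lborel)"
    by (rule nn_integral_radial[of "{..<p}" p "\<lambda>a. \<integral>\<^sup>+b. ?F a b * rad m b \<partial>lborel"]) (use p in auto)
  also have "\<dots> = ennreal (omega p * omega m) * (\<integral>\<^sup>+t. gw t * ennreal (t ^ (p + m - 1)) * indicator {0<..} t \<partial>lborel)
      * (\<integral>\<^sup>+z. h z * beta_w p m z \<partial>lborel)"
    by (rule quadrant_polar[OF p m]) measurable
  also have "(\<integral>\<^sup>+t. gw t * ennreal (t ^ (p + m - 1)) * indicator {0<..} t \<partial>lborel) = ennreal (1 / omega (p + m))"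
  proof -
    have op: "omega (p + m) > 0" using p omega_pos by simp
    \<comment> \<open>The radial integral is read off from the total Gaussian mass one on
      \<open>W\<close>, so no Gamma integral is evaluated; this puts \<open>omega (p + m)\<close>
      into the denominator.\<close>
    have "1 = (\<integral>\<^sup>+v. gw (norm v) \<partial>lebesgue_sub W)" by (simp add: nn_integral_gw_sub[OF W(1)])
    also have "\<dots> = (\<integral>\<^sup>+t. gw t * rad ?d t \<partial>lborel)"
      by (rule nn_integral_lebesgue_sub_radial[OF W]) (use p in auto)
    also have "\<dots> = (\<integral>\<^sup>+t. ennreal (omega ?d) * (gw t * ennreal (t ^ (p + m - 1)) * indicator {0<..} t) \<partial>lborel)"
      using op by (intro nn_integral_cong) (auto simp: rad_def indicator_def ennreal_mult ac_simps)
    also have "\<dots> = ennreal (omega ?d) * (\<integral>\<^sup>+t. gw t * ennreal (t ^ (p + m - 1)) * indicator {0<..} t \<partial>lborel)"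
      by (rule nn_integral_cmult) measurable
    finally have e: "ennreal (omega ?d) * (\<integral>\<^sup>+t. gw t * ennreal (t ^ (p + m - 1)) * indicator {0<..} t \<partial>lborel) = 1" by simp
    have "ennreal (1 / omega ?d) * (ennreal (omega ?d) * (\<integral>\<^sup>+t. gw t * ennreal (t ^ (p + m - 1)) * indicator {0<..} t \<partial>lborel))
      = (\<integral>\<^sup>+t. gw t * ennreal (t ^ (p + m - 1)) * indicator {0<..} t \<partial>lborel)"
      using op by (simp add: mult.assoc[symmetric] ennreal_mult[symmetric])
    then show ?thesis unfolding e by simp
  qed
  also have "ennreal (omega p * omega m) * ennreal (1 / omega ?d) = ennreal (omega p * omega m / omega ?d)"
    using omega_pos[OF p] omega_pos[OF m] omega_pos[of ?d] p by (subst ennreal_mult[symmetric]) auto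
  finally show ?thesis .
qed

subsection \<open>Intersections of flats\<close>

text \<open>The distances from \<open>x\<close> alone do not determine the distance to the
  intersection. By compactness, the closed ball of radius \<open>r > 0\<close> around
  \<open>x\<close> contains a common point of both sets exactly if the open ball contains points
  whose distances to \<open>A\<close> and \<open>B\<close> have arbitrarily small sum; such points
  can be taken from a countable dense set.\<close>

lemma measurable_infdist_Int:
  fixes A B :: "'b \<Rightarrow> 'a::euclidean_space set"
  assumes A[measurable]: "\<And>y. (\<lambda>\<omega>. infdist y (A \<omega>)) \<in> borel_measurable M"
    and B[measurable]: "\<And>y. (\<lambda>\<omega>. infdist y (B \<omega>)) \<in> borel_measurable M"
    and cl: "\<And>\<omega>. \<omega> \<in> space M \<Longrightarrow> closed (A \<omega>) \<and> closed (B \<omega>)"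
    and ne: "\<And>\<omega>. \<omega> \<in> space M \<Longrightarrow> A \<omega> \<inter> B \<omega> \<noteq> {}"
  shows "(\<lambda>\<omega>. infdist x (A \<omega> \<inter> B \<omega>)) \<in> borel_measurable M"
proof (rule borel_measurableI_le)
  obtain D :: "'a set" where D: "countable D" "\<And>X. open X \<Longrightarrow> X \<noteq> {} \<Longrightarrow> \<exists>d\<in>D. d \<in> X"
    using countable_dense_setE by blast
  let ?S = "\<lambda>r. {\<omega>\<in>space M. infdist x (A \<omega> \<inter> B \<omega>) \<le> r}"
  \<comment> \<open>A positive radius ensures that the open ball contains dense points; radius 0 is
    recovered afterwards as a countable intersection.\<close>
  have pos: "?S r \<in> sets M" if r: "r > 0" for r
  proof -
    have "?S r = {\<omega>\<in>space M. \<forall>m::nat. \<exists>y\<in>D \<inter> ball x r. infdist y (A \<omega>) + infdist y (B \<omega>) < 1 / real (Suc m)}" (is "_ = ?T")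
    proof (intro equalityI subsetI)
      fix \<omega> assume "\<omega> \<in> ?S r"
      then have w: "\<omega> \<in> space M" "infdist x (A \<omega> \<inter> B \<omega>) \<le> r" by auto
      have "closed (A \<omega> \<inter> B \<omega>)" using cl w by auto
      then obtain z where z: "z \<in> A \<omega> \<inter> B \<omega>" "infdist x (A \<omega> \<inter> B \<omega>) = dist x z"
        using infdist_attains_inf[OF _ ne[OF w(1)]] by blast
      have "z \<in> closure (ball x r)" using z w r by simp
      have "\<exists>y\<in>D \<inter> ball x r. infdist y (A \<omega>) + infdist y (B \<omega>) < 1 / real (Suc m)" for m
      proof -
        let ?e = "1 / (2 * real (Suc m))"
        have "ball x r \<inter> ball z ?e \<noteq> {}"
          using \<open>z \<in> closure (ball x r)\<close> unfolding closure_approachable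
          by (auto simp: dist_commute ball_def dest!: spec[of _ ?e])
        then obtain y where y: "y \<in> D" "y \<in> ball x r \<inter> ball z ?e"
          using D(2)[of "ball x r \<inter> ball z ?e"] by auto
        have "infdist y (A \<omega>) \<le> dist y z" "infdist y (B \<omega>) \<le> dist y z" using z infdist_le by auto
        moreover have "dist y z < ?e" using y by (simp add: dist_commute)
        ultimately have "infdist y (A \<omega>) + infdist y (B \<omega>) < 2 * ?e" by linarith
        moreover have "2 * ?e = 1 / real (Suc m)" by (simp add: field_simps)
        ultimately show ?thesis using y by (metis IntD1 IntI)
      qed
      then show "\<omega> \<in> ?T" using w by blast
    next
      fix \<omega> assume "\<omega> \<in> ?T"
      then have w: "\<omega> \<in> space M" and "\<forall>m::nat. \<exists>y\<in>D \<inter> ball x r. infdist y (A \<omega>) + infdist y (B \<omega>) < 1 / real (Suc m)" by auto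
      then obtain y where y: "\<And>m. y m \<in> ball x r" "\<And>m. infdist (y m) (A \<omega>) + infdist (y m) (B \<omega>) < 1 / real (Suc m)"
        by (metis IntD2)
      have "\<forall>m. y m \<in> cball x r" using y(1) by (auto simp: less_imp_le)
      then obtain z \<sigma> where z: "z \<in> cball x r" "strict_mono \<sigma>" "(y \<circ> \<sigma>) \<longlonglongrightarrow> z"
        using compact_cball[of x r] unfolding compact_def by metis
      have t: "(\<lambda>m. infdist (y (\<sigma> m)) (A \<omega>) + infdist (y (\<sigma> m)) (B \<omega>)) \<longlonglongrightarrow> infdist z (A \<omega>) + infdist z (B \<omega>)"
        using z(3) by (intro tendsto_add tendsto_infdist) (simp_all add: comp_def)
      have "(\<lambda>m. infdist (y (\<sigma> m)) (A \<omega>) + infdist (y (\<sigma> m)) (B \<omega>)) \<longlonglongrightarrow> 0"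
      proof (rule tendsto_sandwich[OF _ _ tendsto_const LIMSEQ_inverse_real_of_nat])
        show "\<forall>\<^sub>F m in sequentially. 0 \<le> infdist (y (\<sigma> m)) (A \<omega>) + infdist (y (\<sigma> m)) (B \<omega>)"
          by (simp add: infdist_nonneg)
        have "infdist (y (\<sigma> m)) (A \<omega>) + infdist (y (\<sigma> m)) (B \<omega>) \<le> inverse (real (Suc m))" for m
        proof -
          have "infdist (y (\<sigma> m)) (A \<omega>) + infdist (y (\<sigma> m)) (B \<omega>) \<le> 1 / real (Suc (\<sigma> m))" using y(2)[of "\<sigma> m"] by simp
          also have "\<dots> \<le> 1 / real (Suc m)" using seq_suble[OF z(2), of m] by (intro divide_left_mono) auto
          finally show ?thesis by (simp add: inverse_eq_divide)
        qed
        then show "\<forall>\<^sub>F m in sequentially. infdist (y (\<sigma> m)) (A \<omega>) + infdist (y (\<sigma> m)) (B \<omega>) \<le> inverse (real (Suc m))" by simp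
      qed
      with t have "infdist z (A \<omega>) + infdist z (B \<omega>) = 0" using LIMSEQ_unique by blast
      then have "infdist z (A \<omega>) = 0" "infdist z (B \<omega>) = 0" using infdist_nonneg[of z] by (auto simp: add_nonneg_eq_0_iff)
      moreover have "A \<omega> \<noteq> {}" "B \<omega> \<noteq> {}" using ne[OF w] by auto
      ultimately have "z \<in> A \<omega> \<inter> B \<omega>" using cl[OF w] in_closed_iff_infdist_zero by blast
      then have "infdist x (A \<omega> \<inter> B \<omega>) \<le> r" using infdist_le[of z "A \<omega> \<inter> B \<omega>" x] z(1) by simp
      then show "\<omega> \<in> ?S r" using w by simp
    qed
    also have "?T = (\<Inter>m::nat. \<Union>y\<in>D \<inter> ball x r. {\<omega>\<in>space M. infdist y (A \<omega>) + infdist y (B \<omega>) < 1 / real (Suc m)})"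
      by auto
    also have "\<dots> \<in> sets M"
    proof (intro sets.countable_INT sets.countable_UN' image_subsetI)
      show "countable (D \<inter> ball x r)" using D(1) by auto
      fix m y show "{\<omega>\<in>space M. infdist y (A \<omega>) + infdist y (B \<omega>) < 1 / real (Suc m)} \<in> sets M" by measurable
    qed auto
    finally show ?thesis .
  qed
  fix r :: real
  consider "r > 0" | "r = 0" | "r < 0" by linarith
  then show "?S r \<in> sets M"
  proof cases
    case 1 then show ?thesis by (rule pos)
  next
    case 2
    have "?S 0 = (\<Inter>m::nat. ?S (1 / real (Suc m)))"
    proof (intro equalityI subsetI)
      fix \<omega> assume "\<omega> \<in> (\<Inter>m::nat. ?S (1 / real (Suc m)))"
      then have w: "\<omega> \<in> space M" "\<And>m. infdist x (A \<omega> \<inter> B \<omega>) \<le> inverse (real (Suc m))"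
        by (auto simp: inverse_eq_divide)
      have "infdist x (A \<omega> \<inter> B \<omega>) \<le> 0"
        by (rule LIMSEQ_le_const[OF LIMSEQ_inverse_real_of_nat]) (use w in auto)
      then show "\<omega> \<in> ?S 0" using w by simp
    next
      fix \<omega> assume "\<omega> \<in> ?S 0"
      then have "\<omega> \<in> space M" "infdist x (A \<omega> \<inter> B \<omega>) \<le> 0" by auto
      then show "\<omega> \<in> (\<Inter>m::nat. ?S (1 / real (Suc m)))" by (auto intro: order_trans)
    qed
    also have "\<dots> \<in> sets M" by (intro sets.countable_INT image_subsetI pos) auto
    finally show ?thesis using 2 by simp
  next
    case 3
    have "\<not> infdist x (A \<omega> \<inter> B \<omega>) \<le> r" for \<omega> using 3 infdist_nonneg[of x "A \<omega> \<inter> B \<omega>"] by linarith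
    then have "?S r = {}" by blast
    then show ?thesis by (simp only: sets.empty_sets)
  qed
qed

text \<open>The dimension is the trace of the orthogonal projection, whose diagonal entry at a unit
  vector \<open>b\<close> is \<open>1 - (infdist b V)\<^sup>2\<close>. This makes the dimension a
  measurable function of distances.\<close>

lemma dim_eq_trace:
  fixes V :: "'a::euclidean_space set"
  assumes "subspace V"
  shows "real (dim V) = (\<Sum>b\<in>Basis. 1 - (infdist b V)\<^sup>2)"
proof -
  obtain v where v: "ons v (dim V)" "span (v ` {..<dim V}) = V" using ons_exists[OF assms] by metis
  have "1 - (infdist b V)\<^sup>2 = (\<Sum>i<dim V. (b \<bullet> v i)\<^sup>2)" if "b \<in> Basis" for b
    using infdist_subspace_sq[OF assms, of b] ons_proj[OF v(1), of b] ons_norm_sum[OF v(1), of "\<lambda>i. b \<bullet> v i"] that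
    by (simp add: v(2))
  then have "(\<Sum>b\<in>Basis. 1 - (infdist b V)\<^sup>2) = (\<Sum>b\<in>Basis. \<Sum>i<dim V. (b \<bullet> v i)\<^sup>2)" by simp
  also have "\<dots> = (\<Sum>i<dim V. \<Sum>b\<in>Basis. (b \<bullet> v i)\<^sup>2)" by (rule sum.swap)
  also have "\<dots> = (\<Sum>i<dim V. 1)"
  proof (rule sum.cong)
    fix i assume "i \<in> {..<dim V}"
    then have "v i \<bullet> v i = 1" using onsD[OF v(1)] by simp
    then show "(\<Sum>b\<in>Basis. (b \<bullet> v i)\<^sup>2) = 1"
      by (subst (asm) euclidean_inner) (simp add: power2_eq_square inner_commute)
  qed simp
  finally show ?thesis by simp
qed

lemma measurable_dim_Int:
  fixes A B :: "'b \<Rightarrow> 'a::euclidean_space set"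
  assumes A: "\<And>y. (\<lambda>\<omega>. infdist y (A \<omega>)) \<in> borel_measurable M"
    and B: "\<And>y. (\<lambda>\<omega>. infdist y (B \<omega>)) \<in> borel_measurable M"
    and sub: "\<And>\<omega>. \<omega> \<in> space M \<Longrightarrow> subspace (A \<omega>) \<and> subspace (B \<omega>)"
  shows "{\<omega>\<in>space M. dim (A \<omega> \<inter> B \<omega>) = d} \<in> sets M"
proof -
  have [measurable]: "(\<lambda>\<omega>. infdist y (A \<omega> \<inter> B \<omega>)) \<in> borel_measurable M" for y
  proof (rule measurable_infdist_Int[OF A B])
    fix \<omega> assume "\<omega> \<in> space M"
    from sub[OF this] show "closed (A \<omega>) \<and> closed (B \<omega>)" "A \<omega> \<inter> B \<omega> \<noteq> {}"
      using subspace_0[of "A \<omega>"] subspace_0[of "B \<omega>"] by (auto simp: closed_subspace)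
  qed
  have "{\<omega>\<in>space M. (\<Sum>b\<in>Basis. 1 - (infdist b (A \<omega> \<inter> B \<omega>))\<^sup>2) = real d} \<in> sets M" by measurable
  moreover have "(\<Sum>b\<in>Basis. 1 - (infdist b (A \<omega> \<inter> B \<omega>))\<^sup>2) = real (dim (A \<omega> \<inter> B \<omega>))" if "\<omega> \<in> space M" for \<omega>
    by (rule dim_eq_trace[symmetric]) (use sub[OF that] subspace_inter in auto)
  then have "{\<omega>\<in>space M. (\<Sum>b\<in>Basis. 1 - (infdist b (A \<omega> \<inter> B \<omega>))\<^sup>2) = real d} = {\<omega>\<in>space M. dim (A \<omega> \<inter> B \<omega>) = d}"
    by auto
  ultimately show ?thesis by simp
qed

section \<open>Directions of flats and their intersections with subspaces\<close>

definition direction :: "'a::euclidean_space set \<Rightarrow> 'a set" where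
  "direction E = {x - y | x y. x \<in> E \<and> y \<in> E}"

lemma direction_translate:
  assumes "subspace L"
  shows "direction ((\<lambda>y. y + x) ` L) = L"
proof
  show "direction ((\<lambda>y. y + x) ` L) \<subseteq> L" using assms by (auto simp: direction_def intro: subspace_diff)
  show "L \<subseteq> direction ((\<lambda>y. y + x) ` L)"
  proof
    fix z assume "z \<in> L"
    then have "z = (z + x) - (0 + x)" "z + x \<in> (\<lambda>y. y + x) ` L" "0 + x \<in> (\<lambda>y. y + x) ` L"
      using subspace_0[OF assms] by (simp, blast, blast)
    then show "z \<in> direction ((\<lambda>y. y + x) ` L)" unfolding direction_def by blast
  qed
qed

lemma direction_AffGrass: "E \<in> AffGrass k \<Longrightarrow> direction E \<in> Grass k"
  by (auto simp: AffGrass_def direction_translate GrassD(1))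

lemma direction_linear_image:
  assumes "linear f"
  shows "direction (f ` E) = f ` direction E"
proof
  show "direction (f ` E) \<subseteq> f ` direction E"
  proof
    fix z assume "z \<in> direction (f ` E)"
    then obtain x y where "x \<in> E" "y \<in> E" "z = f x - f y" unfolding direction_def by blast
    then have "z = f (x - y)" "x - y \<in> direction E" by (auto simp: direction_def linear_diff[OF assms])
    then show "z \<in> f ` direction E" by blast
  qed
  show "f ` direction E \<subseteq> direction (f ` E)"
    unfolding direction_def using linear_diff[OF assms] by blast
qed

lemma infdist_scale_subspace:
  fixes L :: "'a::euclidean_space set"
  shows "subspace L \<Longrightarrow> infdist (c *\<^sub>R y) L = \<bar>c\<bar> * infdist y L"
  by (simp add: infdist_subspace proj_scaleR scaleR_diff_right[symmetric])

text \<open>The direction is the limit of the flat shrunk towards the origin: the distance from a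
  large multiple of \<open>y\<close>, divided by the factor, differs from the distance of
  \<open>y\<close> to the direction by at most the length of the shift over the factor.\<close>

lemma measurable_direction:
  assumes F: "F \<in> measurable M (set_sigma (AffGrass k :: (real^'n) set set))"
  shows "(\<lambda>\<omega>. infdist y (direction (F \<omega>))) \<in> borel_measurable M"
proof (rule borel_measurable_LIMSEQ_real)
  note measurable_infdist_comp[OF F, measurable]
  show "(\<lambda>\<omega>. infdist (real (Suc m) *\<^sub>R y) (F \<omega>) / real (Suc m)) \<in> borel_measurable M" for m by measurable
  fix \<omega> assume "\<omega> \<in> space M"
  then have "F \<omega> \<in> AffGrass k" using measurable_space[OF F] by simp
  then obtain L x where L: "L \<in> Grass k" "F \<omega> = (\<lambda>y. y + x) ` L" by (auto simp: AffGrass_def)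
  have sL: "subspace L" using L GrassD by blast
  have "\<bar>infdist (real (Suc m) *\<^sub>R y) (F \<omega>) / real (Suc m) - infdist y L\<bar> \<le> norm x * inverse (real (Suc m))" for m
  proof -
    have "\<bar>infdist (real (Suc m) *\<^sub>R y - x) L - infdist (real (Suc m) *\<^sub>R y) L\<bar> \<le> norm x"
      using infdist_triangle_abs[of "real (Suc m) *\<^sub>R y - x" L "real (Suc m) *\<^sub>R y"] by (simp add: dist_norm)
    then have "\<bar>infdist (real (Suc m) *\<^sub>R y) (F \<omega>) - real (Suc m) * infdist y L\<bar> / real (Suc m) \<le> norm x / real (Suc m)"
      unfolding L(2) infdist_translate infdist_scale_subspace[OF sL] by (intro divide_right_mono) auto
    moreover have "\<bar>infdist (real (Suc m) *\<^sub>R y) (F \<omega>) - real (Suc m) * infdist y L\<bar> / real (Suc m)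
      = \<bar>infdist (real (Suc m) *\<^sub>R y) (F \<omega>) / real (Suc m) - infdist y L\<bar>"
    proof -
      have "\<bar>a - real (Suc m) * c\<bar> / real (Suc m) = \<bar>a / real (Suc m) - c\<bar>" for a c
      proof -
        have "a - real (Suc m) * c = real (Suc m) * (a / real (Suc m) - c)" by (simp add: right_diff_distrib)
        then show ?thesis by (simp only: abs_mult) simp
      qed
      then show ?thesis .
    qed
    ultimately show ?thesis by (simp only: divide_inverse)
  qed
  then have "\<forall>\<^sub>F m in sequentially. norm (infdist (real (Suc m) *\<^sub>R y) (F \<omega>) / real (Suc m) - infdist y L) \<le> norm x * inverse (real (Suc m))"
    unfolding real_norm_def by (intro always_eventually allI)
  moreover have "(\<lambda>m. norm x * inverse (real (Suc m))) \<longlonglongrightarrow> 0"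
    using tendsto_mult[OF tendsto_const LIMSEQ_inverse_real_of_nat, of "norm x"] by (simp only: mult_zero_right)
  ultimately have "(\<lambda>m. infdist (real (Suc m) *\<^sub>R y) (F \<omega>) / real (Suc m) - infdist y L) \<longlonglongrightarrow> 0"
    by (rule Lim_null_comparison)
  then show "(\<lambda>m. infdist (real (Suc m) *\<^sub>R y) (F \<omega>) / real (Suc m)) \<longlonglongrightarrow> infdist y (direction (F \<omega>))"
    using L(2) direction_translate[OF sL] by (simp add: LIM_zero_iff)
qed

text \<open>The dimension condition forces the direction and \<open>L\<close> to span the space
  together, so the shift may be chosen inside \<open>L\<close>. With such a shift the intersection
  is a translate of \<open>K \<inter> L\<close>, in particular nonempty.\<close>

lemma Int_AffGrass:
  fixes E L :: "(real^'n) set"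
  assumes E: "E \<in> AffGrass j" and L: "L \<in> Grass q" and d: "dim (direction E \<inter> L) = g" "j + q = CARD('n) + g"
  shows "E \<inter> L \<in> AffGrass g" "E \<inter> L \<noteq> {}"
proof -
  obtain K x where K: "K \<in> Grass j" "E = (\<lambda>y. y + x) ` K" using E by (auto simp: AffGrass_def)
  have sK: "subspace K" and sL: "subspace L" using K L GrassD by auto
  have dE: "direction E = K" unfolding K(2) by (rule direction_translate[OF sK])
  have "dim {a + b |a b. a \<in> K \<and> b \<in> L} = CARD('n)"
    using dim_sums_Int[OF sK sL] d K(1) L by (simp add: dE Grass_def)
  then have "{a + b |a b. a \<in> K \<and> b \<in> L} = UNIV"
    using subspace_sums[OF sK sL] dim_eq_full[of "{a + b |a b. a \<in> K \<and> b \<in> L}"] span_eq_iff[of "{a + b |a b. a \<in> K \<and> b \<in> L}"]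
    by simp
  then obtain a b where ab: "x = a + b" "a \<in> K" "b \<in> L" by blast
  have Eb: "E = (\<lambda>y. y + b) ` K" unfolding K(2) by (rule translate_eq[OF sK]) (simp add: ab)
  have "E \<inter> L = (\<lambda>y. y + b) ` (K \<inter> L)"
  proof
    show "(\<lambda>y. y + b) ` (K \<inter> L) \<subseteq> E \<inter> L" unfolding Eb using ab sL by (auto simp: subspace_add)
    show "E \<inter> L \<subseteq> (\<lambda>y. y + b) ` (K \<inter> L)"
    proof
      fix z assume z: "z \<in> E \<inter> L"
      then obtain y where "y \<in> K" "z = y + b" unfolding Eb by blast
      moreover have "z - b \<in> L" using z ab(3) sL by (auto intro: subspace_diff)
      ultimately show "z \<in> (\<lambda>y. y + b) ` (K \<inter> L)" by auto
    qed
  qed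
  moreover have "K \<inter> L \<in> Grass g" using d sK sL by (simp add: Grass_def dE subspace_inter)
  ultimately show "E \<inter> L \<in> AffGrass g" using translate_AffGrass by metis
  then show "E \<inter> L \<noteq> {}" by (rule AffGrass_nonempty)
qed

subsection \<open>Transversality\<close>

text \<open>One Gram-Schmidt step, written as a formula so that the projection onto the enlarged
  span is measurable in \<open>v\<close>. If \<open>v\<close> lies in \<open>V\<close>, then
  \<open>w = 0\<close> and the correction term disappears.\<close>

lemma proj_insert:
  fixes V :: "'a::euclidean_space set" and v :: 'a
  assumes V: "subspace V"
  defines "w \<equiv> v - proj V v"
  shows "proj (span (insert v V)) y = proj V y + ((y \<bullet> w) / (w \<bullet> w)) *\<^sub>R w"
proof (rule proj_eqI)
  let ?p = "proj V y + ((y \<bullet> w) / (w \<bullet> w)) *\<^sub>R w"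
  have wV: "w \<bullet> u = 0" if "u \<in> V" for u unfolding w_def using proj_orth[OF V that] .
  have in': "u \<in> span (insert v V)" if "u \<in> V" for u using that by (simp add: span_base)
  show "?p \<in> span (insert v V)"
  proof -
    have "v \<in> span (insert v V)" by (simp add: span_base)
    then have "w \<in> span (insert v V)" unfolding w_def using in'[OF proj_in[OF V]] by (rule span_diff)
    then show ?thesis using in'[OF proj_in[OF V]] by (intro span_add span_scale)
  qed
  have oV: "(y - ?p) \<bullet> u = 0" if "u \<in> V" for u
    using proj_orth[OF V that, of y] wV[OF that] by (simp add: inner_diff_left inner_add_left)
  have ow: "(y - ?p) \<bullet> w = 0"
    using wV[OF proj_in[OF V], of y]
    by (cases "w = 0") (simp_all add: inner_diff_left inner_add_left inner_commute[of "proj V y"])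
  have ov: "(y - ?p) \<bullet> v = 0"
  proof -
    have "v = w + proj V v" by (simp add: w_def)
    then have "(y - ?p) \<bullet> v = (y - ?p) \<bullet> w + (y - ?p) \<bullet> proj V v" by (metis inner_add_right)
    then show ?thesis using ow oV[OF proj_in[OF V]] by simp
  qed
  fix u assume "u \<in> span (insert v V)"
  then show "(y - ?p) \<bullet> u = 0"
    by (rule span_induct) (use ov oV subspace_hyperplane[of "y - ?p"] in auto)
qed simp

text \<open>By transitivity and invariance the generic intersection dimension depends only on the
  dimension of the fixed subspace, so one convenient subspace decides for all.\<close>

lemma nu_dim_Int_rotation:
  fixes V V' :: "(real^'n) set"
  assumes n: "CARD('n) \<ge> 2" "b < CARD('n)" "a < CARD('n)" and V: "V \<in> Grass a" "V' \<in> Grass a"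
    and AE: "AE L in nu b. dim (V \<inter> L) = d"
  shows "AE L in nu b. dim (V' \<inter> L) = d"
proof -
  obtain R where R: "R \<in> rotations" "R ` V = V'"
    using rotation_transitive[of a V V'] n V Grass_sub_AffGrass[of a] by (auto simp: GrassD(1) subspace_0)
  let ?M = "matrix R"
  have M: "?M \<in> SO" "(*v) ?M ` V = V'" using rotation_SO[OF R(1)] R(2) by auto
  have ot: "orthogonal_transformation ((*v) ?M)" using M SO_orthogonal by blast
  have lin: "linear ((*v) ?M)" and inj: "inj ((*v) ?M)"
    using ot orthogonal_transformation_linear orthogonal_transformation_inj by blast+
  let ?S = "\<lambda>V. {L\<in>Grass b. dim (V \<inter> L) = d}"
  have S: "?S V \<in> sets (set_sigma (Grass b))" if "V \<in> Grass a" for V :: "(real^'n) set"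
    using measurable_dim_Int[of "\<lambda>_. V" "set_sigma (Grass b)" "\<lambda>L. L" d] that
    by (simp add: measurable_infdist_set_sigma GrassD(1))
  let ?f = "\<lambda>V L. indicator (Grass b - ?S V) L :: ennreal"
  have f: "?f V \<in> borel_measurable (set_sigma (Grass b))" if "V \<in> Grass a" for V :: "(real^'n) set"
    using S[OF that] sets.top[of "set_sigma (Grass b)"] by (auto intro!: borel_measurable_indicator)
  have null: "(AE L in nu b. dim (V \<inter> L) = d) \<longleftrightarrow> (\<integral>\<^sup>+L. ?f V L \<partial>nu b) = 0" if "V \<in> Grass a" for V :: "(real^'n) set"
  proof -
    have "?f V \<in> borel_measurable (nu b)" using f[OF that] by (simp add: measurable_cong_sets[OF nu_spec(1)[OF n(1,2)] refl])
    then have "(\<integral>\<^sup>+L. ?f V L \<partial>nu b) = 0 \<longleftrightarrow> (AE L in nu b. ?f V L = 0)" by (rule nn_integral_0_iff_AE)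
    also have "\<dots> \<longleftrightarrow> (AE L in nu b. dim (V \<inter> L) = d)"
      by (rule AE_cong) (auto simp: indicator_def space_nu[OF n(1,2)])
    finally show ?thesis by simp
  qed
  have "dim (V' \<inter> (*v) ?M ` L) = dim (V \<inter> L)" for L
  proof -
    have "V' \<inter> (*v) ?M ` L = (*v) ?M ` (V \<inter> L)" using M(2) inj by (auto simp: inj_def)
    then show ?thesis using lin inj by (simp add: dim_image_eq inj_on_subset)
  qed
  then have "?f V' ((*v) ?M ` L) = ?f V L" if "L \<in> Grass b" for L
    using that SO_image_Grass[OF M(1) that] by (simp add: indicator_def)
  then have "(\<integral>\<^sup>+L. ?f V L \<partial>nu b) = (\<integral>\<^sup>+L. ?f V' ((*v) ?M ` L) \<partial>nu b)"
    by (intro nn_integral_cong) (simp add: space_nu[OF n(1,2)])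
  also have "\<dots> = (\<integral>\<^sup>+L. ?f V' L \<partial>nu b)" by (rule nu_invariant[OF n(1,2) M(1) f[OF V(2)]])
  finally show ?thesis using AE null[OF V(1)] null[OF V(2)] by simp
qed

text \<open>Induction on the dimension \<open>a\<close>, adding a vector \<open>v\<close>. If
  \<open>V0\<close> meets \<open>L\<close> trivially, the enlarged span does so as well unless
  \<open>v\<close> lies in the proper subspace \<open>V0 + L\<close>. Fubini exchanges the null sets
  and provides a fixed \<open>v\<close>, and \<open>nu_dim_Int_rotation\<close> passes to the given
  subspace.\<close>

lemma transversal_complement:
  fixes V :: "(real^'n) set"
  assumes n: "CARD('n) \<ge> 2" "b < CARD('n)" "0 < b"
  shows "a + b \<le> CARD('n) \<Longrightarrow> V \<in> Grass a \<Longrightarrow> AE L in nu b. dim (V \<inter> L) = 0"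
proof (induction a arbitrary: V)
  case 0
  then have "dim V = 0" by (simp add: GrassD)
  then have "dim (V \<inter> L) = 0" for L using dim_subset[of "V \<inter> L" V] by (metis Int_lower1 le_zero_eq)
  then show ?case by simp
next
  case (Suc a)
  let ?n = "CARD('n)"
  interpret prob_space "nu b :: (real^'n) set measure" by (rule nu_spec[OF n(1,2)])
  interpret pair_sigma_finite "nu b :: (real^'n) set measure" "lborel :: (real^'n) measure" ..
  obtain V0 :: "(real^'n) set" where V0: "V0 \<in> Grass a" using Grass_exists[of a, where 'n = 'n] Suc.prems by auto
  have sV: "subspace V0" "dim V0 = a" using V0 GrassD by auto
  let ?W = "\<lambda>v. span (insert v V0)"
  have IH: "AE L in nu b. dim (V0 \<inter> L) = 0" using Suc V0 by simp
  have "AE L in nu b. AE v in lborel. dim (?W v \<inter> L) = 0"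
    using IH AE_space
  proof eventually_elim
    fix L :: "(real^'n) set" assume L0: "dim (V0 \<inter> L) = 0" and "L \<in> space (nu b)"
    then have L: "subspace L" "dim L = b" using GrassD by (auto simp: space_nu[OF n(1,2)])
    have z: "V0 \<inter> L = {0}" using L0 sV(1) L(1) subspace_0 by (auto simp: dim_eq_0)
    let ?S = "{x + y |x y. x \<in> V0 \<and> y \<in> L}"
    have "dim ?S = a + b" using dim_sums_Int[OF sV(1) L(1)] L0 sV L by simp
    then have "AE v in lborel. v \<notin> ?S" using Suc.prems by (intro AE_lborel_not_in_lowdim) simp
    then show "AE v in lborel. dim (?W v \<inter> L) = 0"
    proof eventually_elim
      fix v assume v: "v \<notin> ?S"
      have "u = 0" if u: "u \<in> ?W v" "u \<in> L" for u
      proof -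
        obtain c where c: "u - c *\<^sub>R v \<in> span V0" using u(1) by (auto simp: span_insert)
        then have uV: "u - c *\<^sub>R v \<in> V0" using sV(1) by (simp add: span_eq_iff[THEN iffD2])
        have "c = 0"
        proof (rule ccontr)
          assume "c \<noteq> 0"
          then have "v = (- inverse c) *\<^sub>R (u - c *\<^sub>R v) + inverse c *\<^sub>R u" by (simp add: algebra_simps)
          moreover have "(- inverse c) *\<^sub>R (u - c *\<^sub>R v) \<in> V0" "inverse c *\<^sub>R u \<in> L"
            using uV u(2) sV(1) L(1) subspace_scale by blast+
          ultimately show False using v by blast
        qed
        then show ?thesis using uV u(2) z by auto
      qed
      then show "dim (?W v \<inter> L) = 0" by (auto simp: dim_eq_0)
    qed
  qed
  moreover have "{p \<in> space (nu b \<Otimes>\<^sub>M (lborel :: (real^'n) measure)). dim (?W (snd p) \<inter> fst p) = 0} \<in> sets (nu b \<Otimes>\<^sub>M lborel)"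
  proof (rule measurable_dim_Int)
    have [measurable]: "(\<lambda>x. proj V0 x) \<in> borel_measurable borel"
      by (rule measurable_proj_joint) (use sV in auto)
    fix y :: "real^'n"
    show "(\<lambda>p. infdist y (?W (snd p))) \<in> borel_measurable (nu b \<Otimes>\<^sub>M (lborel :: (real^'n) measure))"
      unfolding infdist_subspace[OF subspace_span] proj_insert[OF sV(1)] by measurable
    have "(\<lambda>L. L) \<in> measurable (nu b) (set_sigma (Grass b :: (real^'n) set set))"
      by (simp add: measurable_cong_sets[OF nu_spec(1)[OF n(1,2)] refl])
    from measurable_infdist_comp[OF measurable_compose[OF measurable_fst this]]
    show "(\<lambda>p. infdist y (fst p)) \<in> borel_measurable (nu b \<Otimes>\<^sub>M (lborel :: (real^'n) measure))" .
  qed (auto simp: space_pair_measure space_nu[OF n(1,2)] GrassD)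
  ultimately have "AE v in lborel. AE L in nu b. dim (?W v \<inter> L) = 0"
    using AE_commute[of "\<lambda>L v. dim (?W v \<inter> L) = 0"] by simp
  moreover have "AE v in lborel. v \<notin> V0" using Suc.prems sV by (intro AE_lborel_not_in_lowdim) simp
  ultimately have "AE v in lborel. v \<notin> V0 \<and> (AE L in nu b. dim (?W v \<inter> L) = 0)" by eventually_elim simp
  \<comment> \<open>A condition valid almost everywhere has a witness, because Lebesgue measure is
    not zero.\<close>
  then have "\<exists>v. v \<notin> V0 \<and> (AE L in nu b. dim (?W v \<inter> L) = 0)"
  proof (rule contrapos_pp)
    assume "\<not> (\<exists>v. v \<notin> V0 \<and> (AE L in nu b. dim (?W v \<inter> L) = 0))"
    then have "(AE v in lborel. v \<notin> V0 \<and> (AE L in nu b. dim (?W v \<inter> L) = 0)) \<longleftrightarrow> (AE v in (lborel :: (real^'n) measure). False)"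
      by (intro AE_cong) auto
    then show "\<not> (AE v in lborel. v \<notin> V0 \<and> (AE L in nu b. dim (?W v \<inter> L) = 0))"
      by (simp add: trivial_limit_def[symmetric] ae_filter_eq_bot_iff)
  qed
  then obtain v where v: "v \<notin> V0" "AE L in nu b. dim (?W v \<inter> L) = 0" by blast
  have "?W v \<in> Grass (Suc a)"
    using v(1) sV by (simp add: Grass_def dim_insert span_eq_iff[THEN iffD2])
  then show ?case using nu_dim_Int_rotation[of b "Suc a" "?W v" V 0] n Suc.prems v(2) by auto
qed

text \<open>The dimension formula gives at least \<open>e\<close>. For the converse, a subspace
  \<open>?V\<close> of \<open>W\<close> of dimension complementary to that of \<open>L\<close> meets
  \<open>L\<close> trivially almost surely, and inside \<open>W\<close> it leaves at most
  \<open>e\<close> dimensions for \<open>W \<inter> L\<close>.\<close>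

lemma transversal:
  fixes W :: "(real^'n) set"
  assumes n: "CARD('n) \<ge> 2" "b < CARD('n)" "0 < b" and W: "W \<in> Grass d" and d: "d + b = CARD('n) + e"
  shows "AE L in nu b. dim (W \<inter> L) = e"
proof -
  let ?a = "CARD('n) - b"
  have sW: "subspace W" "dim W = d" using W GrassD by auto
  have ad: "?a \<le> d" using d n by simp
  obtain c where c: "ons c d" "span (c ` {..<d}) = W" using ons_exists[OF sW(1)] sW(2) by metis
  let ?V = "span (c ` {..<?a})"
  have V: "?V \<in> Grass ?a" using ons_dim[of c ?a] ons_mono[OF c(1) ad] by (auto simp: Grass_def)
  have VW: "?V \<subseteq> W" unfolding c(2)[symmetric] using ad by (intro span_mono image_mono) auto
  have "AE L in nu b. dim (?V \<inter> L) = 0" using transversal_complement[OF n _ V] n by simp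
  then show ?thesis using AE_space
  proof eventually_elim
    fix L :: "(real^'n) set" assume 0: "dim (?V \<inter> L) = 0" and "L \<in> space (nu b)"
    then have L: "subspace L" "dim L = b" using GrassD by (auto simp: space_nu[OF n(1,2)])
    have "dim {x + y |x y. x \<in> W \<and> y \<in> L} \<le> CARD('n)" using dim_subset_UNIV[of "{x + y |x y. x \<in> W \<and> y \<in> L}"] by simp
    then have ge: "e \<le> dim (W \<inter> L)" using dim_sums_Int[OF sW(1) L(1)] sW L d by simp
    have sWL: "subspace (W \<inter> L)" using sW L subspace_inter by blast
    have "?V \<inter> (W \<inter> L) = ?V \<inter> L" using VW by blast
    then have "dim {x + y |x y. x \<in> ?V \<and> y \<in> W \<inter> L} = ?a + dim (W \<inter> L)"
      using dim_sums_Int[OF subspace_span sWL, of "c ` {..<?a}"] 0 V by (simp add: Grass_def)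
    moreover have "dim {x + y |x y. x \<in> ?V \<and> y \<in> W \<inter> L} \<le> dim W"
      by (rule dim_subset) (use VW sW(1) in \<open>auto intro: subspace_add\<close>)
    ultimately have "dim (W \<inter> L) \<le> e" using sW d n by simp
    then show "dim (W \<inter> L) = e" using ge by simp
  qed
qed

subsection \<open>Averaging over rotations\<close>

text \<open>A measurable choice of one flat for each distance. Through it, functions that are
  constant on rotation orbits become Borel functions of the distance.\<close>

lemma flat_section:
  assumes "k < CARD('n)"
  obtains F :: "real \<Rightarrow> (real^'n) set" where "\<And>r. F r \<in> AffGrass k" "\<And>r. infdist 0 (F r) = \<bar>r\<bar>"
    "F \<in> measurable borel (set_sigma (AffGrass k))"
proof -
  obtain L :: "(real^'n) set" where L: "L \<in> Grass k" using Grass_exists[of k, where 'n = 'n] assms by auto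
  have sL: "subspace L" "dim L = k" using L GrassD by auto
  obtain u where u: "norm u = 1" "u \<in> orthogonal_comp L"
    using unit_vector_orthogonal_comp[of 0 L] sL assms subspace_0[OF subspace_orthogonal_comp, of L] by auto
  show thesis
  proof
    show "(\<lambda>y. y + r *\<^sub>R u) ` L \<in> AffGrass k" for r using L by (rule translate_AffGrass)
    show "infdist 0 ((\<lambda>y. y + r *\<^sub>R u) ` L) = \<bar>r\<bar>" for r
      using u by (simp add: infdist_0_translate sL subspace_scale[OF subspace_orthogonal_comp])
    show "(\<lambda>r. (\<lambda>y. y + r *\<^sub>R u) ` L) \<in> measurable borel (set_sigma (AffGrass k))"
      by (rule measurable_translate) (use L in auto)
  qed
qed

lemma haar_average:
  fixes g :: "(real^'n) set \<Rightarrow> ennreal"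
  assumes n: "CARD('n) \<ge> 2" "k < CARD('n)" and g: "g \<in> borel_measurable (set_sigma (AffGrass k))"
  obtains \<phi> where "\<phi> \<in> borel_measurable borel"
    "\<And>E. E \<in> AffGrass k \<Longrightarrow> (\<integral>\<^sup>+M. g ((*v) M ` E) \<partial>haar) = \<phi> (infdist 0 E)"
proof -
  interpret H: prob_space "haar :: (real^'n^'n) measure" by (rule haar_spec)
  obtain F :: "real \<Rightarrow> (real^'n) set" where F: "\<And>r. F r \<in> AffGrass k" "\<And>r. infdist 0 (F r) = \<bar>r\<bar>"
    "F \<in> measurable borel (set_sigma (AffGrass k))" by (rule flat_section[OF n(2)]) blast
  show thesis
  proof (rule that[of "\<lambda>r. \<integral>\<^sup>+M. g ((*v) M ` F r) \<partial>haar"])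
    have "(\<lambda>p. (*v) (snd p) ` F (fst p)) \<in> measurable (borel \<Otimes>\<^sub>M haar) (set_sigma (AffGrass k))"
      by (rule measurable_action_AffGrass[OF measurable_snd measurable_compose[OF measurable_fst F(3)]])
    from measurable_compose[OF this g]
    show "(\<lambda>r. \<integral>\<^sup>+M. g ((*v) M ` F r) \<partial>haar) \<in> borel_measurable borel"
      by (intro H.borel_measurable_nn_integral) (simp add: case_prod_beta')
    fix E :: "(real^'n) set" assume E: "E \<in> AffGrass k"
    show "(\<integral>\<^sup>+M. g ((*v) M ` E) \<partial>haar) = (\<integral>\<^sup>+M. g ((*v) M ` F (infdist 0 E)) \<partial>haar)"
      by (rule haar_orbit_AffGrass[OF n E F(1) _ _ _ g]) (simp_all add: F(2) infdist_nonneg SO_image_AffGrass E)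
  qed
qed

text \<open>Rotation invariance of \<open>mu\<close> replaces \<open>g\<close> by its orbit average,
  and the weight is unaffected because it depends on the distance alone. What remains is a radial
  integral.\<close>

lemma nn_integral_mu_average:
  fixes g :: "(real^'n) set \<Rightarrow> ennreal"
  assumes n: "CARD('n) \<ge> 2" "k < CARD('n)" and g: "g \<in> borel_measurable (set_sigma (AffGrass k))"
    and w: "w \<in> borel_measurable borel" and \<phi>: "\<phi> \<in> borel_measurable borel"
    and av: "\<And>E. E \<in> AffGrass k \<Longrightarrow> (\<integral>\<^sup>+M. g ((*v) M ` E) \<partial>haar) = \<phi> (infdist 0 E)"
  shows "(\<integral>\<^sup>+E. g E * w (infdist 0 E) \<partial>mu k) = (\<integral>\<^sup>+r. \<phi> r * w r * rad (CARD('n) - k) r \<partial>lborel)"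
proof -
  note w[measurable] \<phi>[measurable]
  interpret H: prob_space "haar :: (real^'n^'n) measure" by (rule haar_spec)
  interpret Mu: sigma_finite_measure "mu k :: (real^'n) set measure" by (rule sigma_finite_mu[OF n])
  interpret P: pair_sigma_finite "haar :: (real^'n^'n) measure" "mu k :: (real^'n) set measure" ..
  have d[measurable]: "(\<lambda>E. infdist 0 E) \<in> borel_measurable (set_sigma (AffGrass k :: (real^'n) set set))"
    by (rule measurable_infdist_set_sigma)
  have gw: "(\<lambda>E. g E * w (infdist 0 E)) \<in> borel_measurable (set_sigma (AffGrass k))"
    using g by measurable
  have id: "(\<lambda>E. E) \<in> measurable (mu k) (set_sigma (AffGrass k :: (real^'n) set set))"
    by (simp add: measurable_cong_sets[OF sets_mu[OF n] refl])
  have act: "(\<lambda>p. (*v) (fst p) ` snd p) \<in> measurable (haar \<Otimes>\<^sub>M mu k) (set_sigma (AffGrass k :: (real^'n) set set))"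
    by (rule measurable_action_AffGrass[OF measurable_fst measurable_compose[OF measurable_snd id]])
  have gm: "(\<lambda>E. g ((*v) M ` E)) \<in> borel_measurable (mu k)" "(\<lambda>M. g ((*v) M ` E)) \<in> borel_measurable haar"
    if "M \<in> SO" "E \<in> AffGrass k" for M E
    using measurable_compose[OF measurable_action_AffGrass[of "\<lambda>_. M" "mu k" "\<lambda>E. E"] g]
      measurable_compose[OF measurable_action_AffGrass[of "\<lambda>M. M" haar "\<lambda>_. E"] g] id that by auto
  have "(\<integral>\<^sup>+E. g E * w (infdist 0 E) \<partial>mu k) = (\<integral>\<^sup>+M. \<integral>\<^sup>+E. g ((*v) M ` E) * w (infdist 0 E) \<partial>mu k \<partial>haar)"
  proof (subst nn_integral_haar_const[of "\<integral>\<^sup>+E. g E * w (infdist 0 E) \<partial>mu k", symmetric], rule nn_integral_cong)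
    fix M :: "real^'n^'n" assume "M \<in> space haar"
    then have M: "M \<in> SO" by simp
    show "(\<integral>\<^sup>+E. g E * w (infdist 0 E) \<partial>mu k) = (\<integral>\<^sup>+E. g ((*v) M ` E) * w (infdist 0 E) \<partial>mu k)"
      unfolding mu_invariant[OF n M gw, symmetric] infdist_0_rotation[OF SO_rotation[OF M]] ..
  qed
  also have "\<dots> = (\<integral>\<^sup>+E. \<integral>\<^sup>+M. g ((*v) M ` E) * w (infdist 0 E) \<partial>haar \<partial>mu k)"
    by (rule P.Fubini'[symmetric])
      (use measurable_compose[OF act g] measurable_compose[OF measurable_compose[OF measurable_snd id] measurable_compose[OF d w]] in
        \<open>auto simp: case_prod_beta' intro!: borel_measurable_times_ennreal\<close>)
  also have "\<dots> = (\<integral>\<^sup>+E. \<phi> (infdist 0 E) * w (infdist (0::real^'n) E) \<partial>mu k)"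
  proof (rule nn_integral_cong)
    fix E :: "(real^'n) set" assume "E \<in> space (mu k)"
    then have E: "E \<in> AffGrass k" by (simp add: space_mu[OF n])
    show "(\<integral>\<^sup>+M. g ((*v) M ` E) * w (infdist 0 E) \<partial>haar) = \<phi> (infdist 0 E) * w (infdist 0 E)"
      by (subst nn_integral_multc[OF gm(2)[OF SO_1 E]]) (simp add: av[OF E])
  qed
  also have "\<dots> = (\<integral>\<^sup>+r. \<phi> r * w r * rad (CARD('n) - k) r \<partial>lborel)"
    by (rule nn_integral_mu_radial[OF n]) measurable
  finally show ?thesis .
qed

subsection \<open>Sections of flats with subspaces in general position\<close>

text \<open>Outside general position the intersection may be empty or of the wrong dimension, and
  then lies outside the domain on which \<open>f\<close> is controlled. The value 0 there keeps the
  expression jointly measurable and concerns only a null set of pairs.\<close>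

definition meet :: "nat \<Rightarrow> ('a::euclidean_space set \<Rightarrow> ennreal) \<Rightarrow> 'a set \<Rightarrow> 'a set \<Rightarrow> ennreal" where
  "meet g f E L = (if dim (direction E \<inter> L) = g then f (E \<inter> L) else 0)"

text \<open>On the measurable set of pairs in general position the intersections are nonempty, so
  \<open>measurable_infdist_Int\<close> applies there; elsewhere the value is constant.\<close>

lemma measurable_meet:
  fixes F :: "'b \<Rightarrow> (real^'n) set"
  assumes F: "F \<in> measurable M (set_sigma (AffGrass j))" and L: "L \<in> measurable M (set_sigma (Grass q))"
    and f: "f \<in> borel_measurable (set_sigma (AffGrass g))" and jq: "j + q = CARD('n) + g"
  shows "(\<lambda>\<omega>. meet g f (F \<omega>) (L \<omega>)) \<in> borel_measurable M"
proof -
  have FL: "F \<omega> \<in> AffGrass j" "L \<omega> \<in> Grass q" if "\<omega> \<in> space M" for \<omega>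
    using measurable_space[OF F that] measurable_space[OF L that] by auto
  let ?G = "{\<omega>\<in>space M. dim (direction (F \<omega>) \<inter> L \<omega>) = g}"
  have G: "?G \<in> sets M"
    by (rule measurable_dim_Int[OF measurable_direction[OF F] measurable_infdist_comp[OF L]])
      (use FL direction_AffGrass GrassD(1) in blast)
  let ?M = "restrict_space M {\<omega>. dim (direction (F \<omega>) \<inter> L \<omega>) = g}"
  have sp: "space ?M = ?G" by (auto simp: space_restrict_space)
  have "(\<lambda>\<omega>. F \<omega> \<inter> L \<omega>) \<in> measurable ?M (set_sigma (AffGrass g))"
  proof (rule measurable_set_sigma)
    fix \<omega> assume "\<omega> \<in> space ?M"
    then show "F \<omega> \<inter> L \<omega> \<in> AffGrass g" unfolding sp using FL Int_AffGrass(1) jq by blast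
  next
    fix x
    show "(\<lambda>\<omega>. infdist x (F \<omega> \<inter> L \<omega>)) \<in> borel_measurable ?M"
    proof (rule measurable_infdist_Int)
      fix \<omega> assume "\<omega> \<in> space ?M"
      then have w: "\<omega> \<in> space M" "dim (direction (F \<omega>) \<inter> L \<omega>) = g" unfolding sp by auto
      show "closed (F \<omega>) \<and> closed (L \<omega>)"
        using FL[OF w(1)] closed_AffGrass closed_subspace GrassD(1) by blast
      show "F \<omega> \<inter> L \<omega> \<noteq> {}" using FL[OF w(1)] Int_AffGrass(2) w(2) jq by blast
    qed (rule measurable_restrict_space1, rule measurable_infdist_comp, rule F,
        rule measurable_restrict_space1, rule measurable_infdist_comp, rule L)
  qed
  from measurable_compose[OF this f]
  have "(\<lambda>\<omega>. f (F \<omega> \<inter> L \<omega>)) \<in> borel_measurable ?M" .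
  then show ?thesis unfolding meet_def
    using G by (subst measurable_If_restrict_space_iff) (auto simp: pred_def)
qed

lemma meet_rotation:
  fixes E :: "(real^'n) set"
  assumes M: "M \<in> SO"
  shows "meet g f ((*v) M ` E) ((*v) M ` L) = meet g (\<lambda>E. f ((*v) M ` E)) E L"
proof -
  have ot: "orthogonal_transformation ((*v) M)" using M SO_orthogonal by blast
  have lin: "linear ((*v) M)" and inj: "inj ((*v) M)"
    using ot orthogonal_transformation_linear orthogonal_transformation_inj by blast+
  have i: "(*v) M ` A \<inter> (*v) M ` B = (*v) M ` (A \<inter> B)" for A B using inj by (rule image_Int[symmetric])
  show ?thesis unfolding meet_def direction_linear_image[OF lin] i
    using lin inj by (simp add: dim_image_eq inj_on_subset)
qed

text \<open>General position depends only on the direction of \<open>E\<close>, so the claim reduces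
  to \<open>transversal\<close> with the roles exchanged: \<open>L\<close> is fixed and the
  direction is random.\<close>

lemma AE_mu_transversal:
  fixes L :: "(real^'n) set"
  assumes n: "CARD('n) \<ge> 2" "j < CARD('n)" "0 < j" and L: "L \<in> Grass q" and jq: "j + q = CARD('n) + g"
  shows "AE E in mu j. dim (direction E \<inter> L) = g"
proof -
  let ?S = "{E\<in>space (set_sigma (AffGrass j)). dim (direction E \<inter> L) = g}"
  have S: "?S \<in> sets (set_sigma (AffGrass j))"
    by (rule measurable_dim_Int[OF measurable_direction[where k = j]])
      (use L direction_AffGrass[of _ j] GrassD(1) in \<open>auto\<close>)
  let ?f = "\<lambda>E. indicator (space (set_sigma (AffGrass j)) - ?S) E :: ennreal"
  have f: "?f \<in> borel_measurable (set_sigma (AffGrass j))" by (intro borel_measurable_indicator sets.compl_sets S)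
  have "(\<integral>\<^sup>+E. ?f E \<partial>mu j) = (\<integral>\<^sup>+K. \<integral>\<^sup>+x. ?f ((\<lambda>y. y + x) ` K) * gw (norm (proj K x)) \<partial>lborel \<partial>nu j)"
    by (rule nn_integral_mu[OF n(1,2) f])
  also have "\<dots> = (\<integral>\<^sup>+K. 0 \<partial>(nu j :: (real^'n) set measure))"
  proof (rule nn_integral_cong_AE)
    have "AE K in nu j. dim (L \<inter> K) = g" by (rule transversal[OF n L]) (use jq in simp)
    then show "AE K in nu j. (\<integral>\<^sup>+x. ?f ((\<lambda>y. y + x) ` K) * gw (norm (proj K x)) \<partial>lborel) = 0"
      using AE_space
    proof eventually_elim
      fix K assume K: "dim (L \<inter> K) = g" and "K \<in> space (nu j)"
      then have "K \<in> Grass j" by (simp add: space_nu[OF n(1,2)])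
      then have "?f ((\<lambda>y. y + x) ` K) = 0" for x
        using K by (auto simp: indicator_def direction_translate GrassD(1) Int_commute)
      then show "(\<integral>\<^sup>+x. ?f ((\<lambda>y. y + x) ` K) * gw (norm (proj K x)) \<partial>lborel) = 0" by simp
    qed
  qed
  finally have "(\<integral>\<^sup>+E. ?f E \<partial>mu j) = 0" by simp
  moreover have "?f \<in> borel_measurable (mu j)" using f by (simp add: measurable_cong_sets[OF sets_mu[OF n(1,2)] refl])
  ultimately have "AE E in mu j. ?f E = 0" by (subst (asm) nn_integral_0_iff_AE)
  then show ?thesis using AE_space
    by eventually_elim (auto simp: indicator_def space_mu[OF n(1,2)] split: if_splits)
qed

lemma slice_eq_translate:
  fixes W :: "'a::euclidean_space set"
  assumes W: "subspace W" and v: "v \<in> W" "v \<noteq> 0"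
  shows "{y\<in>W. y \<bullet> v = c} = (\<lambda>y. y + (c / (v \<bullet> v)) *\<^sub>R v) ` {y\<in>W. y \<bullet> v = 0}"
proof -
  let ?x = "(c / (v \<bullet> v)) *\<^sub>R v"
  have xW: "?x \<in> W" using W v by (simp add: subspace_scale)
  have xv: "?x \<bullet> v = c" using v by simp
  show ?thesis
  proof (intro equalityI subsetI)
    fix y assume y: "y \<in> {y\<in>W. y \<bullet> v = c}"
    then have "y - ?x \<in> {y\<in>W. y \<bullet> v = 0}" using xW xv W by (simp add: subspace_diff inner_diff_left)
    then show "y \<in> (\<lambda>y. y + ?x) ` {y\<in>W. y \<bullet> v = 0}" by (rule image_eqI[rotated]) simp
  next
    fix y assume "y \<in> (\<lambda>y. y + ?x) ` {y\<in>W. y \<bullet> v = 0}"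
    then show "y \<in> {y\<in>W. y \<bullet> v = c}" using xW xv W by (auto simp: subspace_add inner_add_left)
  qed
qed

text \<open>In the equation \<open>y \<bullet> v = s * norm v\<close> the normal vector
  \<open>v\<close> need not be normalised. Intersecting with \<open>L\<close> gives a slice of
  \<open>W \<inter> L\<close> by the same equation, and its distance is \<open>s\<close> divided by
  the relative length of the projection of \<open>v\<close>.\<close>

lemma infdist_meet_slice:
  fixes W L :: "'a::euclidean_space set"
  assumes W: "subspace W" and L: "subspace L" and s: "s > 0" and v: "v \<in> W" "proj (W \<inter> L) v \<noteq> 0"
    and d: "dim (W \<inter> L) = Suc g"
  shows "meet g (\<lambda>F. \<phi> (infdist 0 F)) {y\<in>W. y \<bullet> v = s * norm v} L
    = \<phi> (s / (norm (proj (W \<inter> L) v) / norm v))"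
proof -
  let ?X = "W \<inter> L" and ?E = "{y\<in>W. y \<bullet> v = s * norm v}"
  have X: "subspace ?X" using W L subspace_inter by blast
  have v0: "v \<noteq> 0" using v(2) proj_id[OF X, of 0] subspace_0[OF X] by auto
  have "direction ?E = {y\<in>W. y \<bullet> v = 0}"
    unfolding slice_eq_translate[OF W v(1) v0, of "s * norm v"]
    by (rule direction_translate[OF subspace_slice[OF W]])
  then have "direction ?E \<inter> L = {y\<in>?X. y \<bullet> v = 0}" by auto
  then have "dim (direction ?E \<inter> L) = g" using dim_slice[OF X v(2)] d by simp
  moreover have "infdist 0 (?E \<inter> L) = s / (norm (proj ?X v) / norm v)"
  proof -
    have "?E \<inter> L = {y\<in>?X. y \<bullet> v = s * norm v}" by auto
    then have "infdist 0 (?E \<inter> L) = sqrt ((infdist 0 ?X)\<^sup>2 + ((s * norm v - 0 \<bullet> proj ?X v) / norm (proj ?X v))\<^sup>2)"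
      by (simp only: infdist_slice[OF X v(2)])
    also have "\<dots> = s * norm v / norm (proj ?X v)" using s subspace_0[OF X] by simp
    finally show ?thesis by simp
  qed
  ultimately show ?thesis by (simp add: meet_def)
qed

lemma slice_AffGrass:
  fixes W :: "(real^'n) set"
  assumes W: "W \<in> Grass (Suc j)" and v: "v \<in> W" "v \<noteq> 0" and s: "s > 0"
  shows "{y\<in>W. y \<bullet> v = s * norm v} \<in> AffGrass j" "infdist 0 {y\<in>W. y \<bullet> v = s * norm v} = s"
proof -
  have sW: "subspace W" "dim W = Suc j" using W GrassD by auto
  have pv: "proj W v = v" using sW(1) v(1) by (rule proj_id)
  have "{y\<in>W. y \<bullet> v = 0} \<in> Grass j"
    using dim_slice[OF sW(1), of v] subspace_slice[OF sW(1)] v pv sW by (simp add: Grass_def)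
  then show "{y\<in>W. y \<bullet> v = s * norm v} \<in> AffGrass j"
    unfolding slice_eq_translate[OF sW(1) v, of "s * norm v"] by (rule translate_AffGrass)
  have "infdist 0 {y\<in>W. y \<bullet> v = s * norm v} = sqrt ((infdist 0 W)\<^sup>2 + ((s * norm v - 0 \<bullet> proj W v) / norm (proj W v))\<^sup>2)"
    by (rule infdist_slice[OF sW(1)]) (use pv v in simp)
  then show "infdist 0 {y\<in>W. y \<bullet> v = s * norm v} = s" using s v subspace_0[OF sW(1)] by (simp add: pv)
qed

text \<open>Rotation invariance allows to replace \<open>E\<close> by the flats at the same distance from the origin
  inside a fixed subspace \<open>W\<close> of one dimension more, and to average over their normal vectors \<open>v\<close>;
  for fixed \<open>L\<close> the distance of \<open>E \<inter> L\<close> is then governed by the projection of \<open>v\<close> onto \<open>W \<inter> L\<close>.\<close>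

lemma nn_integral_nu_meet:
  fixes E :: "(real^'n) set"
  assumes n: "CARD('n) \<ge> 2" "q < CARD('n)" "g < q" and jq: "j + q = CARD('n) + g"
    and E: "E \<in> AffGrass j" and s: "infdist 0 E > 0" and \<phi>[measurable]: "\<phi> \<in> borel_measurable borel"
  shows "(\<integral>\<^sup>+L. meet g (\<lambda>F. \<phi> (infdist 0 F)) E L \<partial>nu q)
    = ennreal (omega (Suc g) * omega (CARD('n) - q) / omega (Suc g + (CARD('n) - q)))
      * (\<integral>\<^sup>+z. \<phi> (infdist 0 E / z) * beta_w (Suc g) (CARD('n) - q) z \<partial>lborel)"
proof -
  let ?s = "infdist 0 E" and ?m = "CARD('n) - q"
  let ?f = "\<lambda>F :: (real^'n) set. \<phi> (infdist 0 F)"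
  let ?K = "ennreal (omega (Suc g) * omega ?m / omega (Suc g + ?m))
      * (\<integral>\<^sup>+z. \<phi> (?s / z) * beta_w (Suc g) ?m z \<partial>lborel)"
  let ?r = "\<lambda>X v. \<phi> (?s / (norm (proj X v) / norm v))"
  have j: "j < CARD('n)" "Suc j \<le> CARD('n)" "Suc j = Suc g + ?m" using n jq by auto
  interpret nu: prob_space "nu q :: (real^'n) set measure" by (rule nu_spec[OF n(1,2)])
  interpret P: pair_sigma_finite "lborel :: (real^'n) measure" "nu q :: (real^'n) set measure" ..
  have f: "?f \<in> borel_measurable (set_sigma (AffGrass g))"
    by (rule measurable_compose[OF measurable_infdist_set_sigma \<phi>])
  have idL: "(\<lambda>L. L) \<in> measurable (nu q) (set_sigma (Grass q :: (real^'n) set set))"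
    by (simp add: measurable_cong_sets[OF nu_spec(1)[OF n(1,2)] refl])
  define \<Psi> where "\<Psi> E = (\<integral>\<^sup>+L. meet g ?f E L \<partial>nu q)" for E
  have inv: "\<Psi> F = \<Psi> E" if F: "F \<in> AffGrass j" "infdist 0 F = ?s" for F
  proof -
    obtain R where R: "R \<in> rotations" "R ` E = F" using rotation_transitive[OF n(1) j(1) E F(1)] F(2) by metis
    let ?M = "matrix R"
    have M: "?M \<in> SO" "(*v) ?M ` E = F" using rotation_SO[OF R(1)] R(2) by auto
    have "\<Psi> F = (\<integral>\<^sup>+L. meet g ?f F ((*v) ?M ` L) \<partial>nu q)"
      unfolding \<Psi>_def
      by (rule nu_invariant[OF n(1,2) M(1), symmetric], rule measurable_meet[OF _ _ f jq]) (use F in auto)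
    also have "\<dots> = \<Psi> E"
      unfolding M(2)[symmetric] meet_rotation[OF M(1)] \<Psi>_def infdist_0_rotation[OF SO_rotation[OF M(1)]] ..
    finally show ?thesis .
  qed
  obtain W :: "(real^'n) set" where W: "W \<in> Grass (Suc j)" using Grass_exists[OF j(2)] .
  have sW: "subspace W" "dim W = Suc j" using W GrassD by auto
  \<comment> \<open>Where the normal vector degenerates, \<open>E\<close> itself is used, so that
    \<open>Ev v\<close> is a flat at the right distance for every \<open>v\<close>.\<close>
  define Ev where "Ev v = (if proj W v = 0 then E else {y\<in>W. y \<bullet> proj W v = ?s * norm (proj W v)})" for v
  have Ev: "Ev v \<in> AffGrass j" "infdist 0 (Ev v) = ?s" for v
    using slice_AffGrass[OF W proj_in[OF sW(1)] _ s, of v] E by (auto simp: Ev_def)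
  have pWm[measurable]: "(\<lambda>x. proj W x) \<in> borel_measurable borel"
    by (rule measurable_proj_joint) (use sW in auto)
  have Evm: "Ev \<in> measurable borel (set_sigma (AffGrass j))"
  proof (rule measurable_set_sigma)
    fix y
    have e: "infdist y (Ev v) = (if proj W v = 0 then infdist y E
      else sqrt ((infdist y W)\<^sup>2 + ((?s * norm (proj W v) - y \<bullet> proj W v) / norm (proj W v))\<^sup>2))" for v
      using infdist_slice[OF sW(1), of "proj W v" y "?s * norm (proj W v)"] proj_id[OF sW(1) proj_in[OF sW(1)], of v]
      by (simp add: Ev_def)
    show "(\<lambda>v. infdist y (Ev v)) \<in> borel_measurable borel" unfolding e by measurable
  qed (use Ev in auto)
  have Evp: "Ev (proj W v) = Ev v" for v by (simp add: Ev_def proj_id[OF sW(1) proj_in[OF sW(1)]])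
  have mm: "(\<lambda>v. meet g ?f (Ev v) L) \<in> borel_measurable borel" if "L \<in> Grass q" for L
    by (rule measurable_meet[OF Evm _ f jq]) (use that in auto)
  have mj: "(\<lambda>p. meet g ?f (Ev (fst p)) (snd p)) \<in> borel_measurable (lborel \<Otimes>\<^sub>M nu q)"
    by (rule measurable_meet[OF measurable_compose[OF measurable_fst] measurable_compose[OF measurable_snd idL] f jq])
      (use Evm in simp)
  \<comment> \<open>The Gaussian on the whole space, factored along \<open>W\<close> and its
    complement: the first factor makes the normal vector random in \<open>W\<close>, the second
    implements \<open>lebesgue_sub W\<close>.\<close>
  let ?w = "\<lambda>x. gw (norm (proj W x)) * gw (norm (x - proj W x))"
  have "\<Psi> E = (\<integral>\<^sup>+v. gw (norm v) \<partial>lebesgue_sub W) * \<Psi> E" by (simp add: nn_integral_gw_sub[OF sW(1)])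
  also have "\<dots> = (\<integral>\<^sup>+x. ?w x \<partial>lborel) * \<Psi> E"
    by (subst nn_integral_lebesgue_sub[OF sW(1)]) auto
  also have "\<dots> = (\<integral>\<^sup>+x. ?w x * \<Psi> (Ev x) \<partial>lborel)"
    by (subst nn_integral_multc[symmetric]) (auto simp: inv[OF Ev])
  also have "\<dots> = (\<integral>\<^sup>+x. \<integral>\<^sup>+L. ?w x * meet g ?f (Ev x) L \<partial>nu q \<partial>lborel)"
  proof (rule nn_integral_cong)
    fix x
    have "(\<lambda>L. meet g ?f (Ev x) L) \<in> borel_measurable (nu q)"
      by (rule measurable_meet[OF _ idL f jq]) (use Ev in auto)
    then show "?w x * \<Psi> (Ev x) = (\<integral>\<^sup>+L. ?w x * meet g ?f (Ev x) L \<partial>nu q)"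
      unfolding \<Psi>_def by (rule nn_integral_cmult[symmetric])
  qed
  also have "\<dots> = (\<integral>\<^sup>+L. \<integral>\<^sup>+x. ?w x * meet g ?f (Ev x) L \<partial>lborel \<partial>nu q)"
  proof (rule P.Fubini'[symmetric])
    have "(\<lambda>p. ?w (fst p)) \<in> borel_measurable (lborel \<Otimes>\<^sub>M (nu q :: (real^'n) set measure))" by measurable
    with mj show "(\<lambda>(x, L). ?w x * meet g ?f (Ev x) L) \<in> borel_measurable (lborel \<Otimes>\<^sub>M nu q)"
      unfolding case_prod_beta' by (rule borel_measurable_times_ennreal[rotated])
  qed
  also have "\<dots> = (\<integral>\<^sup>+L. ?K \<partial>(nu q :: (real^'n) set measure))"
  proof (rule nn_integral_cong_AE)
    have "AE L in nu q. dim (W \<inter> L) = Suc g" by (rule transversal[OF n(1,2) _ W]) (use n jq in auto)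
    then show "AE L in nu q. (\<integral>\<^sup>+x. ?w x * meet g ?f (Ev x) L \<partial>lborel)
      = ?K"
      using AE_space
    proof eventually_elim
      fix L assume dX: "dim (W \<inter> L) = Suc g" and "L \<in> space (nu q)"
      then have L: "L \<in> Grass q" by (simp add: space_nu[OF n(1,2)])
      then have sL: "subspace L" using GrassD by blast
      let ?X = "W \<inter> L"
      have sX: "subspace ?X" using sW(1) sL subspace_inter by blast
      have [measurable]: "(\<lambda>x. proj ?X x) \<in> borel_measurable borel"
        by (rule measurable_proj_joint) (use sX in auto)
      have pp: "proj ?X (proj W x) = proj ?X x" for x
      proof (rule proj_eqI[OF sX proj_in[OF sX]])
        fix u assume u: "u \<in> ?X"
        then have "proj ?X x \<bullet> u = x \<bullet> u" "proj W x \<bullet> u = x \<bullet> u"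
          using proj_inner[OF sX u] proj_inner[OF sW(1), of u] by auto
        then show "(proj W x - proj ?X x) \<bullet> u = 0" by (simp add: inner_diff_left)
      qed
      have "AE x in lborel. x \<notin> orthogonal_comp ?X"
        by (rule AE_lborel_not_in_lowdim) (use dX sX dim_subset_UNIV[of ?X] in \<open>simp add: dim_orthogonal_comp\<close>)
      then have AE: "AE x in lborel. proj ?X x \<noteq> 0"
      proof eventually_elim
        fix x assume x: "x \<notin> orthogonal_comp ?X"
        then obtain y where "y \<in> ?X" "x \<bullet> y \<noteq> 0" by (auto simp: orthogonal_comp_def orthogonal_def inner_commute)
        then show "proj ?X x \<noteq> 0" using proj_inner[OF sX, of y x] by auto
      qed
      have "(\<integral>\<^sup>+x. ?w x * meet g ?f (Ev x) L \<partial>lborel)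
        = (\<integral>\<^sup>+x. (gw (norm (proj W x)) * ?r ?X (proj W x)) * gw (norm (x - proj W x)) \<partial>lborel)"
        using AE
      proof (intro nn_integral_cong_AE, eventually_elim)
        fix x assume "proj ?X x \<noteq> 0"
        then have p0: "proj ?X (proj W x) \<noteq> 0" by (simp add: pp)
        then have "proj W x \<noteq> 0" using proj_id[OF sX subspace_0[OF sX]] by auto
        then have "meet g ?f (Ev x) L = ?r ?X (proj W x)"
          using infdist_meet_slice[OF sW(1) sL s proj_in[OF sW(1)] p0 dX, of \<phi>] by (simp add: Ev_def)
        then show "?w x * meet g ?f (Ev x) L
          = (gw (norm (proj W x)) * ?r ?X (proj W x)) * gw (norm (x - proj W x))"
          by (simp add: ac_simps)
      qed
      also have "\<dots> = (\<integral>\<^sup>+v. gw (norm v) * ?r ?X v \<partial>lebesgue_sub W)"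
        by (rule nn_integral_lebesgue_sub[OF sW(1), symmetric]) measurable
      also have "\<dots> = ?K"
        by (rule beta_law[OF sW(1) _ sX dX _ _ _, where h = "\<lambda>z. \<phi> (?s / z)"]) (use sW(2) j n in auto)
      finally show "(\<integral>\<^sup>+x. ?w x * meet g ?f (Ev x) L \<partial>lborel)
        = ?K" .
    qed
  qed
  also have "\<dots> = ?K"
    by (simp only: nn_integral_const nu.emeasure_space_1 mult_1_right)
  finally show ?thesis unfolding \<Psi>_def .
qed

subsection \<open>The intersection formula\<close>

text \<open>Applying one random rotation to both \<open>E\<close> and \<open>L\<close> preserves the
  product measure and the weight, and rotates \<open>E \<inter> L\<close>. Averaging thus replaces
  \<open>f\<close> by \<open>\<phi>\<close> of the distance of the intersection, after which the
  integral over \<open>L\<close> can be taken first.\<close>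

lemma nn_integral_meet_average:
  fixes f :: "(real^'n) set \<Rightarrow> ennreal"
  assumes n: "CARD('n) \<ge> 2" "q < CARD('n)" "g < q" and jq: "j + q = CARD('n) + g"
    and f: "f \<in> borel_measurable (set_sigma (AffGrass g))"
    and h[measurable]: "h \<in> borel_measurable borel" and \<phi>[measurable]: "\<phi> \<in> borel_measurable borel"
    and av: "\<And>E. E \<in> AffGrass g \<Longrightarrow> (\<integral>\<^sup>+M. f ((*v) M ` E) \<partial>haar) = \<phi> (infdist 0 E)"
  shows "(\<integral>\<^sup>+L. \<integral>\<^sup>+E. meet g f E L * h (infdist 0 E) \<partial>mu j \<partial>nu q)
    = (\<integral>\<^sup>+E. (\<integral>\<^sup>+L. meet g (\<lambda>F. \<phi> (infdist 0 F)) E L \<partial>nu q) * h (infdist (0::real^'n) E) \<partial>mu j)"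
proof -
  have j: "j < CARD('n)" using n jq by auto
  note nj = n(1) j and nq = n(1,2)
  interpret H: prob_space "haar :: (real^'n^'n) measure" by (rule haar_spec)
  interpret nu: prob_space "nu q :: (real^'n) set measure" by (rule nu_spec[OF nq])
  interpret Mu: sigma_finite_measure "mu j :: (real^'n) set measure" by (rule sigma_finite_mu[OF nj])
  interpret P: pair_sigma_finite "nu q :: (real^'n) set measure" "mu j :: (real^'n) set measure" ..
  let ?N = "nu q \<Otimes>\<^sub>M mu j :: ((real^'n) set \<times> (real^'n) set) measure"
  interpret Q: pair_sigma_finite "haar :: (real^'n^'n) measure" ?N ..
  let ?G = "\<lambda>L E. meet g f E L * h (infdist 0 E)"
  have idL: "(\<lambda>L. L) \<in> measurable (nu q) (set_sigma (Grass q :: (real^'n) set set))"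
    by (simp add: measurable_cong_sets[OF nu_spec(1)[OF nq] refl])
  have idE: "(\<lambda>E. E) \<in> measurable (mu j) (set_sigma (AffGrass j :: (real^'n) set set))"
    by (simp add: measurable_cong_sets[OF sets_mu[OF nj] refl])
  have G: "(\<lambda>\<omega>. meet g f' (F \<omega>) (L \<omega>) * h (infdist 0 (F \<omega>))) \<in> borel_measurable M"
    if "f' \<in> borel_measurable (set_sigma (AffGrass g))" "F \<in> measurable M (set_sigma (AffGrass j))"
      "L \<in> measurable M (set_sigma (Grass q))" for M :: "'x measure" and F L and f' :: "(real^'n) set \<Rightarrow> ennreal"
    by (intro borel_measurable_times_ennreal measurable_meet[OF that(2,3,1) jq]
        measurable_compose[OF measurable_infdist_comp[OF that(2)] h])
  have fE: "(\<lambda>p. snd p) \<in> measurable ?N (set_sigma (AffGrass j))"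
    by (rule measurable_compose[OF measurable_snd idE])
  have fL: "(\<lambda>p. fst p) \<in> measurable ?N (set_sigma (Grass q))"
    by (rule measurable_compose[OF measurable_fst idL])
  have f\<phi>: "(\<lambda>F :: (real^'n) set. \<phi> (infdist 0 F)) \<in> borel_measurable (set_sigma (AffGrass g))"
    by (rule measurable_compose[OF measurable_infdist_set_sigma \<phi>])
  have N: "(\<integral>\<^sup>+p. k (fst p) (snd p) \<partial>?N) = (\<integral>\<^sup>+L. \<integral>\<^sup>+E. k L E \<partial>mu j \<partial>nu q)"
    if "(\<lambda>p. k (fst p) (snd p)) \<in> borel_measurable ?N" for k :: "(real^'n) set \<Rightarrow> (real^'n) set \<Rightarrow> ennreal"
    using Mu.nn_integral_fst[OF that] by simp
  have inv: "(\<integral>\<^sup>+L. \<integral>\<^sup>+E. ?G L E \<partial>mu j \<partial>nu q) = (\<integral>\<^sup>+p. ?G ((*v) M ` fst p) ((*v) M ` snd p) \<partial>?N)"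
    if M: "M \<in> SO" for M :: "real^'n^'n"
  proof -
    have actL: "(\<lambda>\<omega>. (*v) M ` L \<omega>) \<in> measurable R (set_sigma (Grass q))"
      if "L \<in> measurable R (set_sigma (Grass q))" for L and R :: "'x measure"
      by (rule measurable_action_Grass[OF _ that]) (use M in auto)
    have actE: "(\<lambda>\<omega>. (*v) M ` F \<omega>) \<in> measurable R (set_sigma (AffGrass j))"
      if "F \<in> measurable R (set_sigma (AffGrass j))" for F and R :: "'x measure"
      by (rule measurable_action_AffGrass[OF _ that]) (use M in auto)
    have "(\<integral>\<^sup>+L. \<integral>\<^sup>+E. ?G L E \<partial>mu j \<partial>nu q) = (\<integral>\<^sup>+L. \<integral>\<^sup>+E. ?G ((*v) M ` L) E \<partial>mu j \<partial>nu q)"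
    proof (rule nu_invariant[OF nq M, symmetric])
      have "(\<lambda>(L, E). ?G L E) \<in> borel_measurable (set_sigma (Grass q) \<Otimes>\<^sub>M mu j)"
        unfolding case_prod_beta'
        by (rule G[OF f measurable_compose[OF measurable_snd idE] measurable_fst])
      then show "(\<lambda>L. \<integral>\<^sup>+E. ?G L E \<partial>mu j) \<in> borel_measurable (set_sigma (Grass q))"
        by (rule Mu.borel_measurable_nn_integral)
    qed
    also have "\<dots> = (\<integral>\<^sup>+L. \<integral>\<^sup>+E. ?G ((*v) M ` L) ((*v) M ` E) \<partial>mu j \<partial>nu q)"
    proof (rule nn_integral_cong)
      fix L :: "(real^'n) set" assume "L \<in> space (nu q)"
      then have L: "(*v) M ` L \<in> Grass q" using M by (simp add: space_nu[OF nq] SO_image_Grass)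
      show "(\<integral>\<^sup>+E. ?G ((*v) M ` L) E \<partial>mu j) = (\<integral>\<^sup>+E. ?G ((*v) M ` L) ((*v) M ` E) \<partial>mu j)"
        by (rule mu_invariant[OF nj M, symmetric], rule G[OF f]) (use L in auto)
    qed
    also have "\<dots> = (\<integral>\<^sup>+p. ?G ((*v) M ` fst p) ((*v) M ` snd p) \<partial>?N)"
      by (rule N[symmetric], rule G[OF f actE[OF fE] actL[OF fL]])
    finally show ?thesis .
  qed
  have "(\<integral>\<^sup>+L. \<integral>\<^sup>+E. ?G L E \<partial>mu j \<partial>nu q) = (\<integral>\<^sup>+M. \<integral>\<^sup>+p. ?G ((*v) M ` fst p) ((*v) M ` snd p) \<partial>?N \<partial>haar)"
    by (subst nn_integral_haar_const[of "\<integral>\<^sup>+L. \<integral>\<^sup>+E. ?G L E \<partial>mu j \<partial>nu q", symmetric], rule nn_integral_cong) (simp add: inv)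
  also have "\<dots> = (\<integral>\<^sup>+p. \<integral>\<^sup>+M. ?G ((*v) M ` fst p) ((*v) M ` snd p) \<partial>haar \<partial>?N)"
  proof (rule Q.Fubini'[symmetric])
    have "(\<lambda>\<omega>. ?G ((*v) (fst \<omega>) ` fst (snd \<omega>)) ((*v) (fst \<omega>) ` snd (snd \<omega>))) \<in> borel_measurable (haar \<Otimes>\<^sub>M ?N)"
      by (rule G[OF f measurable_action_AffGrass[OF measurable_fst measurable_compose[OF measurable_snd fE]]
            measurable_action_Grass[OF measurable_fst measurable_compose[OF measurable_snd fL]]])
    then show "(\<lambda>(M, p). ?G ((*v) M ` fst p) ((*v) M ` snd p)) \<in> borel_measurable (haar \<Otimes>\<^sub>M ?N)"
      by (simp add: case_prod_beta')
  qed
  also have "\<dots> = (\<integral>\<^sup>+p. meet g (\<lambda>F. \<phi> (infdist 0 F)) (snd p) (fst p) * h (infdist 0 (snd p)) \<partial>?N)"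
  proof (rule nn_integral_cong)
    fix p assume "p \<in> space ?N"
    then have p: "fst p \<in> Grass q" "snd p \<in> AffGrass j" by (auto simp: space_pair_measure space_nu[OF nq] space_mu[OF nj])
    have "(\<integral>\<^sup>+M. ?G ((*v) M ` fst p) ((*v) M ` snd p) \<partial>haar)
      = (\<integral>\<^sup>+M. meet g (\<lambda>E. f ((*v) M ` E)) (snd p) (fst p) * h (infdist 0 (snd p)) \<partial>haar)"
      by (rule nn_integral_cong) (simp add: meet_rotation infdist_0_rotation SO_rotation)
    also have "\<dots> = meet g (\<lambda>F. \<phi> (infdist 0 F)) (snd p) (fst p) * h (infdist 0 (snd p))"
    proof (cases "dim (direction (snd p) \<inter> fst p) = g")
      case True
      have I: "snd p \<inter> fst p \<in> AffGrass g" by (rule Int_AffGrass(1)[OF p(2,1) True jq])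
      have "(\<lambda>M. (*v) M ` (snd p \<inter> fst p)) \<in> measurable haar (set_sigma (AffGrass g))"
        by (rule measurable_action_AffGrass) (use I in auto)
      from measurable_compose[OF this f] show ?thesis
        by (simp add: meet_def True nn_integral_multc av[OF I])
    qed (simp add: meet_def)
    finally show "(\<integral>\<^sup>+M. ?G ((*v) M ` fst p) ((*v) M ` snd p) \<partial>haar)
      = meet g (\<lambda>F. \<phi> (infdist 0 F)) (snd p) (fst p) * h (infdist 0 (snd p))" .
  qed
  also have "\<dots> = (\<integral>\<^sup>+E. \<integral>\<^sup>+L. meet g (\<lambda>F. \<phi> (infdist 0 F)) E L * h (infdist (0::real^'n) E) \<partial>nu q \<partial>mu j)"
    using P.nn_integral_snd[of "\<lambda>p. meet g (\<lambda>F. \<phi> (infdist 0 F)) (snd p) (fst p) * h (infdist 0 (snd p))"] G[OF f\<phi> fE fL]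
    by simp
  also have "\<dots> = (\<integral>\<^sup>+E. (\<integral>\<^sup>+L. meet g (\<lambda>F. \<phi> (infdist 0 F)) E L \<partial>nu q) * h (infdist (0::real^'n) E) \<partial>mu j)"
  proof (rule nn_integral_cong)
    fix E :: "(real^'n) set" assume "E \<in> space (mu j)"
    then have "(\<lambda>L. meet g (\<lambda>F. \<phi> (infdist 0 F)) E L) \<in> borel_measurable (nu q)"
      by (intro measurable_meet[OF _ idL f\<phi> jq]) (simp add: space_mu[OF nj])
    then show "(\<integral>\<^sup>+L. meet g (\<lambda>F. \<phi> (infdist 0 F)) E L * h (infdist 0 E) \<partial>nu q)
      = (\<integral>\<^sup>+L. meet g (\<lambda>F. \<phi> (infdist 0 F)) E L \<partial>nu q) * h (infdist 0 E)"
      by (rule nn_integral_multc)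
  qed
  finally show ?thesis .
qed

text \<open>The radial density gives no mass to 0. Flats through the origin are set aside because
  \<open>nn_integral_nu_meet\<close> concerns positive distances.\<close>

lemma AE_mu_infdist_pos:
  assumes n: "CARD('n) \<ge> 2" "k < CARD('n)"
  shows "AE E in mu k. infdist (0::real^'n) E > 0"
proof -
  have "(\<integral>\<^sup>+E. indicator {0} (infdist (0::real^'n) E) \<partial>mu k) = (\<integral>\<^sup>+r. indicator {0} r * rad (CARD('n) - k) r \<partial>lborel)"
    by (rule nn_integral_mu_radial[OF n]) simp
  also have "\<dots> = (\<integral>\<^sup>+r. 0 \<partial>(lborel :: real measure))"
    by (rule nn_integral_cong) (simp add: rad_def indicator_def)
  finally have "(\<integral>\<^sup>+E. indicator {0} (infdist (0::real^'n) E) \<partial>mu k) = 0" by simp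
  moreover have "(\<lambda>E. indicator {0} (infdist (0::real^'n) E) :: ennreal) \<in> borel_measurable (mu k)"
    unfolding measurable_cong_sets[OF sets_mu[OF n] refl]
    by (rule measurable_compose[OF measurable_infdist_set_sigma]) simp
  ultimately have "AE E in mu k. indicator {0} (infdist (0::real^'n) E) = (0::ennreal)"
    by (subst (asm) nn_integral_0_iff_AE)
  then show ?thesis
    by eventually_elim (auto simp: indicator_def less_le infdist_nonneg split: if_splits)
qed

text \<open>\<open>JH\<close> for a nonnegative extended real weight, with the codimension
  \<open>m\<close> in place of a difference of dimensions and with the endpoints removed, so that it
  matches \<open>beta_w\<close>.\<close>

definition J :: "(real \<Rightarrow> ennreal) \<Rightarrow> nat \<Rightarrow> nat \<Rightarrow> real \<Rightarrow> ennreal" where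
  "J h m q r = (\<integral>\<^sup>+z. h (r * z) * ennreal (z ^ q * (1 - z\<^sup>2) powr (real m / 2 - 1)) * indicator {0<..<1} z \<partial>lborel)"

lemma J_measurable [measurable]:
  assumes [measurable]: "h \<in> borel_measurable borel"
  shows "J h m q \<in> borel_measurable borel"
  unfolding J_def by measurable

text \<open>The substitution \<open>s = r z\<close> in the inner integral.\<close>

lemma nn_integral_radial_meet:
  assumes k: "0 < k" and h[measurable]: "h \<in> borel_measurable borel" and \<phi>[measurable]: "\<phi> \<in> borel_measurable borel"
  shows "(\<integral>\<^sup>+s. (\<integral>\<^sup>+z. \<phi> (s / z) * beta_w (Suc g) m z \<partial>lborel) * h s * rad k s \<partial>lborel)
    = (\<integral>\<^sup>+r. \<phi> r * J h m (k + g) r * rad k r \<partial>lborel)"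
proof -
  have "(\<integral>\<^sup>+s. (\<integral>\<^sup>+z. \<phi> (s / z) * beta_w (Suc g) m z \<partial>lborel) * h s * rad k s \<partial>lborel)
    = (\<integral>\<^sup>+s. \<integral>\<^sup>+z. \<phi> (s / z) * beta_w (Suc g) m z * (h s * rad k s) \<partial>lborel \<partial>lborel)"
    by (intro nn_integral_cong) (subst mult.assoc, rule nn_integral_multc[symmetric], measurable)
  also have "\<dots> = (\<integral>\<^sup>+z. \<integral>\<^sup>+s. \<phi> (s / z) * beta_w (Suc g) m z * (h s * rad k s) \<partial>lborel \<partial>lborel)"
    by (rule lborel_pair.Fubini') measurable
  also have "\<dots> = (\<integral>\<^sup>+z. \<integral>\<^sup>+r. (\<phi> r * rad k r) * (h (r * z) * ennreal (z ^ (k + g) * (1 - z\<^sup>2) powr (real m / 2 - 1)) * indicator {0<..<1} z) \<partial>lborel \<partial>lborel)"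
  proof (rule nn_integral_cong)
    fix z :: real
    show "(\<integral>\<^sup>+s. \<phi> (s / z) * beta_w (Suc g) m z * (h s * rad k s) \<partial>lborel)
      = (\<integral>\<^sup>+r. (\<phi> r * rad k r) * (h (r * z) * ennreal (z ^ (k + g) * (1 - z\<^sup>2) powr (real m / 2 - 1)) * indicator {0<..<1} z) \<partial>lborel)"
    proof (cases "0 < z \<and> z < 1")
      case True
      have "(\<integral>\<^sup>+s. \<phi> (s / z) * beta_w (Suc g) m z * (h s * rad k s) \<partial>lborel)
        = (\<integral>\<^sup>+s. (\<phi> (s / z) * beta_w (Suc g) m z * h s * ennreal (omega k * s ^ (k - 1))) * indicator {0<..} s \<partial>lborel)"
        by (simp add: rad_def mult.assoc)
      also have "\<dots> = ennreal z * (\<integral>\<^sup>+r. (\<phi> (z * r / z) * beta_w (Suc g) m z * h (z * r) * ennreal (omega k * (z * r) ^ (k - 1))) * indicator {0<..} r \<partial>lborel)"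
        by (rule nn_integral_scale) (use True in auto)
      also have "\<dots> = (\<integral>\<^sup>+r. ennreal z * ((\<phi> (z * r / z) * beta_w (Suc g) m z * h (z * r) * ennreal (omega k * (z * r) ^ (k - 1))) * indicator {0<..} r) \<partial>lborel)"
        by (rule nn_integral_cmult[symmetric]) measurable
      also have "\<dots> = (\<integral>\<^sup>+r. (\<phi> r * rad k r) * (h (r * z) * ennreal (z ^ (k + g) * (1 - z\<^sup>2) powr (real m / 2 - 1)) * indicator {0<..<1} z) \<partial>lborel)"
      proof (rule nn_integral_cong)
        fix r :: real
        show "ennreal z * ((\<phi> (z * r / z) * beta_w (Suc g) m z * h (z * r) * ennreal (omega k * (z * r) ^ (k - 1))) * indicator {0<..} r)
          = (\<phi> r * rad k r) * (h (r * z) * ennreal (z ^ (k + g) * (1 - z\<^sup>2) powr (real m / 2 - 1)) * indicator {0<..<1} z)"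
        proof (cases "r > 0")
          case r: True
          let ?b = "(1 - z\<^sup>2) powr (real m / 2 - 1)"
          have pw: "z * (z ^ g * z ^ (k - 1)) = z ^ (k + g)" using k by (cases k) (simp_all add: power_add)
          have "ennreal z * (ennreal (z ^ g * ?b) * ennreal (omega k * (z * r) ^ (k - 1)))
            = ennreal (z * ((z ^ g * ?b) * (omega k * (z * r) ^ (k - 1))))"
            using True r omega_pos[OF k] by (simp add: ennreal_mult)
          also have "z * ((z ^ g * ?b) * (omega k * (z * r) ^ (k - 1))) = (omega k * r ^ (k - 1)) * ((z * (z ^ g * z ^ (k - 1))) * ?b)"
            by (simp add: power_mult_distrib)
          also have "ennreal \<dots> = ennreal (omega k * r ^ (k - 1)) * ennreal (z ^ (k + g) * ?b)"
            unfolding pw using True r omega_pos[OF k] by (intro ennreal_mult) auto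
          finally have e: "ennreal z * (ennreal (z ^ g * ?b) * ennreal (omega k * (z * r) ^ (k - 1)))
            = ennreal (omega k * r ^ (k - 1)) * ennreal (z ^ (k + g) * ?b)" .
          have "ennreal z * ((\<phi> (z * r / z) * beta_w (Suc g) m z * h (z * r) * ennreal (omega k * (z * r) ^ (k - 1))) * indicator {0<..} r)
            = \<phi> r * h (r * z) * (ennreal z * (ennreal (z ^ g * ?b) * ennreal (omega k * (z * r) ^ (k - 1))))"
            using True r by (simp add: beta_w_def ac_simps)
          then show ?thesis unfolding e using True r by (simp add: rad_def ac_simps)
        qed (simp add: rad_def)
      qed
      finally show ?thesis .
    qed (simp add: beta_w_def)
  qed
  also have "\<dots> = (\<integral>\<^sup>+r. \<integral>\<^sup>+z. (\<phi> r * rad k r) * (h (r * z) * ennreal (z ^ (k + g) * (1 - z\<^sup>2) powr (real m / 2 - 1)) * indicator {0<..<1} z) \<partial>lborel \<partial>lborel)"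
    by (rule lborel_pair.Fubini') measurable
  also have "\<dots> = (\<integral>\<^sup>+r. (\<phi> r * rad k r) * J h m (k + g) r \<partial>lborel)"
    unfolding J_def by (intro nn_integral_cong nn_integral_cmult) measurable
  finally show ?thesis by (simp add: ac_simps)
qed

text \<open>The intervals differ by two null points. The absolute value turns \<open>HI\<close>,
  which is controlled on nonnegative arguments only, into a nonnegative function on the whole
  line.\<close>

lemma JH_eq_J:
  assumes "q \<le> n" "0 \<le> r" "\<And>s. 0 \<le> s \<Longrightarrow> 0 \<le> HI s"
  shows "JH HI n q r = J (\<lambda>s. ennreal (HI \<bar>s\<bar>)) (n - q) q r"
  unfolding JH_def J_def
proof (rule nn_integral_cong_AE, rule AE_mp[OF AE_lborel_singleton[of 0]], rule AE_mp[OF AE_lborel_singleton[of 1]], intro AE_I2 impI)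
  fix z :: real assume z: "z \<noteq> 1" "z \<noteq> 0"
  show "ennreal (HI (r * z) * z ^ q * (1 - z\<^sup>2) powr ((real n - real q) / 2 - 1)) * indicator {0..1} z
    = ennreal (HI \<bar>r * z\<bar>) * ennreal (z ^ q * (1 - z\<^sup>2) powr (real (n - q) / 2 - 1)) * indicator {0<..<1} z"
  proof (cases "0 < z \<and> z < 1")
    case True
    then have "0 \<le> r * z" using assms by simp
    then show ?thesis using True assms by (simp add: ennreal_mult[symmetric] of_nat_diff mult.assoc)
  qed (use z in \<open>auto simp: indicator_def\<close>)
qed

theorem theorem4p1:
  fixes H :: "(real^'n) set \<Rightarrow> real" and HI :: "real \<Rightarrow> real"
    and f :: "(real^'n) set \<Rightarrow> real" and q \<gamma> :: nat
  assumes "CARD('n) \<ge> 2" and "1 \<le> q" and "q \<le> CARD('n) - 1" and "\<gamma> < q"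
    and "H \<in> borel_measurable (mu (CARD('n) - q + \<gamma>))"
    and "\<forall>E\<in>AffGrass (CARD('n) - q + \<gamma>). H E \<ge> 0"
    and "\<forall>\<eta>\<in>rotations. \<forall>E\<in>AffGrass (CARD('n) - q + \<gamma>). H (\<eta> ` E) = H E"
    and "\<forall>r\<ge>0. HI r \<ge> 0"
    and "\<forall>E\<in>AffGrass (CARD('n) - q + \<gamma>). H E = HI (infdist 0 E)"
    and "f \<in> borel_measurable (mu \<gamma>)"
    and "\<forall>E\<in>AffGrass \<gamma>. f E \<ge> 0"
  shows "(\<integral>\<^sup>+ L. (\<integral>\<^sup>+ E. ennreal (f (E \<inter> L) * H E) \<partial>mu (CARD('n) - q + \<gamma>)) \<partial>nu q)
       = ennreal (Dconst CARD('n) q \<gamma>) *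
         (\<integral>\<^sup>+ E. ennreal (f E * infdist 0 E powr (- real (CARD('n) - q)))
                  * JH HI CARD('n) q (infdist 0 E) \<partial>mu \<gamma>)"
proof -
  \<comment> \<open>\<open>j\<close> is the dimension of \<open>E\<close>, \<open>m\<close> the
    codimension of \<open>L\<close> and \<open>k\<close> that of \<open>E\<close>; in general
    position the codimensions add up, so \<open>E \<inter> L\<close> has codimension
    \<open>k + m\<close>.\<close>
  define j where "j = CARD('n) - q + \<gamma>"
  define m where "m = CARD('n) - q"
  define k where "k = q - \<gamma>"
  have jq: "j + q = CARD('n) + \<gamma>" and q: "q < CARD('n)" and j: "j < CARD('n)" "0 < j" and g: "\<gamma> < CARD('n)"
    and m: "0 < m" and k: "0 < k" "CARD('n) - j = k" "k + \<gamma> = q" "CARD('n) - \<gamma> = k + m"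
    using assms(1-4) by (auto simp: j_def m_def k_def)
  note nj = assms(1) j(1) and nq = assms(1) q and ng = assms(1) g
  note A = assms[folded j_def]
  define h where "h = (\<lambda>r. ennreal (HI \<bar>r\<bar>))"
  let ?f = "\<lambda>E. ennreal (f E)"
  have f: "?f \<in> borel_measurable (set_sigma (AffGrass \<gamma>))"
    using A(10) by (simp add: measurable_cong_sets[OF sets_mu[OF ng] refl])
  \<comment> \<open>Measurability is given for \<open>H\<close>; composing \<open>H\<close> with a
    measurable section of flats transfers it to \<open>HI\<close> on absolute values, that is, to
    \<open>h\<close>.\<close>
  obtain F :: "real \<Rightarrow> (real^'n) set" where F: "\<And>r. F r \<in> AffGrass j" "\<And>r. infdist 0 (F r) = \<bar>r\<bar>"
    "F \<in> measurable borel (set_sigma (AffGrass j))" by (rule flat_section[OF j(1)]) blast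
  have "(\<lambda>r. H (F r)) \<in> borel_measurable borel"
    using measurable_compose[OF F(3)] A(5) by (simp add: measurable_cong_sets[OF sets_mu[OF nj] refl])
  then have h[measurable]: "h \<in> borel_measurable borel" using A(9) F by (simp add: h_def)
  obtain \<phi> where \<phi>[measurable]: "\<phi> \<in> borel_measurable borel"
    and av: "\<And>E :: (real^'n) set. E \<in> AffGrass \<gamma> \<Longrightarrow> (\<integral>\<^sup>+M. ?f ((*v) M ` E) \<partial>haar) = \<phi> (infdist 0 E)"
    using haar_average[OF ng f] by metis
  let ?C = "ennreal (omega (Suc \<gamma>) * omega m / omega (Suc \<gamma> + m))"
  let ?I = "\<integral>\<^sup>+r. \<phi> r * J h m q r * rad k r \<partial>lborel"
  have "(\<integral>\<^sup>+L. (\<integral>\<^sup>+E. ennreal (f (E \<inter> L) * H E) \<partial>mu j) \<partial>nu q)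
    = (\<integral>\<^sup>+L. \<integral>\<^sup>+E. meet \<gamma> ?f E L * h (infdist 0 E) \<partial>mu j \<partial>nu q)"
  proof (rule nn_integral_cong)
    fix L :: "(real^'n) set" assume "L \<in> space (nu q)"
    then have L: "L \<in> Grass q" by (simp add: space_nu[OF nq])
    show "(\<integral>\<^sup>+E. ennreal (f (E \<inter> L) * H E) \<partial>mu j) = (\<integral>\<^sup>+E. meet \<gamma> ?f E L * h (infdist 0 E) \<partial>mu j)"
      using AE_mu_transversal[OF nj j(2) L jq] AE_space
    proof (intro nn_integral_cong_AE, eventually_elim)
      fix E :: "(real^'n) set" assume d: "dim (direction E \<inter> L) = \<gamma>" and "E \<in> space (mu j)"
      then have E: "E \<in> AffGrass j" by (simp add: space_mu[OF nj])
      have "E \<inter> L \<in> AffGrass \<gamma>" by (rule Int_AffGrass(1)[OF E L d jq])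
      then show "ennreal (f (E \<inter> L) * H E) = meet \<gamma> ?f E L * h (infdist 0 E)"
        using A(9,11,6) E d by (simp add: meet_def h_def ennreal_mult infdist_nonneg)
    qed
  qed
  also have "\<dots> = (\<integral>\<^sup>+E. (\<integral>\<^sup>+L. meet \<gamma> (\<lambda>F. \<phi> (infdist 0 F)) E L \<partial>nu q) * h (infdist (0::real^'n) E) \<partial>mu j)"
    by (rule nn_integral_meet_average[OF nq A(4) jq f h \<phi> av])
  also have "\<dots> = (\<integral>\<^sup>+E. ?C * ((\<integral>\<^sup>+z. \<phi> (infdist (0::real^'n) E / z) * beta_w (Suc \<gamma>) m z \<partial>lborel) * h (infdist 0 E)) \<partial>mu j)"
    using AE_mu_infdist_pos[OF nj] AE_space
  proof (intro nn_integral_cong_AE, eventually_elim)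
    fix E :: "(real^'n) set" assume d: "infdist 0 E > 0" and "E \<in> space (mu j)"
    then have E: "E \<in> AffGrass j" by (simp add: space_mu[OF nj])
    show "(\<integral>\<^sup>+L. meet \<gamma> (\<lambda>F. \<phi> (infdist 0 F)) E L \<partial>nu q) * h (infdist 0 E)
      = ?C * ((\<integral>\<^sup>+z. \<phi> (infdist 0 E / z) * beta_w (Suc \<gamma>) m z \<partial>lborel) * h (infdist 0 E))"
      unfolding nn_integral_nu_meet[OF nq A(4) jq E d \<phi>] m_def[symmetric] by (rule mult.assoc)
  qed
  also have "\<dots> = (\<integral>\<^sup>+s. ?C * ((\<integral>\<^sup>+z. \<phi> (s / z) * beta_w (Suc \<gamma>) m z \<partial>lborel) * h s) * rad k s \<partial>lborel)"
    unfolding k(2)[symmetric]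
    by (rule nn_integral_mu_radial[OF nj, where \<phi> = "\<lambda>s. ?C * ((\<integral>\<^sup>+z. \<phi> (s / z) * beta_w (Suc \<gamma>) m z \<partial>lborel) * h s)"]) measurable
  also have "\<dots> = ?C * (\<integral>\<^sup>+s. (\<integral>\<^sup>+z. \<phi> (s / z) * beta_w (Suc \<gamma>) m z \<partial>lborel) * h s * rad k s \<partial>lborel)"
    unfolding mult.assoc by (rule nn_integral_cmult) measurable
  also have "\<dots> = ?C * ?I"
    using nn_integral_radial_meet[OF k(1) h \<phi>, of \<gamma> m] by (simp only: k(3))
  finally have lhs: "(\<integral>\<^sup>+L. (\<integral>\<^sup>+E. ennreal (f (E \<inter> L) * H E) \<partial>mu j) \<partial>nu q) = ?C * ?I" .
  let ?w = "\<lambda>r. ennreal (r powr (- real m)) * J h m q r"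
  have "(\<integral>\<^sup>+E. ennreal (f E * infdist 0 E powr (- real m)) * JH HI CARD('n) q (infdist 0 E) \<partial>mu \<gamma>)
    = (\<integral>\<^sup>+E. ?f E * ?w (infdist 0 E) \<partial>mu \<gamma>)"
  proof (rule nn_integral_cong)
    fix E :: "(real^'n) set" assume "E \<in> space (mu \<gamma>)"
    then have "E \<in> AffGrass \<gamma>" by (simp add: space_mu[OF ng])
    then have "0 \<le> f E" using A(11) by simp
    moreover have "JH HI CARD('n) q (infdist 0 E) = J h m q (infdist 0 E)"
      unfolding h_def m_def by (rule JH_eq_J) (use q A(8) in \<open>auto simp: infdist_nonneg\<close>)
    ultimately show "ennreal (f E * infdist 0 E powr (- real m)) * JH HI CARD('n) q (infdist 0 E) = ?f E * ?w (infdist 0 E)"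
      by (simp add: ennreal_mult mult.assoc)
  qed
  also have "\<dots> = (\<integral>\<^sup>+r. \<phi> r * ?w r * rad (CARD('n) - \<gamma>) r \<partial>lborel)"
    by (rule nn_integral_mu_average[OF ng f _ \<phi> av]) measurable
  also have "\<dots> = (\<integral>\<^sup>+r. ennreal (omega (k + m) / omega k) * (\<phi> r * J h m q r * rad k r) \<partial>lborel)"
  proof (rule nn_integral_cong)
    fix r :: real
    \<comment> \<open>The weight lowers the radial power of dimension \<open>k + m\<close> to that
      of dimension \<open>k\<close>; the sphere areas leave the factor
      \<open>omega (k + m) / omega k\<close>.\<close>
    have "ennreal (r powr (- real m)) * rad (k + m) r = ennreal (omega (k + m) / omega k) * rad k r"
    proof (cases "r > 0")
      case True
      have "r powr (- real m) * r ^ (k + m - 1) = r ^ (k - 1)"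
      proof -
        have "r ^ (k + m - 1) = r ^ (k - 1) * r ^ m" using k(1) by (cases k) (simp_all add: power_add)
        then show ?thesis using True by (simp add: powr_minus powr_realpow)
      qed
      then have "r powr (- real m) * (omega (k + m) * r ^ (k + m - 1)) = omega (k + m) / omega k * (omega k * r ^ (k - 1))"
        using omega_pos[OF k(1)] by (simp add: mult.left_commute)
      then show ?thesis using True omega_pos[OF k(1)] omega_pos[of "k + m"] k(1)
        by (simp add: rad_def ennreal_mult[symmetric])
    qed (simp add: rad_def)
    then have e: "\<phi> r * J h m q r * (ennreal (r powr (- real m)) * rad (k + m) r)
      = \<phi> r * J h m q r * (ennreal (omega (k + m) / omega k) * rad k r)" by (rule arg_cong)
    show "\<phi> r * ?w r * rad (CARD('n) - \<gamma>) r = ennreal (omega (k + m) / omega k) * (\<phi> r * J h m q r * rad k r)"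
      unfolding k(4) using e by (simp only: ac_simps)
  qed
  also have "\<dots> = ennreal (omega (k + m) / omega k) * ?I" by (rule nn_integral_cmult) measurable
  finally have rhs: "(\<integral>\<^sup>+E. ennreal (f E * infdist 0 E powr (- real m)) * JH HI CARD('n) q (infdist 0 E) \<partial>mu \<gamma>)
    = ennreal (omega (k + m) / omega k) * ?I" .
  have "ennreal (Dconst CARD('n) q \<gamma>) * ennreal (omega (k + m) / omega k) = ?C"
  proof -
    \<comment> \<open>This is the dimension of the linear span of \<open>E\<close>, in which the law
      of the projection was computed.\<close>
    have e: "CARD('n) - (q - \<gamma>) + 1 = Suc \<gamma> + m" using q A(4) by (simp add: m_def)
    have pos: "omega (Suc \<gamma>) > 0" "omega k > 0" "omega m > 0" "omega (Suc \<gamma> + m) > 0" "omega (k + m) > 0"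
      using k(1) m by (auto intro: omega_pos)
    have D: "Dconst CARD('n) q \<gamma> = omega (Suc \<gamma>) * omega k * omega m / (omega (Suc \<gamma> + m) * omega (k + m))"
      unfolding Dconst_def e k(4) by (simp add: k_def m_def)
    show ?thesis unfolding D using pos by (subst ennreal_mult[symmetric]) (auto simp: field_simps)
  qed
  then show ?thesis unfolding j_def[symmetric] unfolding m_def[symmetric] lhs rhs by (simp only: mult.assoc[symmetric])
qed

end
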